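(* Let $r=(\sqrt{17}-3)/4$. There is a one-to-one correspondence between compact packings of the plane using discs of radius $1$ and $r$ and tilings of the plane using rhombi with sides of length $2$ and acute angle $2\cos^{-1}\bigl(\tfrac{-1+\sqrt{17}}{4}\bigr)$ and equilateral triangles with sides of length $2$, where at least one such rhombus is used. Given a packing, the corresponding tiling is obtained by drawing the line segments between the centres of any pair of discs of radius $1$ that are tangent to each other. Conversely, given such a tiling, the corresponding packing is obtained by putting a disc of radius $1$ at each vertex of each triangle and each rhombus and then putting a pair of discs of radius $r$ inside each rhombus: the two are tangent to each other, both are tangent to the radius-$1$ discs at the two obtuse vertices of the rhombus, and each is tangent to the radius-$1$ disc at one of the two acute vertices (a different one for each).
   Context: A packing of the plane is a collection of closed discs in $\mathbb{R}^2$ with pairwise disjoint interiors. A packing is compact if for every disc $D$ of the packing, the discs of the packing tangent to $D$, listed in cyclic order around $D$ as $D_1,\dots,D_n$ (with $D_{n+1}=D_1$), are such that $D_i$ is tangent to $D_{i+1}$ for $i=1,\dots,n$, and this chain surrounds $D$: the angles, in $(0,\pi)$, at the centre of $D$ in the triangles with vertices the centres of $D,D_i,D_{i+1}$ sum to $2\pi$. A compact packing using discs of radius $1$ and $r$ is a compact packing in which every disc has radius $1$ or $r$ and discs of both radii occur.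
   Formalization: Tilings are required to be edge-to-edge (two tiles meet in nothing, a common vertex or a common edge); otherwise, e.g. after sliding half of a rhombus tiling along an edge line, the radius-1 discs at the vertices overlap and the claim fails. *)

theory Defs
  imports "HOL-Analysis.Analysis"
begin

text \<open>The plane is \<^typ>\<open>complex\<close>; a disc is a pair (centre, radius).\<close>

type_synonym disc = "complex \<times> real"

definition region :: "disc \<Rightarrow> complex set" where
  "region D = cball (fst D) (snd D)"

definition packing :: "disc set \<Rightarrow> bool" where
  "packing P \<longleftrightarrow> (\<forall>D\<in>P. 0 < snd D) \<and>
     pairwise (\<lambda>D E. interior (region D) \<inter> interior (region E) = {}) P"

text \<open>External tangency, the only kind that can occur between discs with disjoint interiors.\<close>

definition tangent :: "disc \<Rightarrow> disc \<Rightarrow> bool" where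
  "tangent D E \<longleftrightarrow> dist (fst D) (fst E) = snd D + snd E"

definition vertex_angle :: "complex \<Rightarrow> complex \<Rightarrow> complex \<Rightarrow> real" where
  "vertex_angle x v y = arccos (((x - v) \<bullet> (y - v)) / (norm (x - v) * norm (y - v)))"

text \<open>The list below enumerates the neighbours of \<open>D\<close> counterclockwise, by increasing polar angle
  in \<open>[0, 2\<pi>)\<close> around the centre of \<open>D\<close>. Where the list starts is immaterial, since the condition
  on it is invariant under rotation. For three mutually tangent discs \<^const>\<open>vertex_angle\<close> is
  automatically in \<open>(0, \<pi>)\<close>.\<close>

definition surrounded :: "disc set \<Rightarrow> disc \<Rightarrow> bool" where
  "surrounded P D \<longleftrightarrow> (\<exists>Ds.
     set Ds = {E \<in> P. tangent D E} \<and>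
     sorted_wrt (<) (map (\<lambda>E. Arg2pi (fst E - fst D)) Ds) \<and>
     (\<forall>i<length Ds. tangent (Ds ! i) (Ds ! (Suc i mod length Ds))) \<and>
     (\<Sum>i<length Ds. vertex_angle (fst (Ds ! i)) (fst D) (fst (Ds ! (Suc i mod length Ds)))) = 2 * pi)"

definition compact_packing :: "disc set \<Rightarrow> bool" where
  "compact_packing P \<longleftrightarrow> packing P \<and> (\<forall>D\<in>P. surrounded P D)"

definition compact_packing_using :: "real \<Rightarrow> real \<Rightarrow> disc set \<Rightarrow> bool" where
  "compact_packing_using s r P \<longleftrightarrow> compact_packing P \<and> snd ` P = {s, r}"

definition triangle_tile :: "complex set \<Rightarrow> bool" where
  "triangle_tile T \<longleftrightarrow> (\<exists>a b c. dist a b = 2 \<and> dist b c = 2 \<and> dist c a = 2 \<and>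
     T = convex hull {a, b, c})"

text \<open>Vertices in cyclic order, with the angle \<open>\<alpha>\<close> at \<open>a\<close> (hence also at \<open>c\<close>). Distinctness excludes
  the folded case \<open>a = c\<close>.\<close>

definition rhombus :: "real \<Rightarrow> complex \<Rightarrow> complex \<Rightarrow> complex \<Rightarrow> complex \<Rightarrow> bool" where
  "rhombus \<alpha> a b c d \<longleftrightarrow> distinct [a, b, c, d] \<and>
     dist a b = 2 \<and> dist b c = 2 \<and> dist c d = 2 \<and> dist d a = 2 \<and> vertex_angle b a d = \<alpha>"

definition rhombus_tile :: "real \<Rightarrow> complex set \<Rightarrow> bool" where
  "rhombus_tile \<alpha> T \<longleftrightarrow> (\<exists>a b c d. rhombus \<alpha> a b c d \<and> T = convex hull {a, b, c, d})"

text \<open>Tilings are edge-to-edge: two tiles meet in a common face, i.e. in the empty set, a common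
  vertex or a common edge (or coincide). Sliding a strip of tiles along a line gives tilings that
  are not edge-to-edge, and for those the unit discs at the vertices would overlap.\<close>

definition tiling :: "complex set set \<Rightarrow> bool" where
  "tiling \<T> \<longleftrightarrow> \<Union>\<T> = UNIV \<and>
     pairwise (\<lambda>S T. interior S \<inter> interior T = {}) \<T> \<and>
     (\<forall>S\<in>\<T>. \<forall>T\<in>\<T>. S \<inter> T face_of S \<and> S \<inter> T face_of T)"

definition rhombus_triangle_tiling :: "real \<Rightarrow> complex set set \<Rightarrow> bool" where
  "rhombus_triangle_tiling \<alpha> \<T> \<longleftrightarrow> tiling \<T> \<and>
     (\<forall>T\<in>\<T>. rhombus_tile \<alpha> T \<or> triangle_tile T) \<and> (\<exists>T\<in>\<T>. rhombus_tile \<alpha> T)"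

definition drawn_segments :: "disc set \<Rightarrow> complex set" where
  "drawn_segments P =
     \<Union>{closed_segment x y | x y. (x, 1) \<in> P \<and> (y, 1) \<in> P \<and> tangent (x, 1) (y, 1)}"

text \<open>The tiles are the closures of the regions into which the drawn segments cut the plane.\<close>

definition tiling_of_packing :: "disc set \<Rightarrow> complex set set" where
  "tiling_of_packing P = closure ` components (- drawn_segments P)"

definition small_pair ::
  "real \<Rightarrow> complex \<Rightarrow> complex \<Rightarrow> complex \<Rightarrow> complex \<Rightarrow> complex \<Rightarrow> complex \<Rightarrow> bool" where
  "small_pair r a b c d p q \<longleftrightarrow>
     region (p, r) \<subseteq> convex hull {a, b, c, d} \<and> region (q, r) \<subseteq> convex hull {a, b, c, d} \<and>
     tangent (p, r) (q, r) \<and>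
     tangent (p, r) (b, 1) \<and> tangent (p, r) (d, 1) \<and>
     tangent (q, r) (b, 1) \<and> tangent (q, r) (d, 1) \<and>
     tangent (p, r) (a, 1) \<and> tangent (q, r) (c, 1)"

text \<open>For a convex polygon the extreme points are its vertices.\<close>

definition packing_of_tiling :: "real \<Rightarrow> real \<Rightarrow> complex set set \<Rightarrow> disc set" where
  "packing_of_tiling r \<alpha> \<T> =
     {(v, 1) | v. \<exists>T\<in>\<T>. v extreme_point_of T} \<union>
     \<Union>{{(p, r), (q, r)} | p q. \<exists>a b c d. rhombus \<alpha> a b c d \<and> convex hull {a, b, c, d} \<in> \<T> \<and>
        small_pair r a b c d p q}"

end

theory Submission imports Defs begin

text \<open>
  Write \<open>\<rho>\<close> for the small radius and \<open>\<alpha>\<close> for the acute angle. All angles of triangles formed by the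
  centres of three mutually tangent discs are among \<open>\<pi>/3\<close>, \<open>\<alpha>/2\<close>, \<open>\<alpha>\<close>, \<open>\<pi> - \<alpha>\<close>, \<open>\<pi> - 2\<alpha>\<close>.

  From packings to tilings: since \<open>5\<pi>/12 < \<alpha> < \<pi>/2\<close>, the neighbours of a small disc are either six
  small discs or, in cyclic order, one small disc and three unit discs. The first kind would propagate
  to all neighbours, which is refuted by the disc of this kind that is nearest to a given unit disc.
  The second kind produces a rhombus. These rhombi and the triangles of mutually tangent unit discs
  cover the plane: a point whose nearest unit centre is \<open>v\<close> lies in the tile at \<open>v\<close> towards which it
  points. Two unit discs are at distance at least 2, so two segments of length 2 between unit centres
  meet only in a common end point or coincide; hence the drawn segments avoid the interiors of the
  tiles, which are therefore the components of the complement.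

  From tilings to packings: the tiles at a vertex cover the unit disc around it, so discs at different
  vertices are disjoint. A segment of length 2 between two vertices starts inside some tile at
  its first end point, and its other end point is at distance less than 2 from a vertex of that tile;
  hence it is an edge.
\<close>

section \<open>Angles of mutually tangent discs\<close>

text \<open>The number \<open>rho\<close> is the positive root of 2 rho^2 + 3 rho = 1. This equation
  says that a ring of one small and three unit discs closes up around a small disc: the angle there
  between two unit neighbours becomes supplementary to the angle between a unit and a small
  neighbour. The same equation expresses every angle between mutually tangent discs linearly in
  \<open>alph\<close> and pi, so the possible rings are found by linear arithmetic. The obstacle is
  that \<open>surrounded\<close> speaks of a sorted list and an angle sum, while tilings are about
  points and directions. The link is a covering by cones: every direction at a centre lies in a
  convex cone spanned by two neighbours tangent to each other. The list yields this covering, and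
  the covering, together with the absence of further neighbours in a cone, yields the list. Tiles
  are handled by the coordinates at one vertex, in \<open>corner\<close>, with triangles and rhombi
  side by side. One topological lemma recovers the tiles as components in both directions of the
  correspondence.\<close>

definition rho :: real where "rho = (sqrt 17 - 3) / 4"
definition alph :: real where "alph = 2 * arccos ((-1 + sqrt 17) / 4)"

lemma rho_eq: "2 * rho\<^sup>2 + 3 * rho = 1"
  by (simp add: rho_def power2_eq_square field_simps)

lemma rho_bounds: "1/4 < rho" "rho < 3/10"
proof -
  have "4 < sqrt 17" by (rule real_less_rsqrt) auto
  then show "1/4 < rho" by (simp add: rho_def)
  have "sqrt 17 < 42/10" by (rule real_less_lsqrt) (auto simp: power2_eq_square)
  then show "rho < 3/10" by (simp add: rho_def)
qed

lemma rho_pos: "0 < rho"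
  using rho_bounds by simp

lemma rho_square: "rho\<^sup>2 = (1 - 3 * rho) / 2" "rho * rho = (1 - 3 * rho) / 2"
  using rho_eq by (auto simp: power2_eq_square)

lemma cos_half_alph: "cos (alph / 2) = 1/2 + rho"
proof -
  have "(-1 + sqrt 17) / 4 = 1/2 + rho" by (simp add: rho_def field_simps)
  then show ?thesis unfolding alph_def using rho_bounds by simp
qed

lemma alph_half_range: "0 < alph / 2" "alph / 2 < pi/2"
proof -
  have *: "(-1 + sqrt 17) / 4 = 1/2 + rho" by (simp add: rho_def field_simps)
  have "0 < arccos (1/2+rho)" using rho_bounds arccos_lt_bounded[of "1/2+rho"] by auto
  moreover have "arccos (1/2+rho) < arccos 0" using rho_bounds by (intro arccos_less_mono[THEN iffD2]) auto
  ultimately show "0 < alph / 2" "alph / 2 < pi/2" unfolding alph_def * by auto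
qed

lemma cos_alph: "cos alph = 1/2 - rho"
proof -
  have "cos (2 * (alph/2)) = 2 * (cos (alph/2))\<^sup>2 - 1" by (rule cos_double_cos)
  also have "\<dots> = 1/2 - rho" unfolding cos_half_alph using rho_eq by (simp add: power2_eq_square field_simps)
  finally show ?thesis by simp
qed

lemma alph_eq: "alph = arccos (1/2 - rho)"
  using alph_half_range by (simp add: arccos_cos flip: cos_alph)

text \<open>These are the thresholds of the later case distinctions. At 5 pi/12 a small disc could
  have the ring of radii 1, \<open>rho\<close>, 1, \<open>rho\<close>, \<open>rho\<close>, whose
  angle sum is 4 \<open>alph\<close> + pi/3. The bound comes from cos(5 pi/12) = (sqrt 6 - sqrt
  2)/4, which exceeds 1/4, while 1/2 - \<open>rho\<close> is below 1/4.\<close>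

lemma alph_bounds: "pi/3 < alph" "alph < pi/2" "5*pi/12 < alph"
proof -
  show "alph < pi/2" unfolding alph_eq
    using arccos_less_mono[of "1/2-rho" 0] rho_bounds by auto
  have "5*pi/12 = pi/4 + pi/6" by simp
  then have "cos (5*pi/12) = sqrt 2/2 * (sqrt 3 /2) - sqrt 2 /2 * (1/2)"
    by (simp only: cos_add cos_45 cos_30 sin_45 sin_30)
  also have "\<dots> = (sqrt 6 - sqrt 2) / 4"
    by (simp add: field_simps flip: real_sqrt_mult)
  also have "\<dots> > 1/4"
  proof -
    have s2: "sqrt 2 < 3/2" by (rule real_less_lsqrt) (auto simp: power2_eq_square)
    have "1 + sqrt 2 < sqrt 6" by (rule real_less_rsqrt) (use s2 in \<open>auto simp: power2_eq_square algebra_simps\<close>)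
    then show ?thesis by simp
  qed
  finally have "1/2 - rho < cos (5*pi/12)" using rho_bounds by simp
  then have "arccos (cos (5*pi/12)) < alph" unfolding alph_eq
    using rho_bounds by (intro arccos_less_mono[THEN iffD2]) auto
  then show "5*pi/12 < alph" by (simp add: arccos_cos)
  then show "pi/3 < alph" using pi_gt_zero by linarith
qed

text \<open>The law of cosines at the centre of the disc of radius \<open>d\<close>, for the
  triangle with sides \<open>d + e\<close>, \<open>d + f\<close> and \<open>e + f\<close>, after
  cancelling a factor 2.\<close>

definition tri_angle :: "real \<Rightarrow> real \<Rightarrow> real \<Rightarrow> real" where
  "tri_angle d e f = arccos ((d\<^sup>2 + d*e + d*f - e*f) / ((d+e)*(d+f)))"

lemma vertex_angle_tangent:
  assumes "tangent D E" "tangent D F" "tangent E F" "0 < snd D" "0 < snd E" "0 < snd F"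
  shows "vertex_angle (fst E) (fst D) (fst F) = tri_angle (snd D) (snd E) (snd F)"
proof -
  have n: "norm (fst E - fst D) = snd D + snd E" "norm (fst F - fst D) = snd D + snd F"
     "norm (fst E - fst F) = snd E + snd F"
    using assms by (auto simp: tangent_def dist_norm norm_minus_commute)
  have "(fst E - fst D) \<bullet> (fst F - fst D) =
     ((norm (fst E - fst D))\<^sup>2 + (norm (fst F - fst D))\<^sup>2 - (norm (fst E - fst F))\<^sup>2)/2"
    by (simp add: dot_norm_neg)
  also have "\<dots> = (snd D)\<^sup>2 + snd D * snd E + snd D * snd F - snd E * snd F"
    unfolding n by (simp add: power2_eq_square field_simps)
  finally show ?thesis
    unfolding vertex_angle_def tri_angle_def n by simp
qed

lemma tri_angle_bounds:
  assumes "0 < d" "0 < e" "0 < f"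
  shows "0 < tri_angle d e f" "tri_angle d e f < pi"
proof -
  let ?c = "(d\<^sup>2 + d*e + d*f - e*f) / ((d+e)*(d+f))"
  have p: "0 < (d+e)*(d+f)" using assms by simp
  have "0 < d\<^sup>2" "0 < d*e" "0 < d*f" "0 < e*f" using assms by auto
  then have "-1 < ?c" "?c < 1"
    using p by (auto simp: pos_less_divide_eq pos_divide_less_eq power2_eq_square algebra_simps)
  then show "0 < tri_angle d e f" "tri_angle d e f < pi"
    unfolding tri_angle_def using arccos_lt_bounded by auto
qed

lemma tri_angle_swap: "tri_angle d e f = tri_angle d f e"
  by (simp add: tri_angle_def mult.commute add.commute add.left_commute diff_add_eq algebra_simps)

text \<open>All eight combinations of radii occur. Each cosine is a rational function of
  \<open>rho\<close>, which the quadratic equation reduces to the cosine of the stated angle. From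
  here on sums of angles can be compared by linear arithmetic and
  \<open>alph_bounds\<close>.\<close>

lemma tri_angle_values:
  "tri_angle rho 1 1 = pi - alph"
  "tri_angle rho 1 rho = alph" "tri_angle rho rho 1 = alph"
  "tri_angle rho rho rho = pi/3"
  "tri_angle 1 1 1 = pi/3"
  "tri_angle 1 1 rho = alph/2" "tri_angle 1 rho 1 = alph/2"
  "tri_angle 1 rho rho = pi - 2*alph"
proof -
  note s = rho_square
  have nz: "rho \<noteq> 0" "1 + rho \<noteq> 0" "rho + 1 \<noteq> 0" using rho_pos by auto
  have "rho\<^sup>2 + rho*1 + rho*1 - 1*1 = - (1/2 - rho) * ((rho+1)*(rho+1))"
    using rho_eq by algebra
  then have "(rho\<^sup>2 + rho*1 + rho*1 - 1*1) / ((rho+1)*(rho+1)) = - (1/2 - rho)"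
    using nz by (simp add: nonzero_divide_eq_eq)
  then show "tri_angle rho 1 1 = pi - alph"
    unfolding tri_angle_def using rho_bounds by (simp only: arccos_minus alph_eq)
  have "rho\<^sup>2 + rho*1 + rho*rho - 1*rho = (1/2 - rho) * ((rho+1)*(rho+rho))"
    using rho_eq by algebra
  then have "(rho\<^sup>2 + rho*1 + rho*rho - 1*rho) / ((rho+1)*(rho+rho)) = (1/2 - rho)"
    using rho_pos by (metis nonzero_eq_divide_eq add_pos_pos less_irrefl mult_pos_pos zero_less_one)
  then show "tri_angle rho 1 rho = alph"
    unfolding tri_angle_def by (simp only: alph_eq)
  then show "tri_angle rho rho 1 = alph" by (simp add: tri_angle_swap)
  have "(rho\<^sup>2 + rho*rho + rho*rho - rho*rho) / ((rho+rho)*(rho+rho)) = 1/2"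
    using nz by (simp add: divide_simps power2_eq_square)
  then show "tri_angle rho rho rho = pi/3"
    unfolding tri_angle_def by (simp only: arccos_one_half)
  show "tri_angle 1 1 1 = pi/3"
    by (simp add: tri_angle_def arccos_one_half)
  have "(1\<^sup>2 + 1*1 + 1*rho - 1*rho) / ((1+1)*(1+rho)) = cos (alph/2)"
    using nz s by (simp add: cos_half_alph divide_simps power2_eq_square; simp add: algebra_simps)
  then show "tri_angle 1 1 rho = alph/2"
    unfolding tri_angle_def using alph_half_range by (simp only: arccos_cos)
  then show "tri_angle 1 rho 1 = alph/2" by (simp add: tri_angle_swap)
  have "cos (pi - 2*alph) = 1 - 2 * (1/2 - rho)\<^sup>2"
    by (simp add: cos_double_cos cos_alph)
  also have "\<dots> = (1\<^sup>2 + 1*rho + 1*rho - rho*rho) / ((1+rho)*(1+rho))"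
  proof -
    have "(1 - 2 * (1/2 - rho)\<^sup>2) * ((1+rho)*(1+rho)) = 1 + rho + rho - rho*rho"
      using rho_eq by algebra
    then have "(1 - 2 * (1/2 - rho)\<^sup>2) * ((1+rho)*(1+rho)) = 1\<^sup>2 + 1*rho + 1*rho - rho*rho" by simp
    then show ?thesis using nz by (simp add: nonzero_eq_divide_eq)
  qed
  finally show "tri_angle 1 rho rho = pi - 2*alph"
    using arccos_cos[of "pi - 2*alph"] alph_bounds alph_half_range by (simp add: tri_angle_def)
qed

section \<open>Discs surrounding a disc\<close>

text \<open>The signed area of the parallelogram spanned by the two vectors. It is positive when the
  second vector lies counterclockwise from the first by less than pi, which makes it possible to
  describe cones without choosing arguments.\<close>

definition cross :: "complex \<Rightarrow> complex \<Rightarrow> real" where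
  "cross z w = Re z * Im w - Im z * Re w"

lemma cross_rcis: "cross (rcis R a) (rcis S b) = R * S * sin (b - a)"
  by (simp add: cross_def rcis_def sin_diff algebra_simps)

lemma rcis_Arg2pi: "rcis (norm z) (Arg2pi z) = z"
  using Arg2pi_eq[of z] by (simp add: rcis_def cis_conv_exp)

lemma inner_rcis: "rcis R a \<bullet> rcis S b = R * S * cos (b - a)"
  by (simp add: inner_complex_def rcis_def cos_diff algebra_simps)

text \<open>The expression \<open>arccos (cos (b - a))\<close> stays unsimplified, since the
  difference of two polar angles may exceed pi; that it does not will be a consequence of the angle
  sum.\<close>

lemma vertex_angle_rcis:
  assumes "0 < R" "0 < S" "x - v = rcis R a" "y - v = rcis S b"
  shows "vertex_angle x v y = arccos (cos (b - a))"
  using assms by (simp add: vertex_angle_def inner_rcis)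

lemma arccos_cos_le: "0 \<le> t \<Longrightarrow> arccos (cos t) \<le> t"
  using arccos_cos[of t] arccos_ubound[of "cos t"] by (cases "t \<le> pi") auto

lemma step_locate:
  fixes L :: "nat \<Rightarrow> real"
  assumes "L 0 \<le> x" "x < L n"
  shows "\<exists>i<n. L i \<le> x \<and> x < L (Suc i)"
  using assms
proof (induction n)
  case (Suc n)
  then show ?case by (cases "x < L n") (auto intro: less_SucI)
qed auto

text \<open>Lifts the cyclic sequence of polar angles to an increasing sequence of reals of length
  \<open>n + 1\<close>, so that the gap after the last entry is treated like the others.\<close>

definition lift_angle :: "complex \<Rightarrow> disc list \<Rightarrow> nat \<Rightarrow> real" where
  "lift_angle c Ds i = (if i < length Ds then Arg2pi (fst (Ds ! i) - c) else Arg2pi (fst (Ds ! 0) - c) + 2 * pi)"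

lemma lift_angle_rcis:
  assumes "i < length Ds"
  shows "rcis (norm (fst (Ds ! i) - c)) (lift_angle c Ds i) = fst (Ds ! i) - c"
    "rcis (norm (fst (Ds ! (Suc i mod length Ds)) - c)) (lift_angle c Ds (Suc i)) = fst (Ds ! (Suc i mod length Ds)) - c"
proof -
  show "rcis (norm (fst (Ds ! i) - c)) (lift_angle c Ds i) = fst (Ds ! i) - c"
    using assms by (simp add: lift_angle_def rcis_Arg2pi)
  show "rcis (norm (fst (Ds ! (Suc i mod length Ds)) - c)) (lift_angle c Ds (Suc i)) = fst (Ds ! (Suc i mod length Ds)) - c"
  proof (cases "Suc i < length Ds")
    case True then show ?thesis by (simp add: lift_angle_def rcis_Arg2pi)
  next
    case False
    then have e: "Suc i = length Ds" using assms by simp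
    have "rcis (norm (fst (Ds ! 0) - c)) (Arg2pi (fst (Ds ! 0) - c) + 2*pi) = rcis (norm (fst (Ds ! 0) - c)) (Arg2pi (fst (Ds ! 0) - c))"
      by (simp add: rcis_def cis_mult[symmetric])
    then show ?thesis using e by (simp add: lift_angle_def rcis_Arg2pi)
  qed
qed

lemma lift_angle_less:
  assumes "sorted_wrt (<) (map (\<lambda>E. Arg2pi (fst E - c)) Ds)" "i < length Ds"
  shows "lift_angle c Ds i < lift_angle c Ds (Suc i)"
proof (cases "Suc i < length Ds")
  case True
  then show ?thesis using assms by (auto simp: lift_angle_def sorted_wrt_iff_nth_less)
next
  case False
  then show ?thesis using assms Arg2pi[of "fst (Ds ! 0) - c"] Arg2pi[of "fst (Ds ! i) - c"]
    by (auto simp: lift_angle_def)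
qed

lemma sum_lift_angle:
  assumes "Ds \<noteq> []"
  shows "(\<Sum>i<length Ds. lift_angle c Ds (Suc i) - lift_angle c Ds i) = 2 * pi"
  by (subst sum_lessThan_telescope) (use assms in \<open>simp add: lift_angle_def\<close>)

section \<open>From the angle sum around a disc to cones spanned by tangent neighbours\<close>

lemma tangent_sym: "tangent D E \<Longrightarrow> tangent E D"
  by (simp add: tangent_def dist_commute)

text \<open>Consecutive polar angles differ by gaps that add up to 2 pi, as do the angles of the
  triangles. Each angle is at most its gap, hence equal to it, and therefore each gap is less than
  pi. So the sector between consecutive neighbours is a convex cone, and every direction falls into
  one of them.\<close>

lemma surrounded_cone:
  assumes sur: "surrounded P D" and pos: "\<And>E. E \<in> P \<Longrightarrow> 0 < snd E" and D: "D \<in> P" and u: "u \<noteq> 0"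
  shows "\<exists>E\<in>P. \<exists>F\<in>P. tangent D E \<and> tangent D F \<and> tangent E F \<and>
    0 < cross (fst E - fst D) (fst F - fst D) \<and>
    0 \<le> cross (fst E - fst D) u \<and> 0 \<le> cross u (fst F - fst D)"
proof -
  obtain Ds where Ds: "set Ds = {E \<in> P. tangent D E}"
     "sorted_wrt (<) (map (\<lambda>E. Arg2pi (fst E - fst D)) Ds)"
     "\<And>i. i<length Ds \<Longrightarrow> tangent (Ds ! i) (Ds ! (Suc i mod length Ds))"
     "(\<Sum>i<length Ds. vertex_angle (fst (Ds ! i)) (fst D) (fst (Ds ! (Suc i mod length Ds)))) = 2 * pi"
    using sur unfolding surrounded_def by blast
  define n where "n = length Ds"
  define c where "c = fst D"
  define L where "L = lift_angle c Ds"
  define z where "z i = fst (Ds ! i) - c" for i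
  have ne: "Ds \<noteq> []" using Ds(4) by auto
  have mem: "Ds ! i \<in> P" "tangent D (Ds ! i)" if "i < n" for i
    using that Ds(1) nth_mem[of i Ds] by (auto simp: n_def)
  have md: "Suc i mod n < n" for i using ne by (simp add: n_def)
  have zpos: "0 < norm (z i)" if "i < n" for i
  proof -
    have "norm (z i) = snd D + snd (Ds ! i)" using mem(2)[OF that]
      by (simp add: z_def c_def tangent_def dist_norm norm_minus_commute)
    then show ?thesis using pos[OF D] pos[OF mem(1)[OF that]] by simp
  qed
  have r1: "rcis (norm (z i)) (L i) = z i"
    and r2: "rcis (norm (z (Suc i mod n))) (L (Suc i)) = z (Suc i mod n)" if "i < n" for i
    using lift_angle_rcis[of i Ds c] that by (auto simp: z_def L_def n_def)
  have va: "vertex_angle (fst (Ds ! i)) c (fst (Ds ! (Suc i mod n))) = arccos (cos (L (Suc i) - L i))"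
    if "i < n" for i
    using vertex_angle_rcis[OF zpos[OF that] zpos[OF md]] r1[OF that] r2[OF that]
    by (metis z_def)
  have Lless: "L i < L (Suc i)" if "i < n" for i
    using lift_angle_less[OF Ds(2)] that by (simp add: L_def n_def c_def)
  have gap: "L (Suc i) - L i < pi" if i: "i < n" for i
  proof -
    \<comment> \<open>Two families with equal sums, one of them termwise at most the other, agree
      termwise.\<close>
    have "arccos (cos (L (Suc i) - L i)) = L (Suc i) - L i"
    proof (rule sum_mono_inv[where I = "{..<n}"])
      have "(\<Sum>i<n. L (Suc i) - L i) = 2*pi"
        using sum_lift_angle[OF ne] by (simp add: L_def n_def)
      moreover have "(\<Sum>i<n. arccos (cos (L (Suc i) - L i))) = 2*pi"
        using Ds(4) va by (simp add: n_def c_def)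
      ultimately show "(\<Sum>i<n. arccos (cos (L (Suc i) - L i))) = (\<Sum>i<n. L (Suc i) - L i)" by simp
    qed (use i Lless in \<open>auto intro!: arccos_cos_le simp: less_imp_le\<close>)
    moreover have "vertex_angle (fst (Ds ! i)) c (fst (Ds ! (Suc i mod n))) < pi"
      unfolding c_def
      using vertex_angle_tangent[OF mem(2)[OF i] mem(2)[OF md] Ds(3)[folded n_def, OF i]]
         tri_angle_bounds pos mem(1) i md D by metis
    ultimately show ?thesis using va[OF i] by simp
  qed
  \<comment> \<open>The lifted angles run through the window from \<open>L 0\<close> to
    \<open>L 0 + 2 * pi\<close>, whereas \<open>Arg2pi u\<close> is normalised to start at 0; adding
    at most one full turn moves it into the window.\<close>
  obtain k where k: "L 0 \<le> Arg2pi u + k" "Arg2pi u + k < L n" "k = 0 \<or> k = 2*pi"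
  proof (cases "L 0 \<le> Arg2pi u")
    case True
    have "L n = L 0 + 2*pi" using ne by (auto simp: L_def n_def lift_angle_def)
    moreover have "0 \<le> L 0" using ne by (auto simp: L_def lift_angle_def Arg2pi)
    ultimately show ?thesis using that[of 0] True Arg2pi[of u] by auto
  next
    case False
    have "L n = L 0 + 2*pi" using ne by (auto simp: L_def n_def lift_angle_def)
    moreover have "L 0 < 2*pi" using ne by (auto simp: L_def lift_angle_def Arg2pi)
    ultimately show ?thesis using that[of "2*pi"] False Arg2pi[of u] by auto
  qed
  have ur: "u = rcis (norm u) (Arg2pi u + k)"
    using k(3) rcis_Arg2pi[of u] by (auto simp: rcis_def cis_mult[symmetric])
  obtain i where i: "i < n" "L i \<le> Arg2pi u + k" "Arg2pi u + k < L (Suc i)"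
    using step_locate[OF k(1,2)] by blast
  let ?E = "Ds ! i" and ?F = "Ds ! (Suc i mod n)"
  have "0 < cross (z i) (z (Suc i mod n))"
    using gap[OF i(1)] Lless[OF i(1)] zpos[OF i(1)] zpos[OF md]
    by (subst r1[OF i(1), symmetric], subst r2[OF i(1), symmetric], simp only: cross_rcis) (auto intro!: mult_pos_pos sin_gt_zero)
  moreover have "0 \<le> cross (z i) u"
    using gap[OF i(1)] i zpos[OF i(1)]
    by (subst r1[OF i(1), symmetric], subst ur, simp only: cross_rcis) (auto intro!: mult_nonneg_nonneg sin_ge_zero)
  moreover have "0 \<le> cross u (z (Suc i mod n))"
    using gap[OF i(1)] i
    by (subst r2[OF i(1), symmetric], subst ur, simp only: cross_rcis) (auto intro!: mult_nonneg_nonneg sin_ge_zero)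
  ultimately show ?thesis
    using mem[OF i(1)] mem[OF md] Ds(3)[folded n_def, OF i(1)] unfolding z_def c_def by blast
qed

section \<open>From cones back to the cyclic list of neighbours\<close>

lemma cross_self [simp]: "cross z z = 0"
  by (simp add: cross_def)

lemma cross_swap: "cross w z = - cross z w"
  by (simp add: cross_def)

lemma Arg2pi_divide_le_pi:
  assumes "0 \<le> cross z w"
  shows "Arg2pi (w / z) \<le> pi"
proof -
  have "Im (w / z) = cross z w / (norm z)\<^sup>2"
    by (simp add: cross_def Im_divide cmod_power2 algebra_simps)
  then show ?thesis using assms by (simp add: Arg2pi_le_pi)
qed

lemma rcis_mult_Arg2pi_divide:
  assumes "z = rcis R a" "0 < R" "w \<noteq> 0"
  shows "w = rcis (norm w) (a + Arg2pi (w / z))"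
proof -
  have z: "z \<noteq> 0" "norm z = R" using assms by auto
  have "w = z * (w / z)" using z by simp
  also have "\<dots> = rcis R a * rcis (norm (w/z)) (Arg2pi (w/z))" using assms rcis_Arg2pi by metis
  also have "\<dots> = rcis (norm w) (a + Arg2pi (w / z))"
    using z assms(2) by (simp add: rcis_mult norm_divide)
  finally show ?thesis .
qed

text \<open>Arguments are measured from the middle vector \<open>g\<close>, going back to
  \<open>e\<close> and forward to \<open>f\<close>. This avoids the jump of \<open>Arg2pi\<close> at
  the positive real axis, which may run through the cone: \<open>a\<close> may be negative and
  \<open>c\<close> may exceed 2 pi.\<close>

lemma cone_angles:
  assumes "0 < cross e f" "0 \<le> cross e g" "0 \<le> cross g f" "g \<noteq> 0"
  obtains a b c where "e = rcis (norm e) a" "g = rcis (norm g) b" "f = rcis (norm f) c"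
    "a \<le> b" "b \<le> c" "c - a < pi" "b = Arg2pi g"
proof -
  have e: "e \<noteq> 0" and f: "f \<noteq> 0" using assms by (auto simp: cross_def)
  define s t where "s = Arg2pi (g / e)" and "t = Arg2pi (f / g)"
  define b where "b = Arg2pi g"
  have gb: "g = rcis (norm g) b" by (simp add: b_def rcis_Arg2pi)
  have st: "0 \<le> s" "s \<le> pi" "0 \<le> t" "t \<le> pi"
    using assms Arg2pi_divide_le_pi Arg2pi by (auto simp: s_def t_def)
  have fc: "f = rcis (norm f) (b + t)"
    unfolding t_def using assms(4) by (intro rcis_mult_Arg2pi_divide[OF gb _ f]) auto
  have ea: "e = rcis (norm e) (b - s)"
  proof -
    have "g / e = rcis (norm (g/e)) s" unfolding s_def by (simp add: rcis_Arg2pi)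
    then have "e = g / rcis (norm (g/e)) s" using e assms by (metis divide_divide_eq_right nonzero_mult_div_cancel_left mult.commute)
    also have "\<dots> = rcis (norm g) b / rcis (norm (g/e)) s" using gb by simp
    also have "\<dots> = rcis (norm e) (b - s)"
      using assms e by (simp add: rcis_divide norm_divide)
    finally show ?thesis .
  qed
  have "0 < norm e * norm f * sin ((b + t) - (b - s))"
    using assms(1) by (subst (asm) ea, subst (asm) fc, simp only: cross_rcis)
  then have "0 < sin (s + t)" using e f by (simp add: zero_less_mult_iff algebra_simps)
  \<comment> \<open>Both \<open>s\<close> and \<open>t\<close> lie between 0 and pi, so their sum is
    at most 2 pi, and a positive sine excludes the range from pi to 2 pi.\<close>
  then have "s + t < pi"
    using st sin_le_zero[of "s+t"] by (cases "s + t < pi") (auto simp: not_less, smt (verit) sin_two_pi sin_le_zero)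
  then show ?thesis using that[OF ea gb fc] st by (simp add: b_def)
qed

text \<open>The neighbours are sorted by argument. For two consecutive ones, the direction halfway
  between them lies in a cone of \<open>cov\<close>. The sides of this cone cannot fall strictly
  inside the gap, so the cone contains both consecutive neighbours, and \<open>nb\<close> identifies
  them with the sides. Hence they are tangent, the gap is less than pi and equals the angle of the
  triangle, and the gaps telescope to 2 pi.\<close>

lemma surroundedI:
  assumes fin: "finite {E \<in> P. tangent D E}"
    and pos: "\<And>E. E \<in> P \<Longrightarrow> 0 < snd E" and D: "D \<in> P"
    and cov: "\<And>u. u \<noteq> 0 \<Longrightarrow> \<exists>E\<in>P. \<exists>F\<in>P. tangent D E \<and> tangent D F \<and> tangent E F \<and>
      0 < cross (fst E - fst D) (fst F - fst D) \<and>
      0 \<le> cross (fst E - fst D) u \<and> 0 \<le> cross u (fst F - fst D)"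
    and nb: "\<And>E F G. \<lbrakk>E \<in> P; F \<in> P; G \<in> P; tangent D E; tangent D F; tangent D G; tangent E F;
      0 < cross (fst E - fst D) (fst F - fst D);
      0 \<le> cross (fst E - fst D) (fst G - fst D); 0 \<le> cross (fst G - fst D) (fst F - fst D)\<rbrakk>
      \<Longrightarrow> G = E \<or> G = F"
  shows "surrounded P D"
proof -
  define N where "N = {E \<in> P. tangent D E}"
  define z where "z E = fst E - fst D" for E :: disc
  have zpos: "0 < norm (z E)" if "E \<in> N" for E
    using that pos[OF D] pos[of E]
    by (auto simp: N_def z_def tangent_def dist_norm norm_minus_commute)
  have cov': "\<exists>E\<in>N. \<exists>F\<in>N. tangent E F \<and> 0 < cross (z E) (z F) \<and> 0 \<le> cross (z E) u \<and> 0 \<le> cross u (z F)"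
    if "u \<noteq> 0" for u
    using cov[OF that] unfolding N_def z_def by blast
  have nb': "G = E \<or> G = F" if "E \<in> N" "F \<in> N" "G \<in> N" "tangent E F" "0 < cross (z E) (z F)"
    "0 \<le> cross (z E) (z G)" "0 \<le> cross (z G) (z F)" for E F G
    using nb that unfolding N_def z_def by blast
  have finN: "finite N" using fin by (simp add: N_def)
  define \<theta> where "\<theta> E = Arg2pi (z E)" for E
  \<comment> \<open>Two neighbours in the same direction lie in the same cone, so by
    \<open>nb\<close> both are sides of it; but the two sides of a cone have positive
    \<open>cross\<close> and hence different directions.\<close>
  have inj: "inj_on \<theta> N"
  proof (rule inj_onI, rule ccontr)
    fix G H assume GH: "G \<in> N" "H \<in> N" "\<theta> G = \<theta> H" "G \<noteq> H"
    obtain E F where EF: "E \<in> N" "F \<in> N" "tangent E F" "0 < cross (z E) (z F)"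
      "0 \<le> cross (z E) (z G)" "0 \<le> cross (z G) (z F)"
      using cov'[of "z G"] zpos[OF GH(1)] by auto
    have eq: "z H = (norm (z H) / norm (z G)) *\<^sub>R z G"
      using rcis_Arg2pi[of "z G"] rcis_Arg2pi[of "z H"] GH(3) zpos[OF GH(1)]
      unfolding \<theta>_def rcis_def
      by (metis (no_types, lifting) less_irrefl mult.assoc nonzero_divide_eq_eq of_real_mult scaleR_conv_of_real)
    define k where "k = norm (z H) / norm (z G)"
    have k: "0 < k" using zpos GH by (simp add: k_def)
    have zH: "z H = k *\<^sub>R z G" using eq by (simp add: k_def)
    have "cross (z E) (z H) = k * cross (z E) (z G)" "cross (z H) (z F) = k * cross (z G) (z F)"
      "cross (z G) (z H) = 0" "cross (z H) (z G) = 0"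
      unfolding zH by (auto simp: cross_def algebra_simps)
    then have "H = E \<or> H = F" using nb'[of E F H] EF GH k by auto
    moreover have "G = E \<or> G = F" using nb'[of E F G] EF GH by auto
    ultimately show False using EF(4) GH(4) \<open>cross (z G) (z H) = 0\<close> \<open>cross (z H) (z G) = 0\<close> by auto
  qed
  define Ds where "Ds = map (inv_into N \<theta>) (sorted_list_of_set (\<theta> ` N))"
  define n where "n = length Ds"
  have setDs: "set Ds = N"
    unfolding Ds_def using finN inj by (simp add: inv_into_image_cancel)
  have mapDs: "map \<theta> Ds = sorted_list_of_set (\<theta> ` N)"
    unfolding Ds_def map_map using finN by (intro map_idI) (auto simp: f_inv_into_f)
  have sorted: "sorted_wrt (<) (map \<theta> Ds)"
    unfolding mapDs by simp
  have "N \<noteq> {}" using cov'[of 1] by auto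
  then have ne: "Ds \<noteq> []" using setDs by auto
  define L where "L = lift_angle (fst D) Ds"
  have md: "Suc i mod n < n" for i using ne by (simp add: n_def)
  have mem: "Ds ! i \<in> N" if "i < n" for i using that setDs nth_mem[of i Ds] by (simp add: n_def)
  have r1: "rcis (norm (z (Ds!i))) (L i) = z (Ds!i)"
    and r2: "rcis (norm (z (Ds!(Suc i mod n)))) (L (Suc i)) = z (Ds!(Suc i mod n))" if "i < n" for i
    using lift_angle_rcis[of i Ds "fst D"] that by (auto simp: z_def L_def n_def)
  have Lless: "L i < L (Suc i)" if "i < n" for i
    using lift_angle_less[of "fst D" Ds i] sorted that by (simp add: L_def n_def \<theta>_def[abs_def] z_def)
  have nth_less: "\<theta> (Ds!i) < \<theta> (Ds!j)" if "i < j" "j < n" for i j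
    using sorted that by (auto simp: sorted_wrt_iff_nth_less n_def)
  have Lnth: "L i = \<theta> (Ds!i)" if "i < n" for i
    using that by (simp add: L_def lift_angle_def n_def \<theta>_def z_def)
  have Llast: "L n = \<theta> (Ds!0) + 2*pi"
    by (simp add: L_def lift_angle_def n_def \<theta>_def z_def)
  have \<theta>b: "0 \<le> \<theta> E" "\<theta> E < 2*pi" for E by (auto simp: \<theta>_def Arg2pi)
  \<comment> \<open>No neighbour has a lifted angle strictly inside a gap. In the last gap the angle
    may reach 2 pi or more; reduced by a full turn it would then precede the first entry of the
    list.\<close>
  have avoid: False if G: "G \<in> N" "z G = rcis (norm (z G)) \<gamma>" and i: "i < n" "L i < \<gamma>" "\<gamma> < L (Suc i)" for G \<gamma> i
  proof -
    obtain j where j: "j < n" "Ds!j = G" using G(1) setDs by (metis in_set_conv_nth n_def)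
    have th: "\<theta> G = \<delta>" if "z G = rcis (norm (z G)) \<delta>" "0 \<le> \<delta>" "\<delta> < 2*pi" for \<delta>
      unfolding \<theta>_def using that zpos[OF G(1)]
      by (intro Arg2pi_unique[of "norm (z G)"]) (auto simp: rcis_def cis_conv_exp)
    have ti: "\<not> (\<theta> (Ds!i) < \<theta> G \<and> (Suc i < n \<longrightarrow> \<theta> G < \<theta> (Ds!Suc i)))"
    proof (cases "j \<le> i")
      case True then show ?thesis using nth_less[of j i] i(1) j by (cases "j = i") auto
    next
      case False then show ?thesis using nth_less[of "Suc i" j] i(1) j by (cases "j = Suc i") auto
    qed
    show False
    proof (cases "\<gamma> < 2*pi")
      case True
      then have "\<theta> G = \<gamma>" using th[OF G(2)] i(2) Lnth[OF i(1)] \<theta>b(1)[of "Ds!i"] by simp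
      then show False using ti i Lnth by auto
    next
      case False
      then have S: "Suc i = n" using i Lnth[of "Suc i"] \<theta>b(2)[of "Ds!Suc i"] by (cases "Suc i < n") auto
      then have g: "\<gamma> - 2*pi < \<theta> (Ds!0)" using i(3) Llast by simp
      have "z G = rcis (norm (z G)) (\<gamma> - 2*pi)"
        by (subst G(2)) (simp add: rcis_def cis_divide[symmetric])
      then have "\<theta> G = \<gamma> - 2*pi" using th g False \<theta>b(2)[of "Ds!0"] by simp
      then show False using g nth_less[of 0 j] j by (cases "j = 0") auto
    qed
  qed
  have main: "tangent (Ds!i) (Ds!(Suc i mod n)) \<and>
     vertex_angle (fst (Ds!i)) (fst D) (fst (Ds!(Suc i mod n))) = L (Suc i) - L i" if i: "i < n" for i
  proof -
    define \<psi> where "\<psi> = (L i + L (Suc i)) / 2"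
    define u where "u = cis \<psi>"
    have \<psi>: "L i < \<psi>" "\<psi> < L (Suc i)" using Lless[OF i] by (auto simp: \<psi>_def)
    obtain E F where EF: "E \<in> N" "F \<in> N" "tangent E F" "0 < cross (z E) (z F)"
      "0 \<le> cross (z E) u" "0 \<le> cross u (z F)"
      using cov'[of u] by (auto simp: u_def)
    obtain a b c where abc: "z E = rcis (norm (z E)) a" "u = rcis (norm u) b" "z F = rcis (norm (z F)) c"
      "a \<le> b" "b \<le> c" "c - a < pi"
      using cone_angles[OF EF(4-6)] by (metis cis_neq_zero u_def)
    \<comment> \<open>The angles obtained for the cone are relative to the normalised argument of
      \<open>u\<close>. The shift \<open>k\<close> is a full number of turns, as
      \<open>cis k = 1\<close>, and brings them to the branch on which \<open>u\<close> has angle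
      \<psi>.\<close>
    define k where "k = \<psi> - b"
    have ck: "cis k = 1"
    proof -
      have "cis \<psi> = cis b" using abc(2) by (simp add: u_def rcis_def)
      then show ?thesis by (simp add: k_def cis_divide[symmetric])
    qed
    have sh: "rcis R (x + k) = rcis R x" for R x by (simp add: rcis_def cis_mult[symmetric] ck)
    have zE: "z E = rcis (norm (z E)) (a + k)" and zF: "z F = rcis (norm (z F)) (c + k)"
      using abc by (auto simp only: sh)
    have ab: "a + k \<le> \<psi>" "\<psi> \<le> c + k" "(c + k) - (a + k) < pi" using abc by (auto simp: k_def)
    \<comment> \<open>The side \<open>E\<close> has angle at most \<psi>, which is below
      \<open>L (Suc i)\<close>; being outside the gap, it must be at or before \<open>L i\<close>.
      The side \<open>F\<close> is treated in the mirrored way.\<close>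
    have aL: "a + k \<le> L i" using avoid[OF EF(1) zE i] ab \<psi> by force
    have cL: "L (Suc i) \<le> c + k" using avoid[OF EF(2) zF i] ab \<psi> by force
    have in_cone: "G = E \<or> G = F" if "G \<in> N" "z G = rcis (norm (z G)) g" "a + k \<le> g" "g \<le> c + k" for G g
    proof (rule nb'[OF EF(1,2) that(1) EF(3,4)])
      show "0 \<le> cross (z E) (z G)"
        by (subst zE, subst that(2), simp only: cross_rcis)
          (use that ab in \<open>auto intro!: mult_nonneg_nonneg sin_ge_zero\<close>)
      show "0 \<le> cross (z G) (z F)"
        by (subst zF, subst that(2), simp only: cross_rcis)
          (use that ab in \<open>auto intro!: mult_nonneg_nonneg sin_ge_zero\<close>)
    qed
    let ?A = "Ds ! i" and ?B = "Ds ! (Suc i mod n)"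
    have A: "?A = E \<or> ?A = F" by (rule in_cone[OF mem[OF i] r1[OF i, symmetric]]) (use aL cL \<psi> in auto)
    have B: "?B = E \<or> ?B = F" by (rule in_cone[OF mem[OF md] r2[OF i, symmetric]]) (use aL cL \<psi> in auto)
    have gap: "0 < L (Suc i) - L i" "L (Suc i) - L i < pi" using Lless[OF i] aL cL ab by auto
    have "0 < cross (z ?A) (z ?B)"
      by (subst r1[OF i, symmetric], subst r2[OF i, symmetric], simp only: cross_rcis)
        (use gap zpos[OF mem[OF i]] zpos[OF mem[OF md]] in \<open>auto intro!: mult_pos_pos sin_gt_zero\<close>)
    then have "?A \<noteq> ?B" by auto
    then have "tangent ?A ?B" using A B EF(3) tangent_sym[OF EF(3)] by auto
    moreover have "vertex_angle (fst ?A) (fst D) (fst ?B) = arccos (cos (L (Suc i) - L i))"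
      using vertex_angle_rcis[OF zpos[OF mem[OF i]] zpos[OF mem[OF md]]] r1[OF i] r2[OF i]
      by (metis z_def)
    moreover have "arccos (cos (L (Suc i) - L i)) = L (Suc i) - L i"
      using gap by (intro arccos_cos) auto
    ultimately show ?thesis by simp
  qed
  have "(\<Sum>i<n. vertex_angle (fst (Ds!i)) (fst D) (fst (Ds!(Suc i mod n)))) = 2 * pi"
    using sum_lift_angle[OF ne, of "fst D"] main by (simp add: L_def n_def)
  moreover have "sorted_wrt (<) (map (\<lambda>E. Arg2pi (fst E - fst D)) Ds)"
    using sorted by (simp add: \<theta>_def[abs_def] z_def)
  ultimately show ?thesis
    unfolding surrounded_def using main setDs by (intro exI[of _ Ds]) (auto simp: n_def N_def)
qed

section \<open>No room for a third neighbour between two tangent neighbours\<close>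

lemma vertex_angle_ge_tri_angle:
  assumes "tangent D E" "tangent D F" "0 < snd D" "0 < snd E" "0 < snd F"
    and "snd E + snd F \<le> dist (fst E) (fst F)"
  shows "tri_angle (snd D) (snd E) (snd F) \<le> vertex_angle (fst E) (fst D) (fst F)"
proof -
  let ?d = "snd D" and ?e = "snd E" and ?f = "snd F"
  have n: "norm (fst E - fst D) = ?d + ?e" "norm (fst F - fst D) = ?d + ?f"
    using assms by (auto simp: tangent_def dist_norm norm_minus_commute)
  have le: "(?e + ?f)\<^sup>2 \<le> (norm (fst E - fst F))\<^sup>2"
    using assms by (intro power_mono) (auto simp: dist_norm)
  let ?I = "(fst E - fst D) \<bullet> (fst F - fst D)" and ?p = "(?d + ?e) * (?d + ?f)"
  have p: "0 < ?p" using assms by simp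
  have "?I = ((norm (fst E - fst D))\<^sup>2 + (norm (fst F - fst D))\<^sup>2 - (norm (fst E - fst F))\<^sup>2)/2"
    by (simp add: dot_norm_neg)
  also have "\<dots> \<le> ?d\<^sup>2 + ?d * ?e + ?d * ?f - ?e * ?f"
    using le unfolding n by (simp add: power2_eq_square field_simps)
  finally have 1: "?I / ?p \<le> (?d\<^sup>2 + ?d * ?e + ?d * ?f - ?e * ?f) / ?p"
    using p by (intro divide_right_mono) auto
  have "\<bar>?I\<bar> \<le> ?p" using Cauchy_Schwarz_ineq2[of "fst E - fst D" "fst F - fst D"] by (simp add: n)
  then have 2: "-1 \<le> ?I / ?p" using p by (simp add: pos_le_divide_eq)
  have "0 < ?e * ?f" using assms by simp
  then have 3: "(?d\<^sup>2 + ?d * ?e + ?d * ?f - ?e * ?f) / ?p \<le> 1"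
    using p by (simp add: pos_divide_le_eq power2_eq_square algebra_simps)
  show ?thesis unfolding tri_angle_def vertex_angle_def n
    using 1 2 3 by (intro arccos_le_arccos) auto
qed

text \<open>This is a check of all sixteen combinations of radii. The bound
  \<open>pi/3 < alph\<close> decides cases such as a small disc between two unit discs around a unit
  disc, where the claim reads pi/3 < \<open>alph\<close>.\<close>

lemma tri_angle_triangle_inequality:
  assumes "d \<in> {1, rho}" "e \<in> {1, rho}" "f \<in> {1, rho}" "g \<in> {1, rho}"
  shows "tri_angle d e f < tri_angle d e g + tri_angle d g f"
proof -
  have "0 < alph" "0 < pi" using alph_bounds pi_gt_zero by linarith+
  then show ?thesis using assms alph_bounds
    by (elim insertE emptyE; simp only: tri_angle_values; linarith)
qed

text \<open>If \<open>G\<close> were a third disc, the angle between \<open>E\<close> and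
  \<open>F\<close> would be the sum of the angles from \<open>E\<close> to \<open>G\<close> and from
  \<open>G\<close> to \<open>F\<close>. Discs that do not overlap subtend at least the angle of the
  tangent position, so this sum is too large by the preceding inequality.\<close>

lemma no_disc_between:
  assumes tan: "tangent D E" "tangent D F" "tangent D G" "tangent E F"
    and rad: "snd D \<in> {1, rho}" "snd E \<in> {1, rho}" "snd F \<in> {1, rho}" "snd G \<in> {1, rho}"
    and sep: "G \<noteq> E \<Longrightarrow> snd E + snd G \<le> dist (fst E) (fst G)"
      "G \<noteq> F \<Longrightarrow> snd G + snd F \<le> dist (fst G) (fst F)"
    and cone: "0 < cross (fst E - fst D) (fst F - fst D)"
      "0 \<le> cross (fst E - fst D) (fst G - fst D)" "0 \<le> cross (fst G - fst D) (fst F - fst D)"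
  shows "G = E \<or> G = F"
proof (rule ccontr)
  assume ne: "\<not> (G = E \<or> G = F)"
  have pos: "0 < snd D" "0 < snd E" "0 < snd F" "0 < snd G"
    using rad rho_pos by auto
  have np: "0 < norm (fst E - fst D)" "0 < norm (fst F - fst D)" "0 < norm (fst G - fst D)"
    using tan pos by (auto simp: tangent_def dist_norm norm_minus_commute)
  then have "fst G - fst D \<noteq> 0" by auto
  from cone_angles[OF cone this] obtain a b c where abc:
    "fst E - fst D = rcis (norm (fst E - fst D)) a"
    "fst G - fst D = rcis (norm (fst G - fst D)) b"
    "fst F - fst D = rcis (norm (fst F - fst D)) c"
    "a \<le> b" "b \<le> c" "c - a < pi" by metis
  have "vertex_angle (fst E) (fst D) (fst F) = c - a"
    using abc(4-6) by (subst vertex_angle_rcis[OF np(1) np(2) abc(1) abc(3)]) (auto intro: arccos_cos)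
  moreover have "vertex_angle (fst E) (fst D) (fst G) = b - a"
    using abc(4-6) by (subst vertex_angle_rcis[OF np(1) np(3) abc(1) abc(2)]) (auto intro: arccos_cos)
  moreover have "vertex_angle (fst G) (fst D) (fst F) = c - b"
    using abc(4-6) by (subst vertex_angle_rcis[OF np(3) np(2) abc(2) abc(3)]) (auto intro: arccos_cos)
  ultimately show False
    using vertex_angle_tangent[OF tan(1,2,4) pos(1-3)]
      vertex_angle_ge_tri_angle[OF tan(1,3) pos(1,2,4)] vertex_angle_ge_tri_angle[OF tan(3,2) pos(1,4,3)]
      sep ne tri_angle_triangle_inequality[OF rad] by force
qed

section \<open>Triangles and rhombi of side length 2\<close>

definition tri_at :: "complex \<Rightarrow> complex \<Rightarrow> complex \<Rightarrow> complex set" where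
  "tri_at v b c = {v + s *\<^sub>R b + t *\<^sub>R c | s t. 0 \<le> s \<and> 0 \<le> t \<and> s + t \<le> 1}"

definition par_at :: "complex \<Rightarrow> complex \<Rightarrow> complex \<Rightarrow> complex set" where
  "par_at v b c = {v + s *\<^sub>R b + t *\<^sub>R c | s t. 0 \<le> s \<and> s \<le> 1 \<and> 0 \<le> t \<and> t \<le> 1}"

text \<open>The only property of the rhombi used for the elementary geometry of a tile is that the cosine
  of their angles is at most \<open>1/4\<close> in absolute value.\<close>

definition corner :: "complex set \<Rightarrow> complex \<Rightarrow> complex \<Rightarrow> complex \<Rightarrow> bool" where
  "corner T v b c \<longleftrightarrow> norm b = 2 \<and> norm c = 2 \<and>
     (b \<bullet> c = 2 \<and> T = tri_at v b c \<or> \<bar>b \<bullet> c\<bar> \<le> 1 \<and> T = par_at v b c)"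

lemma tri_atI: "x = v + s *\<^sub>R b + t *\<^sub>R c \<Longrightarrow> 0 \<le> s \<Longrightarrow> 0 \<le> t \<Longrightarrow> s + t \<le> 1 \<Longrightarrow> x \<in> tri_at v b c"
  by (auto simp: tri_at_def)

lemma par_atI:
  "x = v + s *\<^sub>R b + t *\<^sub>R c \<Longrightarrow> 0 \<le> s \<Longrightarrow> s \<le> 1 \<Longrightarrow> 0 \<le> t \<Longrightarrow> t \<le> 1 \<Longrightarrow> x \<in> par_at v b c"
  by (auto simp: par_at_def)

lemma convex_hull_tri: "convex hull {v, v + b, v + c} = tri_at v b c"
proof
  have "convex (tri_at v b c)"
  proof (rule convexI)
    fix x y u w assume "x \<in> tri_at v b c" "y \<in> tri_at v b c" and uw: "0 \<le> u" "0 \<le> w" "u + w = (1::real)"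
    then obtain s t s' t' where st: "x = v + s *\<^sub>R b + t *\<^sub>R c" "0 \<le> s" "0 \<le> t" "s + t \<le> 1"
      "y = v + s' *\<^sub>R b + t' *\<^sub>R c" "0 \<le> s'" "0 \<le> t'" "s' + t' \<le> 1" by (auto simp: tri_at_def)
    have "u *\<^sub>R x + w *\<^sub>R y = (u + w) *\<^sub>R v + (u * s + w * s') *\<^sub>R b + (u * t + w * t') *\<^sub>R c"
      unfolding st by (simp add: algebra_simps)
    moreover have "u * (s + t) + w * (s' + t') \<le> u * 1 + w * 1"
      using st uw by (intro add_mono mult_left_mono) auto
    ultimately show "u *\<^sub>R x + w *\<^sub>R y \<in> tri_at v b c"
      using st(2-4,6-8) uw
      by (intro tri_atI[of _ _ "u * s + w * s'" _ "u * t + w * t'"]) (auto simp: algebra_simps)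
  qed
  moreover have "{v, v + b, v + c} \<subseteq> tri_at v b c"
    using tri_atI[of _ v 0 b 0 c] tri_atI[of _ v 1 b 0 c] tri_atI[of _ v 0 b 1 c] by auto
  ultimately show "convex hull {v, v + b, v + c} \<subseteq> tri_at v b c" by (intro hull_minimal) auto
  show "tri_at v b c \<subseteq> convex hull {v, v + b, v + c}"
  proof
    fix x assume "x \<in> tri_at v b c"
    then obtain s t where st: "x = v + s *\<^sub>R b + t *\<^sub>R c" "0 \<le> s" "0 \<le> t" "s + t \<le> 1"
      by (auto simp: tri_at_def)
    then have "x = (1 - s - t) *\<^sub>R v + s *\<^sub>R (v + b) + t *\<^sub>R (v + c)" by (simp add: algebra_simps)
    then show "x \<in> convex hull {v, v + b, v + c}" unfolding convex_hull_3 mem_Collect_eq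
      by (rule_tac exI[of _ "1 - s - t"], rule_tac exI[of _ s], rule_tac exI[of _ t]) (use st in auto)
  qed
qed

lemma convex_hull_par: "convex hull {v, v + b, v + b + c, v + c} = par_at v b c"
proof
  have "convex (par_at v b c)"
  proof (rule convexI)
    fix x y u w assume "x \<in> par_at v b c" "y \<in> par_at v b c" and uw: "0 \<le> u" "0 \<le> w" "u + w = (1::real)"
    then obtain s t s' t' where st: "x = v + s *\<^sub>R b + t *\<^sub>R c" "0 \<le> s" "0 \<le> t" "s \<le> 1" "t \<le> 1"
      "y = v + s' *\<^sub>R b + t' *\<^sub>R c" "0 \<le> s'" "0 \<le> t'" "s' \<le> 1" "t' \<le> 1" by (auto simp: par_at_def)
    have "u *\<^sub>R x + w *\<^sub>R y = (u + w) *\<^sub>R v + (u * s + w * s') *\<^sub>R b + (u * t + w * t') *\<^sub>R c"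
      unfolding st by (simp add: algebra_simps)
    moreover have "u * s + w * s' \<le> u * 1 + w * 1" "u * t + w * t' \<le> u * 1 + w * 1"
      using st uw by (intro add_mono mult_left_mono; simp)+
    ultimately show "u *\<^sub>R x + w *\<^sub>R y \<in> par_at v b c"
      using st(2-5,7-10) uw
      by (intro par_atI[of _ _ "u * s + w * s'" _ "u * t + w * t'"]) auto
  qed
  moreover have "{v, v + b, v + b + c, v + c} \<subseteq> par_at v b c"
    using par_atI[of _ v 0 b 0 c] par_atI[of _ v 1 b 0 c] par_atI[of _ v 0 b 1 c] par_atI[of _ v 1 b 1 c] by auto
  ultimately show "convex hull {v, v + b, v + b + c, v + c} \<subseteq> par_at v b c" by (intro hull_minimal) auto
  show "par_at v b c \<subseteq> convex hull {v, v + b, v + b + c, v + c}" (is "_ \<subseteq> ?H")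
  proof
    fix x assume "x \<in> par_at v b c"
    then obtain s t where st: "x = v + s *\<^sub>R b + t *\<^sub>R c" "0 \<le> s" "0 \<le> t" "s \<le> 1" "t \<le> 1"
      by (auto simp: par_at_def)
    have H: "v \<in> ?H" "v + b \<in> ?H" "v + b + c \<in> ?H" "v + c \<in> ?H" by (auto intro: hull_inc)
    have H': "(1 - s) *\<^sub>R v + s *\<^sub>R (v + b) \<in> ?H" "(1 - s) *\<^sub>R (v + c) + s *\<^sub>R (v + b + c) \<in> ?H"
      by (intro convexD[OF convex_convex_hull] H; use st in simp)+
    have "(1 - t) *\<^sub>R ((1 - s) *\<^sub>R v + s *\<^sub>R (v + b)) + t *\<^sub>R ((1 - s) *\<^sub>R (v + c) + s *\<^sub>R (v + b + c)) \<in> ?H"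
      by (intro convexD[OF convex_convex_hull] H'; use st in simp)
    also have "(1 - t) *\<^sub>R ((1 - s) *\<^sub>R v + s *\<^sub>R (v + b)) + t *\<^sub>R ((1 - s) *\<^sub>R (v + c) + s *\<^sub>R (v + b + c)) = x"
      unfolding st by (simp add: algebra_simps)
    finally show "x \<in> ?H" .
  qed
qed

lemma tri_at_swap: "tri_at v c b = tri_at v b c"
  unfolding convex_hull_tri[symmetric] by (simp add: insert_commute)

lemma tri_at_next: "tri_at (v + b) (c - b) (- b) = tri_at v b c"
  unfolding convex_hull_tri[symmetric] by (simp add: insert_commute)

lemma par_at_swap: "par_at v c b = par_at v b c"
  unfolding convex_hull_par[symmetric] by (simp add: insert_commute algebra_simps)

lemma par_at_next: "par_at (v + b) (- b) c = par_at v b c"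
  unfolding convex_hull_par[symmetric] by (simp add: insert_commute algebra_simps)

lemma corner_swap: "corner T v b c \<Longrightarrow> corner T v c b"
  by (auto simp: corner_def tri_at_swap par_at_swap inner_commute)

text \<open>Together with \<open>corner_swap\<close> this walks around the tile, so that a fact
  proved at one vertex holds at all of them. The first edge vector at the new vertex leads back to
  the old one; the conditional equations for \<open>c'\<close> record the other edge where the shape
  is known.\<close>

lemma corner_next:
  assumes "corner T v b c"
  obtains c' where "corner T (v + b) (- b) c'" "b \<bullet> c = 2 \<Longrightarrow> T = tri_at v b c \<Longrightarrow> c' = c - b"
    "T = par_at v b c \<Longrightarrow> \<bar>b \<bullet> c\<bar> \<le> 1 \<Longrightarrow> c' = c"
proof (cases "b \<bullet> c = 2 \<and> T = tri_at v b c")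
  case True
  have "(norm (c - b))\<^sup>2 = 2\<^sup>2"
    using assms True by (simp add: corner_def dot_square_norm[symmetric] inner_diff inner_commute)
      (simp add: dot_square_norm)
  then have n: "norm (c - b) = 2" by (metis norm_ge_zero power2_eq_imp_eq zero_le_numeral)
  have "(c - b) \<bullet> (- b) = 2" using assms True
    by (simp add: corner_def inner_diff inner_commute dot_square_norm)
  then have "corner T (v + b) (c - b) (- b)"
    using assms True n by (simp add: corner_def tri_at_next)
  then show ?thesis using True that[of "c - b"] corner_swap by auto
next
  case False
  then have "corner T (v + b) (- b) c" using assms by (auto simp: corner_def par_at_next)
  then show ?thesis using False that[of c] by auto
qed

lemma corner_inner: "corner T v b c \<Longrightarrow> -1 \<le> b \<bullet> c \<and> b \<bullet> c \<le> 2"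
  by (auto simp: corner_def)

lemma corner_norm: "corner T v b c \<Longrightarrow> norm b = 2 \<and> norm c = 2"
  by (auto simp: corner_def)

lemma corner_inner_self: "corner T v b c \<Longrightarrow> b \<bullet> b = 4 \<and> c \<bullet> c = 4"
  by (auto simp: corner_def dot_square_norm)

lemma norm_comb_general:
  assumes "norm b = 2" "norm c = 2"
  shows "(norm (s *\<^sub>R b + t *\<^sub>R c))\<^sup>2 = 4 * s\<^sup>2 + 4 * t\<^sup>2 + 2 * (b \<bullet> c) * s * t"
proof -
  have "(norm (s *\<^sub>R b + t *\<^sub>R c))\<^sup>2 = s * (s * (b \<bullet> b)) + t * (t * (c \<bullet> c)) + 2 * (b \<bullet> c) * s * t"
    by (simp add: dot_square_norm[symmetric] inner_add inner_commute algebra_simps)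
  then show ?thesis using assms by (simp add: dot_square_norm power2_eq_square)
qed

lemma norm_comb:
  assumes "corner T v b c"
  shows "(norm (s *\<^sub>R b + t *\<^sub>R c))\<^sup>2 = 4 * s\<^sup>2 + 4 * t\<^sup>2 + 2 * (b \<bullet> c) * s * t"
  using corner_norm[OF assms] by (simp add: norm_comb_general)

text \<open>The point with coordinates \<open>s\<close>, \<open>t\<close> is at distance 2 |s| sin
  \<theta> from the line along \<open>c\<close>, where \<theta> is the angle between
  \<open>b\<close> and \<open>c\<close>. As \<theta> lies between 60 and 120 degrees, the square of
  this distance is at least 3 s^2.\<close>

lemma comb_coord_bound:
  assumes bc: "norm b = 2" "norm c = 2" "\<bar>b \<bullet> c\<bar> \<le> 2"
  shows "3 * s\<^sup>2 \<le> (norm (s *\<^sub>R b + t *\<^sub>R c))\<^sup>2" "3 * t\<^sup>2 \<le> (norm (s *\<^sub>R b + t *\<^sub>R c))\<^sup>2"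
proof -
  have k4: "(b \<bullet> c)\<^sup>2 \<le> 4" using abs_le_square_iff[of "b \<bullet> c" 2] bc by simp
  have "3 * s\<^sup>2 \<le> 4 * s\<^sup>2 + 4 * t\<^sup>2 + 2 * (b \<bullet> c) * s * t" for s t
  proof -
    have "4 * s\<^sup>2 + 4 * t\<^sup>2 + 2 * (b \<bullet> c) * s * t = (2 * t + (b \<bullet> c) * s / 2)\<^sup>2 + (4 - (b \<bullet> c)\<^sup>2/4) * s\<^sup>2"
      by (simp add: power2_eq_square field_simps)
    moreover have "3 * s\<^sup>2 \<le> (4 - (b \<bullet> c)\<^sup>2/4) * s\<^sup>2" using k4 by (intro mult_right_mono) auto
    ultimately show ?thesis using zero_le_power2[of "2 * t + (b \<bullet> c) * s / 2"] by linarith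
  qed
  from this[of s t] this[of t s] show "3 * s\<^sup>2 \<le> (norm (s *\<^sub>R b + t *\<^sub>R c))\<^sup>2" "3 * t\<^sup>2 \<le> (norm (s *\<^sub>R b + t *\<^sub>R c))\<^sup>2"
    unfolding norm_comb_general[OF bc(1,2)] by (auto simp: algebra_simps)
qed

lemma cross_inner_square: "(cross b c)\<^sup>2 + (b \<bullet> c)\<^sup>2 = (norm b)\<^sup>2 * (norm c)\<^sup>2"
  unfolding cmod_power2 by (simp add: cross_def inner_complex_def power2_eq_square algebra_simps)

lemma corner_cross: assumes "corner T v b c" shows "cross b c \<noteq> 0"
proof
  assume "cross b c = 0"
  then have "(b \<bullet> c)\<^sup>2 = 16" using cross_inner_square[of b c] corner_norm[OF assms] by simp
  moreover have "\<bar>b \<bullet> c\<bar> \<le> 2" using assms by (auto simp: corner_def)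
  then have "\<bar>b \<bullet> c\<bar>\<^sup>2 \<le> 2\<^sup>2" by (intro power_mono) auto
  ultimately show False by simp
qed

text \<open>Cramer's rule, with the coordinates written as inner products with fixed vectors. The
  sides of a tile then become hyperplanes in the form expected by the library on faces, and
  continuity of the coordinates is automatic.\<close>

lemma dual_basis:
  assumes "cross b c \<noteq> 0"
  obtains S Q where "\<And>y. y = (S \<bullet> y) *\<^sub>R b + (Q \<bullet> y) *\<^sub>R c"
    "S \<bullet> b = 1" "S \<bullet> c = 0" "Q \<bullet> b = 0" "Q \<bullet> c = 1"
proof
  define S where "S = (1 / cross b c) *\<^sub>R Complex (Im c) (- Re c)"
  define Q where "Q = (1 / cross b c) *\<^sub>R Complex (- Im b) (Re b)"
  have S: "S \<bullet> y = cross y c / cross b c" and Q: "Q \<bullet> y = cross b y / cross b c" for y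
    by (auto simp: S_def Q_def inner_complex_def cross_def algebra_simps diff_divide_distrib)
  show "y = (S \<bullet> y) *\<^sub>R b + (Q \<bullet> y) *\<^sub>R c" for y
  proof -
    have "cross b c *\<^sub>R y = cross y c *\<^sub>R b + cross b y *\<^sub>R c"
      by (simp add: complex_eq_iff cross_def algebra_simps)
    then have "y = (1 / cross b c) *\<^sub>R (cross y c *\<^sub>R b + cross b y *\<^sub>R c)"
      using assms by (metis divide_self_if mult.commute scaleR_one scaleR_scaleR times_divide_eq_left divide_inverse)
    then show ?thesis by (simp add: S Q scaleR_add_right)
  qed
  show "S \<bullet> b = 1" "S \<bullet> c = 0" "Q \<bullet> b = 0" "Q \<bullet> c = 1" using assms by (auto simp: S Q)
qed

lemma corner_coords:
  assumes "corner T v b c"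
  obtains S Q where "\<And>y. y = (S \<bullet> y) *\<^sub>R b + (Q \<bullet> y) *\<^sub>R c"
    "S \<bullet> b = 1" "S \<bullet> c = 0" "Q \<bullet> b = 0" "Q \<bullet> c = 1"
    "b \<bullet> c = 2 \<and> (\<forall>x. x \<in> T \<longleftrightarrow> 0 \<le> S \<bullet> (x - v) \<and> 0 \<le> Q \<bullet> (x - v) \<and> S \<bullet> (x - v) + Q \<bullet> (x - v) \<le> 1) \<and> T = tri_at v b c \<or>
     \<bar>b \<bullet> c\<bar> \<le> 1 \<and> (\<forall>x. x \<in> T \<longleftrightarrow> 0 \<le> S \<bullet> (x - v) \<and> S \<bullet> (x - v) \<le> 1 \<and> 0 \<le> Q \<bullet> (x - v) \<and> Q \<bullet> (x - v) \<le> 1) \<and> T = par_at v b c"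
proof -
  obtain S Q where SQ: "\<And>y. y = (S \<bullet> y) *\<^sub>R b + (Q \<bullet> y) *\<^sub>R c"
    "S \<bullet> b = 1" "S \<bullet> c = 0" "Q \<bullet> b = 0" "Q \<bullet> c = 1"
    using dual_basis[OF corner_cross[OF assms]] by blast
  have e: "v + y = v + s *\<^sub>R b + t *\<^sub>R c \<longleftrightarrow> s = S \<bullet> y \<and> t = Q \<bullet> y" for y s t
  proof
    assume "v + y = v + s *\<^sub>R b + t *\<^sub>R c"
    then have "y = s *\<^sub>R b + t *\<^sub>R c" by (simp add: add.assoc)
    then show "s = S \<bullet> y \<and> t = Q \<bullet> y" using SQ(2-5) by (simp add: inner_add_right)
  next
    assume "s = S \<bullet> y \<and> t = Q \<bullet> y"
    then show "v + y = v + s *\<^sub>R b + t *\<^sub>R c" using SQ(1)[of y] by (simp add: add.assoc)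
  qed
  have "v + y \<in> tri_at v b c \<longleftrightarrow> 0 \<le> S \<bullet> y \<and> 0 \<le> Q \<bullet> y \<and> S \<bullet> y + Q \<bullet> y \<le> 1"
    "v + y \<in> par_at v b c \<longleftrightarrow> 0 \<le> S \<bullet> y \<and> S \<bullet> y \<le> 1 \<and> 0 \<le> Q \<bullet> y \<and> Q \<bullet> y \<le> 1" for y
    by (auto simp: tri_at_def par_at_def e)
  from this[of "_ - v"] show ?thesis using that[OF SQ] assms by (auto simp: corner_def)
qed

lemma corner_hull:
  assumes "corner T v b c"
  obtains V where "finite V" "T = convex hull V" "v \<in> V"
    "V = {v, v + b, v + c} \<and> T = tri_at v b c \<and> b \<bullet> c = 2 \<or>
     V = {v, v + b, v + b + c, v + c} \<and> T = par_at v b c \<and> \<bar>b \<bullet> c\<bar> \<le> 1"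
  using assms that unfolding corner_def
  by (metis convex_hull_tri convex_hull_par finite.emptyI finite_insert insertI1)

lemma corner_convex: "corner T v b c \<Longrightarrow> convex T"
  by (metis corner_hull convex_convex_hull)

lemma corner_compact: "corner T v b c \<Longrightarrow> compact T"
  by (metis corner_hull compact_convex_hull finite_imp_compact)

lemma corner_mem:
  assumes "corner T v b c" shows "v \<in> T" "v + b \<in> T" "v + c \<in> T"
  using corner_hull[OF assms] by (metis hull_inc insertCI)+

text \<open>The second coordinate is nonnegative on the tile and vanishes exactly on this edge, so
  the edge is cut out by a supporting line.\<close>

lemma corner_edge_face:
  assumes "corner T v b c"
  shows "closed_segment v (v + b) face_of T"
proof -
  obtain S Q where SQ: "\<And>y. y = (S \<bullet> y) *\<^sub>R b + (Q \<bullet> y) *\<^sub>R c"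
    "S \<bullet> b = 1" "S \<bullet> c = 0" "Q \<bullet> b = 0" "Q \<bullet> c = 1"
    and T: "b \<bullet> c = 2 \<and> (\<forall>x. x \<in> T \<longleftrightarrow> 0 \<le> S \<bullet> (x - v) \<and> 0 \<le> Q \<bullet> (x - v) \<and> S \<bullet> (x - v) + Q \<bullet> (x - v) \<le> 1) \<and> T = tri_at v b c \<or>
     \<bar>b \<bullet> c\<bar> \<le> 1 \<and> (\<forall>x. x \<in> T \<longleftrightarrow> 0 \<le> S \<bullet> (x - v) \<and> S \<bullet> (x - v) \<le> 1 \<and> 0 \<le> Q \<bullet> (x - v) \<and> Q \<bullet> (x - v) \<le> 1) \<and> T = par_at v b c"
    by (metis corner_coords[OF assms])
  have "T \<inter> {x. Q \<bullet> x = Q \<bullet> v} face_of T"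
  proof (rule face_of_Int_supporting_hyperplane_ge[OF corner_convex[OF assms]])
    fix x assume "x \<in> T"
    then have "0 \<le> Q \<bullet> (x - v)" using T by metis
    then show "Q \<bullet> v \<le> Q \<bullet> x" by (simp add: inner_diff_right)
  qed
  moreover have "T \<inter> {x. Q \<bullet> x = Q \<bullet> v} = closed_segment v (v + b)"
  proof (rule set_eqI)
    fix x
    have "x \<in> closed_segment v (v + b) \<longleftrightarrow> (\<exists>u. 0 \<le> u \<and> u \<le> 1 \<and> x - v = u *\<^sub>R b)"
    proof -
      have "x = (1 - u) *\<^sub>R v + u *\<^sub>R (v + b) \<longleftrightarrow> x - v = u *\<^sub>R b" for u
        by (auto simp: algebra_simps)
      then show ?thesis by (auto simp: in_segment)
    qed
    also have "\<dots> \<longleftrightarrow> 0 \<le> S \<bullet> (x - v) \<and> S \<bullet> (x - v) \<le> 1 \<and> Q \<bullet> (x - v) = 0"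
    proof
      assume "\<exists>u. 0 \<le> u \<and> u \<le> 1 \<and> x - v = u *\<^sub>R b"
      then show "0 \<le> S \<bullet> (x - v) \<and> S \<bullet> (x - v) \<le> 1 \<and> Q \<bullet> (x - v) = 0" using SQ(2-5) by auto
    next
      assume "0 \<le> S \<bullet> (x - v) \<and> S \<bullet> (x - v) \<le> 1 \<and> Q \<bullet> (x - v) = 0"
      then show "\<exists>u. 0 \<le> u \<and> u \<le> 1 \<and> x - v = u *\<^sub>R b"
        using SQ(1)[of "x - v"] by (intro exI[of _ "S \<bullet> (x - v)"]) auto
    qed
    also have "\<dots> \<longleftrightarrow> x \<in> T \<inter> {x. Q \<bullet> x = Q \<bullet> v}"
      using T by (elim disjE conjE) (simp_all add: inner_diff_right, (smt (verit))+)
    finally show "x \<in> T \<inter> {x. Q \<bullet> x = Q \<bullet> v} \<longleftrightarrow> x \<in> closed_segment v (v + b)" by simp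
  qed
  ultimately show ?thesis by simp
qed

lemma corner_extreme:
  assumes "corner T v b c" shows "v extreme_point_of T"
proof -
  have "closed_segment v (v + b) \<inter> closed_segment v (v + c) face_of T"
    using corner_edge_face[OF assms] corner_edge_face[OF corner_swap[OF assms]] face_of_Int by blast
  moreover have "closed_segment v (v + b) \<inter> closed_segment v (v + c) = {v}"
  proof (intro equalityI subsetI)
    fix x assume x: "x \<in> closed_segment v (v + b) \<inter> closed_segment v (v + c)"
    then obtain s t where st: "x = (1 - s) *\<^sub>R v + s *\<^sub>R (v + b)" "x = (1 - t) *\<^sub>R v + t *\<^sub>R (v + c)"
      unfolding Int_iff in_segment by blast
    then have "s *\<^sub>R b = t *\<^sub>R c" by (simp add: algebra_simps)
    then have "cross (s *\<^sub>R b) c = cross (t *\<^sub>R c) c" by simp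
    then have "s * cross b c = 0" by (simp add: cross_def algebra_simps)
    then have "s = 0" using corner_cross[OF assms] by simp
    then show "x \<in> {v}" using st by simp
  qed auto
  ultimately show ?thesis by (simp add: face_of_singleton)
qed

lemma corner_at_extreme:
  assumes "corner T v b c" "w extreme_point_of T"
  shows "\<exists>b' c'. corner T w b' c'"
proof -
  obtain V where V: "T = convex hull V"
    "V = {v, v + b, v + c} \<and> T = tri_at v b c \<and> b \<bullet> c = 2 \<or>
     V = {v, v + b, v + b + c, v + c} \<and> T = par_at v b c \<and> \<bar>b \<bullet> c\<bar> \<le> 1"
    using corner_hull[OF assms(1)] by metis
  then have "w \<in> V" using assms(2) extreme_point_of_convex_hull by metis
  moreover have "\<exists>b' c'. corner T (v + b) b' c'" using corner_next[OF assms(1)] by metis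
  moreover have "\<exists>b' c'. corner T (v + c) b' c'" using corner_next[OF corner_swap[OF assms(1)]] by metis
  moreover have "\<exists>b' c'. corner T (v + b + c) b' c'" if "T = par_at v b c" "\<bar>b \<bullet> c\<bar> \<le> 1"
    using corner_next[OF assms(1)] corner_next[OF corner_swap] that by metis
  ultimately show ?thesis using assms(1) V by blast
qed

text \<open>Only the diagonal of a parallelogram needs an argument: its squared length is 8 + 2 (b
  \<bullet> c), which is at least 6. It is thus longer than an edge, and a vertex at distance
  exactly 2 is joined to \<open>v\<close> by an edge.\<close>

lemma corner_vertex_dist:
  assumes "corner T v b c" "w extreme_point_of T" "w \<noteq> v"
  shows "2 \<le> dist v w" "dist v w = 2 \<Longrightarrow> w = v + b \<or> w = v + c"
proof -
  obtain V where V: "T = convex hull V"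
    "V = {v, v + b, v + c} \<and> T = tri_at v b c \<and> b \<bullet> c = 2 \<or>
     V = {v, v + b, v + b + c, v + c} \<and> T = par_at v b c \<and> \<bar>b \<bullet> c\<bar> \<le> 1"
    using corner_hull[OF assms(1)] by metis
  then have w: "w \<in> V" using assms(2) extreme_point_of_convex_hull by metis
  have "2\<^sup>2 < (norm (b + c))\<^sup>2"
    using norm_comb[OF assms(1), of 1 1] corner_inner[OF assms(1)] by simp
  then have "2 < norm (b + c)" by (metis norm_ge_zero power2_less_imp_less)
  then have "2 < dist v (v + b + c)" unfolding dist_norm by (subst norm_minus_commute) (simp add: add.assoc)
  then show "2 \<le> dist v w" "dist v w = 2 \<Longrightarrow> w = v + b \<or> w = v + c"
    using w V assms(3) corner_norm[OF assms(1)] by (auto simp: dist_norm)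
qed

text \<open>The points where all inequalities describing the tile are strict form an open subset of
  it. At any other point one inequality is an equality, and each of these equalities describes one
  edge; the edges away from \<open>v\<close> are reached by moving to an adjacent vertex.\<close>

lemma corner_not_interior_edge:
  assumes c: "corner T v b c" and x: "x \<in> T" "x \<notin> interior T"
  shows "\<exists>v b c. corner T v b c \<and> x \<in> closed_segment v (v + b)"
proof -
  obtain S Q where SQ: "\<And>y. y = (S \<bullet> y) *\<^sub>R b + (Q \<bullet> y) *\<^sub>R c"
    "S \<bullet> b = 1" "S \<bullet> c = 0" "Q \<bullet> b = 0" "Q \<bullet> c = 1"
    and T: "b \<bullet> c = 2 \<and> (\<forall>x. x \<in> T \<longleftrightarrow> 0 \<le> S \<bullet> (x - v) \<and> 0 \<le> Q \<bullet> (x - v) \<and> S \<bullet> (x - v) + Q \<bullet> (x - v) \<le> 1) \<and> T = tri_at v b c \<or>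
     \<bar>b \<bullet> c\<bar> \<le> 1 \<and> (\<forall>x. x \<in> T \<longleftrightarrow> 0 \<le> S \<bullet> (x - v) \<and> S \<bullet> (x - v) \<le> 1 \<and> 0 \<le> Q \<bullet> (x - v) \<and> Q \<bullet> (x - v) \<le> 1) \<and> T = par_at v b c"
    by (metis corner_coords[OF c])
  define s t where "s = S \<bullet> (x - v)" and "t = Q \<bullet> (x - v)"
  have xst: "x = v + s *\<^sub>R b + t *\<^sub>R c"
    using SQ(1)[of "x - v"] by (simp add: s_def t_def algebra_simps)
  have op: "open {x. 0 < S \<bullet> (x - v)}" "open {x. 0 < Q \<bullet> (x - v)}" "open {x. S \<bullet> (x - v) < 1}" "open {x. Q \<bullet> (x - v) < 1}"
     "open {x. S \<bullet> (x - v) + Q \<bullet> (x - v) < 1}"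
    by (intro open_Collect_less continuous_intros)+
  obtain c' where c': "corner T (v + b) (- b) c'" "b \<bullet> c = 2 \<Longrightarrow> T = tri_at v b c \<Longrightarrow> c' = c - b"
    "T = par_at v b c \<Longrightarrow> \<bar>b \<bullet> c\<bar> \<le> 1 \<Longrightarrow> c' = c" using corner_next[OF c] by blast
  obtain b' where b': "corner T (v + c) (- c) b'" "T = par_at v b c \<Longrightarrow> \<bar>b \<bullet> c\<bar> \<le> 1 \<Longrightarrow> b' = b"
    using corner_next[OF corner_swap[OF c]] by (metis par_at_swap inner_commute)
  have sw: "t = 0 \<Longrightarrow> 0 \<le> s \<Longrightarrow> s \<le> 1 \<Longrightarrow> x \<in> closed_segment v (v + b)"
    "s = 0 \<Longrightarrow> 0 \<le> t \<Longrightarrow> t \<le> 1 \<Longrightarrow> x \<in> closed_segment v (v + c)"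
    unfolding in_segment xst by (rule exI[of _ s], simp add: algebra_simps, rule exI[of _ t], simp add: algebra_simps)
  from T show ?thesis
  proof (elim disjE conjE)
    assume tri: "b \<bullet> c = 2" "\<forall>x. x \<in> T \<longleftrightarrow> 0 \<le> S \<bullet> (x - v) \<and> 0 \<le> Q \<bullet> (x - v) \<and> S \<bullet> (x - v) + Q \<bullet> (x - v) \<le> 1" "T = tri_at v b c"
    let ?U = "{x. 0 < S \<bullet> (x - v)} \<inter> {x. 0 < Q \<bullet> (x - v)} \<inter> {x. S \<bullet> (x - v) + Q \<bullet> (x - v) < 1}"
    have "?U \<subseteq> T"
      by (intro subsetI, subst tri(2)[THEN spec]) (simp add: less_imp_le)
    then have "?U \<subseteq> interior T" using op by (intro interior_maximal) auto
    then have "\<not> (0 < s \<and> 0 < t \<and> s + t < 1)" using x by (auto simp: s_def t_def)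
    moreover have st: "0 \<le> s" "0 \<le> t" "s + t \<le> 1"
      using tri(2)[rule_format, of x] x by (auto simp: s_def t_def)
    ultimately consider "s = 0" | "t = 0" | "s + t = 1" by linarith
    then show ?thesis
    proof cases
      case 3
      have "x \<in> closed_segment (v + b) (v + b + (c - b))"
        unfolding in_segment xst using 3 st by (intro exI[of _ t]) (simp add: algebra_simps flip: scaleR_left_distrib)
      then show ?thesis using c' tri corner_swap by metis
    qed (use sw st c corner_swap[OF c] in auto)
  next
    assume par: "\<bar>b \<bullet> c\<bar> \<le> 1" "\<forall>x. x \<in> T \<longleftrightarrow> 0 \<le> S \<bullet> (x - v) \<and> S \<bullet> (x - v) \<le> 1 \<and> 0 \<le> Q \<bullet> (x - v) \<and> Q \<bullet> (x - v) \<le> 1" "T = par_at v b c"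
    let ?U = "{x. 0 < S \<bullet> (x - v)} \<inter> {x. 0 < Q \<bullet> (x - v)} \<inter> {x. S \<bullet> (x - v) < 1} \<inter> {x. Q \<bullet> (x - v) < 1}"
    have "?U \<subseteq> T"
      by (intro subsetI, subst par(2)[THEN spec]) (simp add: less_imp_le)
    then have "?U \<subseteq> interior T" using op by (intro interior_maximal) auto
    then have "\<not> (0 < s \<and> 0 < t \<and> s < 1 \<and> t < 1)" using x by (auto simp: s_def t_def)
    moreover have st: "0 \<le> s" "0 \<le> t" "s \<le> 1" "t \<le> 1"
      using par(2)[rule_format, of x] x by (auto simp: s_def t_def)
    ultimately consider "s = 0" | "t = 0" | "s = 1" | "t = 1" by linarith
    then show ?thesis
    proof cases
      case 3
      have "x \<in> closed_segment (v + b) (v + b + c)"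
        unfolding in_segment xst using 3 st by (intro exI[of _ t]) (simp add: algebra_simps)
      then show ?thesis using c' par corner_swap by metis
    next
      case 4
      have "x \<in> closed_segment (v + c) (v + c + b)"
        unfolding in_segment xst using 4 st by (intro exI[of _ s]) (simp add: algebra_simps)
      then show ?thesis using b' par corner_swap by metis
    qed (use sw st c corner_swap[OF c] in auto)
  qed
qed

lemma corner_edge_interior:
  assumes "corner T v b c" shows "closed_segment v (v + b) \<inter> interior T = {}"
proof (rule face_of_disjoint_interior[OF corner_edge_face[OF assms]])
  show "closed_segment v (v + b) \<noteq> T"
  proof
    assume "closed_segment v (v + b) = T"
    then have "v + c \<in> closed_segment v (v + b)" using corner_mem[OF assms] by simp
    then obtain s where "v + c = (1 - s) *\<^sub>R v + s *\<^sub>R (v + b)" by (auto simp: in_segment)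
    then have "c = s *\<^sub>R b" by (simp add: algebra_simps)
    then have "cross b c = 0" by (simp add: cross_def)
    then show False using corner_cross[OF assms] by simp
  qed
qed

text \<open>A radius that serves for all tiles makes the tiles of a tiling locally finite.\<close>

lemma corner_inball:
  assumes c: "corner T v b c" shows "\<exists>m. cball m (1/4) \<subseteq> T"
proof -
  obtain S Q where SQ: "\<And>y. y = (S \<bullet> y) *\<^sub>R b + (Q \<bullet> y) *\<^sub>R c"
    "S \<bullet> b = 1" "S \<bullet> c = 0" "Q \<bullet> b = 0" "Q \<bullet> c = 1"
    and T: "b \<bullet> c = 2 \<and> (\<forall>x. x \<in> T \<longleftrightarrow> 0 \<le> S \<bullet> (x - v) \<and> 0 \<le> Q \<bullet> (x - v) \<and> S \<bullet> (x - v) + Q \<bullet> (x - v) \<le> 1) \<and> T = tri_at v b c \<or>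
     \<bar>b \<bullet> c\<bar> \<le> 1 \<and> (\<forall>x. x \<in> T \<longleftrightarrow> 0 \<le> S \<bullet> (x - v) \<and> S \<bullet> (x - v) \<le> 1 \<and> 0 \<le> Q \<bullet> (x - v) \<and> Q \<bullet> (x - v) \<le> 1) \<and> T = par_at v b c"
    by (metis corner_coords[OF c])
  \<comment> \<open>The centroid in the case of a triangle. Within distance 1/4 each coordinate
    changes by at most 1/6, so the sum of the coordinates stays at most 2/3 + 1/3 = 1.\<close>
  define m where "m = v + (1/3) *\<^sub>R b + (1/3) *\<^sub>R c"
  have "cball m (1/4) \<subseteq> T"
  proof
    fix x assume "x \<in> cball m (1/4)"
    then have n: "norm (x - m) \<le> 1/4" by (simp add: dist_norm norm_minus_commute)
    define s t where "s = S \<bullet> (x - m)" and "t = Q \<bullet> (x - m)"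
    have xm: "x - m = s *\<^sub>R b + t *\<^sub>R c" using SQ(1)[of "x - m"] by (simp add: s_def t_def)
    have "(norm (x - m))\<^sup>2 \<le> (1/4)\<^sup>2" using n by (intro power_mono) auto
    moreover have "3 * s\<^sup>2 \<le> (norm (x - m))\<^sup>2" "3 * t\<^sup>2 \<le> (norm (x - m))\<^sup>2"
      unfolding xm using c by (intro comb_coord_bound; auto simp: corner_def)+
    ultimately have "s\<^sup>2 \<le> (1/6)\<^sup>2" "t\<^sup>2 \<le> (1/6)\<^sup>2" by (auto simp: power2_eq_square)
    then have "\<bar>s\<bar> \<le> 1/6" "\<bar>t\<bar> \<le> 1/6" using abs_le_square_iff[of s "1/6"] abs_le_square_iff[of t "1/6"] by auto
    moreover have "S \<bullet> (x - v) = 1/3 + s" "Q \<bullet> (x - v) = 1/3 + t"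
      using SQ(2-5) by (auto simp: s_def t_def m_def inner_diff_right inner_add_right)
    ultimately have "0 \<le> S \<bullet> (x - v) \<and> 0 \<le> Q \<bullet> (x - v) \<and> S \<bullet> (x - v) + Q \<bullet> (x - v) \<le> 1 \<and>
      S \<bullet> (x - v) \<le> 1 \<and> Q \<bullet> (x - v) \<le> 1" by (auto simp: abs_le_iff)
    then show "x \<in> T" using T by (elim disjE conjE) simp_all
  qed
  then show ?thesis by blast
qed

lemma corner_interior_nonempty:
  assumes c: "corner T v b c" shows "interior T \<noteq> {}"
proof -
  obtain m where "cball m (1/4) \<subseteq> T" using corner_inball[OF c] by blast
  then have "ball m (1/4) \<subseteq> interior T" by (intro interior_maximal) auto
  then show ?thesis by auto
qed

lemma corner_closure_interior:
  assumes c: "corner T v b c" shows "closure (interior T) = T"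
  using convex_closure_interior[OF corner_convex[OF c] corner_interior_nonempty[OF c]]
    corner_compact[OF c] by (simp add: compact_imp_closed)

lemma corner_subset_cball:
  assumes c: "corner T v b c" shows "T \<subseteq> cball v 4"
proof -
  obtain V where V: "T = convex hull V"
    "V = {v, v + b, v + c} \<and> T = tri_at v b c \<and> b \<bullet> c = 2 \<or>
     V = {v, v + b, v + b + c, v + c} \<and> T = par_at v b c \<and> \<bar>b \<bullet> c\<bar> \<le> 1"
    using corner_hull[OF c] by metis
  have "norm (b + c) \<le> 4" using norm_triangle_ineq[of b c] corner_norm[OF c] by simp
  then have "dist v (v + b + c) \<le> 4" unfolding dist_norm by (subst norm_minus_commute) (simp add: add.assoc)
  then have "V \<subseteq> cball v 4" using V corner_norm[OF c] by (auto simp: dist_norm)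
  then show ?thesis unfolding V(1) by (intro hull_minimal) auto
qed

section \<open>Points seen from a vertex of a tile\<close>

lemma corner_sector_coords:
  assumes c: "corner T v b c" and e: "0 < e" "v + e *\<^sub>R y \<in> T"
  obtains s t where "y = s *\<^sub>R b + t *\<^sub>R c" "0 \<le> s" "0 \<le> t"
    "b \<bullet> c = 2 \<and> (v + y \<in> T \<longleftrightarrow> s + t \<le> 1) \<or> \<bar>b \<bullet> c\<bar> \<le> 1 \<and> (v + y \<in> T \<longleftrightarrow> s \<le> 1 \<and> t \<le> 1)"
proof -
  obtain S Q where SQ: "\<And>y. y = (S \<bullet> y) *\<^sub>R b + (Q \<bullet> y) *\<^sub>R c"
    "S \<bullet> b = 1" "S \<bullet> c = 0" "Q \<bullet> b = 0" "Q \<bullet> c = 1"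
    and T: "b \<bullet> c = 2 \<and> (\<forall>x. x \<in> T \<longleftrightarrow> 0 \<le> S \<bullet> (x - v) \<and> 0 \<le> Q \<bullet> (x - v) \<and> S \<bullet> (x - v) + Q \<bullet> (x - v) \<le> 1) \<and> T = tri_at v b c \<or>
     \<bar>b \<bullet> c\<bar> \<le> 1 \<and> (\<forall>x. x \<in> T \<longleftrightarrow> 0 \<le> S \<bullet> (x - v) \<and> S \<bullet> (x - v) \<le> 1 \<and> 0 \<le> Q \<bullet> (x - v) \<and> Q \<bullet> (x - v) \<le> 1) \<and> T = par_at v b c"
    by (metis corner_coords[OF c])
  have "0 \<le> S \<bullet> (e *\<^sub>R y)" "0 \<le> Q \<bullet> (e *\<^sub>R y)" using T e(2) by (metis add_diff_cancel_left')+
  then have "0 \<le> S \<bullet> y" "0 \<le> Q \<bullet> y" using e by (auto simp: zero_le_mult_iff)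
  then show ?thesis using that[OF SQ(1)[of y]] T by auto
qed

lemma corner_inner_comb:
  assumes "corner T v b c" shows "b \<bullet> (s *\<^sub>R b + t *\<^sub>R c) = 4 * s + (b \<bullet> c) * t"
    "c \<bullet> (s *\<^sub>R b + t *\<^sub>R c) = (b \<bullet> c) * s + 4 * t"
  using corner_inner_self[OF assms] by (auto simp: inner_add_right inner_commute)

text \<open>The premise on \<open>e\<close> says that \<open>x\<close> points into the tile at
  \<open>v\<close>, so its coordinates are nonnegative. Being no closer to \<open>v + b\<close> or
  \<open>v + c\<close> than to \<open>v\<close> puts \<open>x\<close> in two half-planes, 4 s + (b
  \<bullet> c) t \<le> 2 and (b \<bullet> c) s + 4 t \<le> 2. With b \<bullet> c = 2 they give s + t
  \<le> 2/3, and with b \<bullet> c \<ge> -1 they bound both coordinates by 1.\<close>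

lemma corner_voronoi:
  assumes c: "corner T v b c" and e: "0 < e" "v + e *\<^sub>R (x - v) \<in> T"
    and near: "\<And>w. w extreme_point_of T \<Longrightarrow> dist x v \<le> dist x w"
  shows "x \<in> T"
proof -
  obtain s t where st: "x - v = s *\<^sub>R b + t *\<^sub>R c" "0 \<le> s" "0 \<le> t"
    "b \<bullet> c = 2 \<and> (x \<in> T \<longleftrightarrow> s + t \<le> 1) \<or> \<bar>b \<bullet> c\<bar> \<le> 1 \<and> (x \<in> T \<longleftrightarrow> s \<le> 1 \<and> t \<le> 1)"
    using corner_sector_coords[OF c e] by (metis add.commute diff_add_cancel)
  have half: "d \<bullet> (x - v) \<le> 2" if "(v + d) extreme_point_of T" "norm d = 2" for d
  proof -
    have "(norm (x - v))\<^sup>2 \<le> (norm ((x - v) - d))\<^sup>2"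
      using near[OF that(1)] by (intro power_mono) (auto simp: dist_norm diff_diff_eq)
    moreover have "2 * (d \<bullet> (x - v)) = 4 + (norm (x - v))\<^sup>2 - (norm ((x - v) - d))\<^sup>2"
      using that(2) dot_norm_neg[of d "x - v"] norm_minus_commute[of d "x - v"] by simp
    ultimately show ?thesis by linarith
  qed
  have "(v + b) extreme_point_of T" using corner_next[OF c] corner_extreme by metis
  then have 1: "4 * s + (b \<bullet> c) * t \<le> 2" using half corner_norm[OF c] corner_inner_comb(1)[OF c, of s t] st(1) by metis
  have "(v + c) extreme_point_of T" using corner_next[OF corner_swap[OF c]] corner_extreme by metis
  then have 2: "(b \<bullet> c) * s + 4 * t \<le> 2" using half corner_norm[OF c] corner_inner_comb(2)[OF c, of s t] st(1) by metis
  show ?thesis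
  proof (cases "b \<bullet> c = 2")
    case True
    then show ?thesis using 1 2 st by auto
  next
    case False
    then have k: "-1 \<le> b \<bullet> c" using corner_inner[OF c] by simp
    have "- t \<le> (b \<bullet> c) * t" "- s \<le> (b \<bullet> c) * s"
      using mult_right_mono[OF k st(3)] mult_right_mono[OF k st(2)] by auto
    then have "s \<le> 1" "t \<le> 1" using 1 2 by linarith+
    then show ?thesis using st(4) False by auto
  qed
qed

text \<open>The sides of the tile that do not contain \<open>v\<close> are at distance at least sqrt
  3 from it, so the part of the unit disc inside the angle at \<open>v\<close> does not reach them.
  The computation only uses the quadratic form for the norm.\<close>

lemma corner_unit_sector:
  assumes c: "corner T v b c" and e: "0 < e" "v + e *\<^sub>R (x - v) \<in> T" and near: "dist x v \<le> 1"
  shows "x \<in> T"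
proof -
  obtain s t where st: "x - v = s *\<^sub>R b + t *\<^sub>R c" "0 \<le> s" "0 \<le> t"
    "b \<bullet> c = 2 \<and> (x \<in> T \<longleftrightarrow> s + t \<le> 1) \<or> \<bar>b \<bullet> c\<bar> \<le> 1 \<and> (x \<in> T \<longleftrightarrow> s \<le> 1 \<and> t \<le> 1)"
    using corner_sector_coords[OF c e] by (metis add.commute diff_add_cancel)
  have "(norm (x - v))\<^sup>2 \<le> 1\<^sup>2" using near by (intro power_mono) (auto simp: dist_norm)
  then have le: "4 * s\<^sup>2 + 4 * t\<^sup>2 + 2 * (b \<bullet> c) * s * t \<le> 1"
    using norm_comb[OF c, of s t] st(1) by simp
  have stp: "0 \<le> s * t" using st by simp
  have "(-1) * (s * t) \<le> (b \<bullet> c) * (s * t)" using corner_inner[OF c] stp by (intro mult_right_mono) auto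
  then have le': "4 * s\<^sup>2 + 4 * t\<^sup>2 - 2 * (s * t) \<le> 1" using le by (simp add: mult.assoc)
  have sq: "3 * (s + t)\<^sup>2 \<le> 4 * s\<^sup>2 + 4 * t\<^sup>2 + 4 * s * t"
    using zero_le_power2[of "s - t"] by (simp add: power2_eq_square algebra_simps)
  have "4 * s\<^sup>2 + 4 * t\<^sup>2 - 2 * (s * t) = (s - t)\<^sup>2 + 3 * s\<^sup>2 + 3 * t\<^sup>2"
    by (simp add: power2_eq_square algebra_simps)
  then have "3 * s\<^sup>2 \<le> 1" "3 * t\<^sup>2 \<le> 1" using le' zero_le_power2[of "s - t"] zero_le_power2[of s] zero_le_power2[of t] by linarith+
  then have "s\<^sup>2 \<le> 1\<^sup>2" "t\<^sup>2 \<le> 1\<^sup>2" by auto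
  then have "s \<le> 1" "t \<le> 1" using st by (metis abs_le_square_iff abs_of_nonneg abs_one)+
  moreover have "s + t \<le> 1" if "b \<bullet> c = 2"
  proof -
    have "(s + t)\<^sup>2 \<le> 1\<^sup>2" using sq le that by auto
    then show ?thesis using st by (metis abs_le_square_iff abs_of_nonneg abs_one add_nonneg_nonneg)
  qed
  ultimately show ?thesis using st(4) by auto
qed

text \<open>The vertex found is an end of one of the two edges at \<open>v\<close>. This prevents an
  edge of length 2 between vertices of a tiling from running through a tile.\<close>

lemma corner_sector_dist2:
  assumes c: "corner T v b c" and e: "0 < e" "v + e *\<^sub>R (w - v) \<in> T" and d: "dist v w = 2"
  shows "\<exists>x. x extreme_point_of T \<and> dist w x < 2"
proof -
  obtain s t where st: "w - v = s *\<^sub>R b + t *\<^sub>R c" "0 \<le> s" "0 \<le> t"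
    using corner_sector_coords[OF c e] by blast
  have n: "norm (w - v) = 2" using d by (simp add: dist_norm norm_minus_commute)
  have eq: "4 * s\<^sup>2 + 4 * t\<^sup>2 + 2 * (b \<bullet> c) * s * t = 4"
    using norm_comb[OF c, of s t] st(1) n by simp
  have near: "dist w (v + a) < 2" if "norm a = 2" "2 < a \<bullet> (w - v)" for a
  proof -
    have "(norm ((w - v) - a))\<^sup>2 < 2\<^sup>2" using that n dot_norm_neg[of a "w - v"] norm_minus_commute[of a "w - v"] by simp
    then have "norm ((w - v) - a) < 2" by (rule power2_less_imp_less) simp
    then show ?thesis by (simp add: dist_norm algebra_simps)
  qed
  have "2 < b \<bullet> (w - v) \<or> 2 < c \<bullet> (w - v)"
  proof (rule ccontr)
    assume "\<not> ?thesis"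
    then have le: "4 * s + (b \<bullet> c) * t \<le> 2" "(b \<bullet> c) * s + 4 * t \<le> 2"
      unfolding st(1) corner_inner_comb[OF c] by auto
    \<comment> \<open>The left side is the squared length 4, so s + t \<ge> 2. Adding the two
      inequalities gives (4 + (b \<bullet> c)) (s + t) \<le> 4, hence 3 (s + t) \<le> 4, a
      contradiction.\<close>
    have "s * (4 * s + (b \<bullet> c) * t) + t * ((b \<bullet> c) * s + 4 * t) \<le> s * 2 + t * 2"
      using le st by (intro add_mono mult_left_mono) auto
    then have "2 \<le> s + t" using eq by (simp add: power2_eq_square algebra_simps)
    moreover have "-1 * (s + t) \<le> (b \<bullet> c) * (s + t)" using corner_inner[OF c] st by (intro mult_right_mono) auto
    ultimately show False using le by (simp add: algebra_simps)
  qed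
  moreover have "(v + b) extreme_point_of T" using corner_next[OF c] corner_extreme by metis
  moreover have "(v + c) extreme_point_of T" using corner_next[OF corner_swap[OF c]] corner_extreme by metis
  ultimately show ?thesis using near corner_norm[OF c] by metis
qed

text \<open>Used to keep centres of unit discs out of the interior of a tile. In a triangle
  \<open>v\<close> itself is close enough except to the other two vertices. A rhombus is cut into
  four parallelograms of half the side length, one for each vertex, whose points have squared
  distance at most 5/2 from it.\<close>

lemma corner_near_vertex:
  assumes c: "corner T v b c" and x: "x \<in> T"
  shows "\<exists>w. w extreme_point_of T \<and> dist x w < 2"
proof (cases "b \<bullet> c = 2 \<and> T = tri_at v b c")
  case True
  then obtain s t where st: "x = v + s *\<^sub>R b + t *\<^sub>R c" "0 \<le> s" "0 \<le> t" "s + t \<le> 1"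
    using x by (auto simp: tri_at_def)
  have "(norm (x - v))\<^sup>2 = 4 * (s + t)\<^sup>2 - 4 * (s * t)"
    using norm_comb[OF c, of s t] True by (simp add: st(1) power2_eq_square algebra_simps)
  moreover have "4 * (s + t)\<^sup>2 - 4 * (s * t) < 2\<^sup>2" if "s \<noteq> 1" "t \<noteq> 1"
  proof (cases "s * t = 0")
    case True
    then have "0 \<le> s + t" "s + t < 1" using st that by auto
    then have "(s + t)\<^sup>2 < 1" by (simp add: power_less_one_iff abs_square_less_1)
    then show ?thesis unfolding True by simp
  next
    case False
    then have "0 < s * t" using st by (simp add: zero_less_mult_iff less_le)
    moreover have "(s + t)\<^sup>2 \<le> 1" using st by (simp add: power_le_one)
    ultimately show ?thesis by (simp)
  qed
  ultimately have "norm (x - v) < 2" if "s \<noteq> 1" "t \<noteq> 1"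
    using that power2_less_imp_less[of "norm (x - v)" 2] by auto
  then consider "dist x v < 2" | "s = 1" "t = 0" | "t = 1" "s = 0"
    using st by (fastforce simp: dist_norm)
  then show ?thesis
  proof cases
    case 1 then show ?thesis using corner_extreme[OF c] by blast
  next
    case 2
    then have "x extreme_point_of T" using corner_next[OF c] corner_extreme st(1) by (metis add.right_neutral scaleR_one scaleR_zero_left)
    then show ?thesis by (metis dist_self zero_less_numeral)
  next
    case 3
    then have "x extreme_point_of T" using corner_next[OF corner_swap[OF c]] corner_extreme st(1) by (metis add.right_neutral scaleR_one scaleR_zero_left)
    then show ?thesis by (metis dist_self zero_less_numeral)
  qed
next
  case False
  then have par: "T = par_at v b c" "\<bar>b \<bullet> c\<bar> \<le> 1" using c by (auto simp: corner_def)
  have quarter: "dist (v + s *\<^sub>R b + t *\<^sub>R c) v < 2" if "0 \<le> s" "s \<le> 1/2" "0 \<le> t" "t \<le> 1/2" "corner T v b c" "\<bar>b \<bullet> c\<bar> \<le> 1"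
    for v b c s t
  proof -
    have "s\<^sup>2 \<le> (1/2)\<^sup>2" "t\<^sup>2 \<le> (1/2)\<^sup>2" using that by (auto intro!: power_mono)
    moreover have "s * t \<le> (1/2) * (1/2)" using that by (intro mult_mono) auto
    moreover have "(b \<bullet> c) * (s * t) \<le> 1 * (s * t)" using that by (intro mult_right_mono) auto
    ultimately have "(norm (s *\<^sub>R b + t *\<^sub>R c))\<^sup>2 < 2\<^sup>2"
      unfolding norm_comb[OF that(5)] by (simp add: power2_eq_square mult.assoc)
    then have "norm (s *\<^sub>R b + t *\<^sub>R c) < 2" by (rule power2_less_imp_less) simp
    then show ?thesis by (simp add: dist_norm add.assoc)
  qed
  obtain s t where st: "x = v + s *\<^sub>R b + t *\<^sub>R c" "0 \<le> s" "0 \<le> t" "s \<le> 1" "t \<le> 1"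
    using x par by (auto simp: par_at_def)
  have c2: "corner T (v + b) (- b) c" using corner_next[OF c] par by metis
  have c3: "corner T (v + c) b (- c)" using corner_next[OF corner_swap[OF c]] par corner_swap by (metis inner_commute par_at_swap)
  have c4: "corner T (v + b + c) (- b) (- c)"
    using corner_next[OF corner_swap[OF c2]] par corner_swap by (metis inner_commute inner_minus_left abs_minus_cancel par_at_swap par_at_next)
  consider "s \<le> 1/2" "t \<le> 1/2" | "s > 1/2" "t \<le> 1/2" | "s \<le> 1/2" "t > 1/2" | "s > 1/2" "t > 1/2" by linarith
  then show ?thesis
  proof cases
    case 1 then show ?thesis using quarter[of s t v b c] st c par corner_extreme[OF c] by auto
  next
    case 2
    have eq: "x = (v + b) + (1 - s) *\<^sub>R (- b) + t *\<^sub>R c" using st(1) by (simp add: algebra_simps)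
    show ?thesis using corner_extreme[OF c2]
      by (rule_tac exI, rule_tac conjI, assumption, subst eq, intro quarter) (use 2 st c2 par in auto)
  next
    case 3
    have eq: "x = (v + c) + s *\<^sub>R b + (1 - t) *\<^sub>R (- c)" using st(1) by (simp add: algebra_simps)
    show ?thesis using corner_extreme[OF c3]
      by (rule_tac exI, rule_tac conjI, assumption, subst eq, intro quarter) (use 3 st c3 par in auto)
  next
    case 4
    have eq: "x = (v + b + c) + (1 - s) *\<^sub>R (- b) + (1 - t) *\<^sub>R (- c)" using st(1) by (simp add: algebra_simps)
    show ?thesis using corner_extreme[OF c4]
      by (rule_tac exI, rule_tac conjI, assumption, subst eq, intro quarter) (use 4 st c4 par in auto)
  qed
qed

section \<open>Rhombi and their pairs of small discs\<close>

lemma orthogonal_plane_zero: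
  fixes e x y :: complex
  assumes "e \<bullet> x = 0" "e \<bullet> y = 0" "cross x y \<noteq> 0"
  shows "e = 0"
proof -
  have "cross x y * Re e = Im y * (e \<bullet> x) - Im x * (e \<bullet> y)" "cross x y * Im e = Re x * (e \<bullet> y) - Re y * (e \<bullet> x)"
    by (auto simp: cross_def inner_complex_def algebra_simps)
  then show ?thesis using assms by (simp add: complex_eq_iff)
qed

text \<open>Relative to \<open>a\<close>, the vector b + d - c is orthogonal to both diagonals.
  These are nonzero and orthogonal to each other, so they span the plane and the vector vanishes.
  The conditions \<open>a \<noteq> c\<close> and \<open>b \<noteq> d\<close> exclude the folded
  positions.\<close>

lemma equilateral_quad:
  fixes a b c d :: complex
  assumes "dist a b = L" "dist b c = L" "dist c d = L" "dist d a = L" "a \<noteq> c" "b \<noteq> d"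
  shows "c = b + d - a"
proof -
  define \<beta> \<gamma> \<delta> where "\<beta> = b - a" and "\<gamma> = c - a" and "\<delta> = d - a"
  have n: "norm \<beta> = L" "norm \<delta> = L" "norm (\<gamma> - \<beta>) = L" "norm (\<gamma> - \<delta>) = L"
    using assms by (auto simp: \<beta>_def \<gamma>_def \<delta>_def dist_norm norm_minus_commute)
  have 1: "\<gamma> \<bullet> \<beta> = (norm \<gamma>)\<^sup>2 / 2" "\<gamma> \<bullet> \<delta> = (norm \<gamma>)\<^sup>2 / 2"
    using n by (simp_all add: dot_norm_neg)
  have 2: "\<beta> \<bullet> \<beta> = \<delta> \<bullet> \<delta>" using n by (simp add: dot_square_norm)
  let ?e = "\<beta> + \<delta> - \<gamma>"
  have "?e \<bullet> \<gamma> = \<gamma> \<bullet> \<beta> + \<gamma> \<bullet> \<delta> - (norm \<gamma>)\<^sup>2"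
    by (simp add: inner_commute[of _ \<gamma>] inner_diff_right inner_add_right dot_square_norm)
  then have "?e \<bullet> \<gamma> = 0" using 1 by simp
  moreover have "?e \<bullet> (\<beta> - \<delta>) = 0"
    using 1 2 by (simp add: inner_diff_left inner_add_left inner_diff_right inner_add_right inner_commute)
  moreover have "cross \<gamma> (\<beta> - \<delta>) \<noteq> 0"
  proof
    assume "cross \<gamma> (\<beta> - \<delta>) = 0"
    moreover have "\<gamma> \<bullet> (\<beta> - \<delta>) = 0" using 1 by (simp add: inner_diff_right)
    ultimately have "(norm \<gamma>)\<^sup>2 * (norm (\<beta> - \<delta>))\<^sup>2 = 0"
      using cross_inner_square[of \<gamma> "\<beta> - \<delta>"] by simp
    then show False using assms by (auto simp: \<beta>_def \<gamma>_def \<delta>_def)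
  qed
  ultimately have "?e = 0" by (rule orthogonal_plane_zero)
  then show ?thesis by (simp add: \<beta>_def \<gamma>_def \<delta>_def algebra_simps)
qed

lemma triangle_tile_iff:
  "triangle_tile T \<longleftrightarrow> (\<exists>v b c. norm b = 2 \<and> norm c = 2 \<and> b \<bullet> c = 2 \<and> T = tri_at v b c)"
proof
  assume "triangle_tile T"
  then obtain x y z where T: "dist x y = 2" "dist y z = 2" "dist z x = 2" "T = convex hull {x, y, z}"
    by (auto simp: triangle_tile_def)
  have n: "norm (y - x) = 2" "norm (z - x) = 2" "norm ((y - x) - (z - x)) = 2"
    using T by (auto simp: dist_norm norm_minus_commute)
  then have "(y - x) \<bullet> (z - x) = 2" unfolding dot_norm_neg n by simp
  moreover have "T = tri_at x (y - x) (z - x)"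
    unfolding T(4) by (simp flip: convex_hull_tri)
  ultimately show "\<exists>v b c. norm b = 2 \<and> norm c = 2 \<and> b \<bullet> c = 2 \<and> T = tri_at v b c" using n by blast
next
  assume "\<exists>v b c. norm b = 2 \<and> norm c = 2 \<and> b \<bullet> c = 2 \<and> T = tri_at v b c"
  then obtain v b c where T: "norm b = 2" "norm c = 2" "b \<bullet> c = 2" "T = tri_at v b c" by blast
  have "(norm (b - c))\<^sup>2 = 2\<^sup>2" using T dot_norm_neg[of b c] by simp
  then have "norm (b - c) = 2" by (metis norm_ge_zero power2_eq_imp_eq zero_le_numeral)
  then show "triangle_tile T"
    unfolding triangle_tile_def
    using T by (intro exI[of _ v] exI[of _ "v + b"] exI[of _ "v + c"]) (auto simp: dist_norm convex_hull_tri)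
qed

lemma vertex_angle_eq_alph:
  assumes "norm (x - v) = 2" "norm (y - v) = 2"
  shows "vertex_angle x v y = alph \<longleftrightarrow> (x - v) \<bullet> (y - v) = 2 - 4 * rho"
proof -
  have "\<bar>(x - v) \<bullet> (y - v)\<bar> \<le> 4" using Cauchy_Schwarz_ineq2[of "x - v" "y - v"] assms by simp
  then have "\<bar>(x - v) \<bullet> (y - v) / 4\<bar> \<le> 1" by simp
  moreover have "\<bar>1/2 - rho\<bar> \<le> 1" using rho_bounds by auto
  ultimately have "arccos ((x - v) \<bullet> (y - v) / 4) = arccos (1/2 - rho) \<longleftrightarrow> (x - v) \<bullet> (y - v) / 4 = 1/2 - rho"
    by (rule arccos_eq_iff[OF conjI])
  then show ?thesis unfolding vertex_angle_def assms alph_eq by auto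
qed

lemma rhombus_iff:
  "rhombus alph a b c d \<longleftrightarrow>
    norm (b - a) = 2 \<and> norm (d - a) = 2 \<and> (b - a) \<bullet> (d - a) = 2 - 4 * rho \<and> c = b + d - a"
proof
  assume r: "rhombus alph a b c d"
  then have n: "norm (b - a) = 2" "norm (d - a) = 2"
    by (auto simp: rhombus_def dist_norm norm_minus_commute)
  moreover have "(b - a) \<bullet> (d - a) = 2 - 4 * rho"
    using r vertex_angle_eq_alph[OF n] by (simp add: rhombus_def)
  moreover have "c = b + d - a" using r by (intro equilateral_quad[of _ _ 2]) (auto simp: rhombus_def)
  ultimately show "norm (b - a) = 2 \<and> norm (d - a) = 2 \<and> (b - a) \<bullet> (d - a) = 2 - 4 * rho \<and> c = b + d - a" by simp
next
  assume as: "norm (b - a) = 2 \<and> norm (d - a) = 2 \<and> (b - a) \<bullet> (d - a) = 2 - 4 * rho \<and> c = b + d - a"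
  then have n: "norm (b - a) = 2" "norm (d - a) = 2" and i: "(b - a) \<bullet> (d - a) = 2 - 4 * rho" and c: "c = b + d - a" by auto
  have "b \<noteq> d" using i rho_bounds n by (auto simp: dot_square_norm)
  moreover have "a \<noteq> c"
  proof
    assume "a = c"
    then have "d - a = - (b - a)" using c by (simp add: algebra_simps)
    then have "(b - a) \<bullet> (d - a) = - ((b - a) \<bullet> (b - a))" by (metis inner_minus_right)
    then show False using i n rho_bounds by (simp add: dot_square_norm)
  qed
  ultimately show "rhombus alph a b c d"
    using n i vertex_angle_eq_alph[OF n] unfolding rhombus_def
    by (auto simp: dist_norm norm_minus_commute c)
qed

lemma rhombus_hull:
  assumes "rhombus alph a b c d"
  shows "convex hull {a, b, c, d} = par_at a (b - a) (d - a)"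
proof -
  have "c = a + (b - a) + (d - a)" using assms by (simp add: rhombus_iff)
  then show ?thesis using convex_hull_par[of a "b - a" "d - a"] by simp
qed

lemma rhombus_corner:
  assumes "rhombus alph a b c d"
  shows "corner (convex hull {a, b, c, d}) a (b - a) (d - a)"
  using assms rho_bounds unfolding corner_def rhombus_hull[OF assms] by (auto simp: rhombus_iff)

lemma tile_corner:
  assumes "rhombus_tile alph T \<or> triangle_tile T"
  shows "\<exists>v b c. corner T v b c"
  using assms
proof
  assume "rhombus_tile alph T"
  then show ?thesis using rhombus_corner unfolding rhombus_tile_def by metis
next
  assume "triangle_tile T"
  then show ?thesis by (auto simp: triangle_tile_iff corner_def)
qed

lemma rhombus_flip: "rhombus alph a b c d \<Longrightarrow> rhombus alph a d c b"
  by (auto simp: rhombus_iff inner_commute algebra_simps)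

lemma rhombus_turn: "rhombus alph a b c d \<Longrightarrow> rhombus alph c d a b"
proof -
  assume r: "rhombus alph a b c d"
  then have "d - c = - (b - a)" "b - c = - (d - a)" "a = d + b - c" by (auto simp: rhombus_iff)
  then show ?thesis using r unfolding rhombus_iff by (metis inner_minus_left inner_minus_right minus_minus norm_minus_cancel)
qed

text \<open>The two values differ from each other and from the squared side 4, so the acute vertices
  can be recognised from the set of vertices alone.\<close>

lemma rhombus_diagonals:
  assumes "rhombus alph a b c d"
  shows "(dist a c)\<^sup>2 = 12 - 8 * rho" "(dist b d)\<^sup>2 = 4 + 8 * rho"
proof -
  have r: "norm (b - a) = 2" "norm (d - a) = 2" "(b - a) \<bullet> (d - a) = 2 - 4 * rho" "c = b + d - a"
    using assms by (auto simp: rhombus_iff)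
  have "c - a = (b - a) + (d - a)" using r(4) by simp
  then have "norm (a - c) = norm ((b - a) + (d - a))" by (metis norm_minus_commute)
  then show "(dist a c)\<^sup>2 = 12 - 8 * rho" using r dot_norm[of "b - a" "d - a"] by (simp add: dist_norm)
  have "b - d = (b - a) - (d - a)" by simp
  then show "(dist b d)\<^sup>2 = 4 + 8 * rho" using r dot_norm_neg[of "b - a" "d - a"] by (simp add: dist_norm)
qed

lemma rhombus_extreme_iff:
  assumes "rhombus alph a b c d"
  shows "v extreme_point_of convex hull {a, b, c, d} \<longleftrightarrow> v \<in> {a, b, c, d}"
proof
  show "v extreme_point_of convex hull {a, b, c, d} \<Longrightarrow> v \<in> {a, b, c, d}"
    by (rule extreme_point_of_convex_hull)
next
  assume "v \<in> {a, b, c, d}"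
  have "a extreme_point_of convex hull {a, b, c, d}" if "rhombus alph a b c d" for a b c d
    using corner_extreme[OF rhombus_corner[OF that]] .
  note A = this
  have "b extreme_point_of convex hull {a, b, c, d}" if "rhombus alph a b c d" for a b c d
    using corner_next[OF rhombus_corner[OF that]] corner_extreme by (metis diff_add_cancel add.commute)
  note B = this
  from \<open>v \<in> {a, b, c, d}\<close> show "v extreme_point_of convex hull {a, b, c, d}"
    using A[OF assms] B[OF assms] A[OF rhombus_turn[OF assms]] B[OF rhombus_flip[OF assms]]
    by (auto simp: insert_commute)
qed

lemma triangle_extreme_iff:
  fixes x y z :: complex
  assumes "dist x y = 2" "dist y z = 2" "dist z x = 2"
  shows "v extreme_point_of convex hull {x, y, z} \<longleftrightarrow> v \<in> {x, y, z}"
proof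
  show "v extreme_point_of convex hull {x, y, z} \<Longrightarrow> v \<in> {x, y, z}"
    by (rule extreme_point_of_convex_hull)
next
  assume v: "v \<in> {x, y, z}"
  have n: "norm (y - x) = 2" "norm (z - x) = 2" "norm ((y - x) - (z - x)) = 2"
    using assms by (auto simp: dist_norm norm_minus_commute)
  then have "(y - x) \<bullet> (z - x) = 2" unfolding dot_norm_neg n by simp
  then have c: "corner (convex hull {x, y, z}) x (y - x) (z - x)"
    using n by (auto simp: corner_def simp flip: convex_hull_tri)
  have "y extreme_point_of convex hull {x, y, z}"
    using corner_next[OF c] corner_extreme by (metis diff_add_cancel add.commute)
  moreover have "z extreme_point_of convex hull {x, y, z}"
    using corner_next[OF corner_swap[OF c]] corner_extreme by (metis diff_add_cancel add.commute)
  ultimately show "v extreme_point_of convex hull {x, y, z}" using v corner_extreme[OF c] by auto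
qed

text \<open>The position, as a fraction of the long diagonal, of the circumcentre of one acute and
  the two obtuse vertices. Requiring inner product 2 with both edges gives 1 / (3 - 2
  \<open>rho\<close>), which the quadratic equation turns into the form stated.\<close>

definition small_ratio :: real where "small_ratio = (3 + rho) / 8"

lemma small_ratio_eq: "small_ratio * (3 - 2 * rho) = 1"
proof -
  have "(3 + rho) * (3 - 2 * rho) = 8" using rho_eq by algebra
  then show ?thesis by (simp add: small_ratio_def)
qed

lemma square_dist_eq: "0 \<le> s \<Longrightarrow> dist x y = s \<longleftrightarrow> (norm (x - y))\<^sup>2 = s\<^sup>2"
  unfolding dist_norm by (metis norm_ge_zero power2_eq_imp_eq)

lemma rhombus_comb_norm:
  assumes "rhombus alph a b c d"
  shows "(norm (s *\<^sub>R (b - a) + t *\<^sub>R (d - a)))\<^sup>2 = 4 * s\<^sup>2 + 4 * t\<^sup>2 + 4 * (1 - 2 * rho) * s * t"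
proof -
  have "(b - a) \<bullet> (d - a) = 2 - 4 * rho" using assms by (simp add: rhombus_iff)
  from norm_comb[OF rhombus_corner[OF assms], of s t, unfolded this] show ?thesis by simp
qed

text \<open>Three tangencies put the centre at distance 1 + \<open>rho\<close> from
  \<open>a\<close>, \<open>b\<close> and \<open>d\<close>. It is therefore their circumcentre, which
  is determined by its inner products with the two edges at \<open>a\<close>.\<close>

lemma small_centre_unique:
  assumes r: "rhombus alph a b c d"
    and "tangent (p, rho) (a, 1)" "tangent (p, rho) (b, 1)" "tangent (p, rho) (d, 1)"
  shows "p = a + small_ratio *\<^sub>R (c - a)"
proof -
  have rr: "norm (b - a) = 2" "norm (d - a) = 2" "(b - a) \<bullet> (d - a) = 2 - 4 * rho" "c - a = (b - a) + (d - a)"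
    using r by (auto simp: rhombus_iff)
  define y where "y = p - a"
  have "norm y = 1 + rho" "norm (y - (b - a)) = 1 + rho" "norm (y - (d - a)) = 1 + rho"
    using assms(2-4) by (auto simp: tangent_def dist_norm y_def)
  then have y: "y \<bullet> (b - a) = 2" "y \<bullet> (d - a) = 2" using rr by (auto simp: dot_norm_neg)
  have self: "(b - a) \<bullet> (b - a) = 4" "(d - a) \<bullet> (d - a) = 4" using rr by (auto simp: dot_square_norm)
  let ?e = "y - small_ratio *\<^sub>R (c - a)"
  have "small_ratio * (4 + (2 - 4 * rho)) = 2" using small_ratio_eq by (simp add: algebra_simps)
  then have "?e \<bullet> (b - a) = 0" "?e \<bullet> (d - a) = 0"
    unfolding rr(4) inner_diff_left[of y] inner_scaleR_left inner_add_left y self rr(3) inner_commute[of "d - a" "b - a"]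
    by (simp_all add: add.commute)
  then have "?e = 0" using corner_cross[OF rhombus_corner[OF r]] by (rule orthogonal_plane_zero)
  then show ?thesis by (simp add: y_def algebra_simps)
qed

lemma small_centre_dist:
  assumes r: "rhombus alph a b c d" and p: "p = a + small_ratio *\<^sub>R (c - a)"
  shows "dist p a = 1 + rho" "dist p b = 1 + rho" "dist p d = 1 + rho" "1 + rho < dist p c"
proof -
  have rr: "c - a = (b - a) + (d - a)" using r by (auto simp: rhombus_iff)
  let ?l = small_ratio
  \<comment> \<open>The squared circumradius is 4 \<open>small_ratio\<close>; the equation for
    \<open>rho\<close> makes it the square of 1 + \<open>rho\<close>.\<close>
  have sq: "(1 + rho)\<^sup>2 = 4 * ?l" unfolding small_ratio_def using rho_eq by (simp add: power2_eq_square field_simps)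
  have pos: "0 \<le> 1 + rho" using rho_bounds by simp
  have "p - a = ?l *\<^sub>R (b - a) + ?l *\<^sub>R (d - a)" unfolding p rr by (simp add: algebra_simps)
  then have "(norm (p - a))\<^sup>2 = 4 * ?l\<^sup>2 + 4 * ?l\<^sup>2 + 4 * (1 - 2 * rho) * ?l * ?l"
    using rhombus_comb_norm[OF r, of ?l ?l] by simp
  also have "\<dots> = 4 * ?l" using small_ratio_eq by algebra
  finally show "dist p a = 1 + rho" using pos sq by (subst square_dist_eq) auto
  have eqb: "4 * (?l - 1)\<^sup>2 + 4 * ?l\<^sup>2 + 4 * (1 - 2 * rho) * (?l - 1) * ?l = 4 * ?l"
    using small_ratio_eq by algebra
  have eqd: "4 * ?l\<^sup>2 + 4 * (?l - 1)\<^sup>2 + 4 * (1 - 2 * rho) * ?l * (?l - 1) = 4 * ?l"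
    using small_ratio_eq by algebra
  have "p - b = (?l - 1) *\<^sub>R (b - a) + ?l *\<^sub>R (d - a)" unfolding p rr by (simp add: algebra_simps)
  then have "(norm (p - b))\<^sup>2 = 4 * ?l"
    using rhombus_comb_norm[OF r, of "?l - 1" ?l] eqb by simp
  then show "dist p b = 1 + rho" using pos sq by (subst square_dist_eq) auto
  have "p - d = ?l *\<^sub>R (b - a) + (?l - 1) *\<^sub>R (d - a)" unfolding p rr by (simp add: algebra_simps)
  then have "(norm (p - d))\<^sup>2 = 4 * ?l"
    using rhombus_comb_norm[OF r, of ?l "?l - 1"] eqd by simp
  then show "dist p d = 1 + rho" using pos sq by (subst square_dist_eq) auto
  have "p - c = (?l - 1) *\<^sub>R (c - a)" unfolding p by (simp add: algebra_simps)
  then have "dist p c = (1 - ?l) * norm (c - a)" using rho_bounds by (simp add: dist_norm small_ratio_def)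
  moreover have "dist p a = ?l * norm (c - a)" using rho_bounds by (simp add: dist_norm p small_ratio_def)
  moreover have "0 < norm (c - a)" using r by (auto simp: rhombus_def)
  moreover have "?l < 1 - ?l" using rho_bounds by (simp add: small_ratio_def field_simps)
  ultimately show "1 + rho < dist p c" using \<open>dist p a = 1 + rho\<close> by (metis mult_less_cancel_right_pos)
qed

text \<open>Both coordinates of the centre lie between 1/4 and 3/4, and within distance 3/10 each
  coordinate changes by at most 1/4.\<close>

lemma small_centre_region:
  assumes r: "rhombus alph a b c d" and p: "p = a + small_ratio *\<^sub>R (c - a)"
  shows "region (p, rho) \<subseteq> convex hull {a, b, c, d}"
proof
  fix x assume "x \<in> region (p, rho)"
  then have n: "norm (x - p) \<le> rho" by (simp add: region_def dist_norm norm_minus_commute)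
  have rr: "norm (b - a) = 2" "norm (d - a) = 2" "(b - a) \<bullet> (d - a) = 2 - 4 * rho" "c - a = (b - a) + (d - a)"
    using r by (auto simp: rhombus_iff)
  obtain S Q where SQ: "\<And>y. y = (S \<bullet> y) *\<^sub>R (b - a) + (Q \<bullet> y) *\<^sub>R (d - a)"
    using dual_basis[OF corner_cross[OF rhombus_corner[OF r]]] by metis
  define s t where "s = S \<bullet> (x - p)" and "t = Q \<bullet> (x - p)"
  have xp: "x - p = s *\<^sub>R (b - a) + t *\<^sub>R (d - a)" using SQ[of "x - p"] by (simp add: s_def t_def)
  have "(norm (x - p))\<^sup>2 \<le> (3/10)\<^sup>2" using n rho_bounds by (intro power_mono) auto
  moreover have "3 * s\<^sup>2 \<le> (norm (x - p))\<^sup>2" "3 * t\<^sup>2 \<le> (norm (x - p))\<^sup>2"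
    unfolding xp using rr rho_bounds by (intro comb_coord_bound; simp)+
  ultimately have "s\<^sup>2 \<le> (1/4)\<^sup>2" "t\<^sup>2 \<le> (1/4)\<^sup>2" by (auto simp: power2_eq_square)
  then have "\<bar>s\<bar> \<le> 1/4" "\<bar>t\<bar> \<le> 1/4" using abs_le_square_iff[of s "1/4"] abs_le_square_iff[of t "1/4"] by auto
  moreover have "x = a + (small_ratio + s) *\<^sub>R (b - a) + (small_ratio + t) *\<^sub>R (d - a)"
  proof -
    have "x = p + (s *\<^sub>R (b - a) + t *\<^sub>R (d - a))" using xp by (simp add: diff_eq_eq add.commute)
    then show ?thesis unfolding p rr(4)
      by (simp only: scaleR_left_distrib scaleR_add_right add_ac)
  qed
  moreover have "1/4 \<le> small_ratio" "small_ratio \<le> 3/4" using rho_bounds by (simp_all add: small_ratio_def)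
  ultimately show "x \<in> convex hull {a, b, c, d}"
    unfolding rhombus_hull[OF r]
    by (intro par_atI[of _ a "small_ratio + s" _ "small_ratio + t"]) (auto simp: abs_le_iff)
qed

text \<open>The pair exists and is unique once the vertices are labelled. The distance of the
  centres is 1 - 2 \<open>small_ratio\<close> times the long diagonal, and the equation for
  \<open>rho\<close> evaluates it to 2 \<open>rho\<close>, so the two small discs touch.\<close>

lemma small_pair_iff:
  assumes r: "rhombus alph a b c d"
  shows "small_pair rho a b c d p q \<longleftrightarrow> p = a + small_ratio *\<^sub>R (c - a) \<and> q = c + small_ratio *\<^sub>R (a - c)"
proof
  assume s: "small_pair rho a b c d p q"
  show "p = a + small_ratio *\<^sub>R (c - a) \<and> q = c + small_ratio *\<^sub>R (a - c)"
    using s small_centre_unique[OF r] small_centre_unique[OF rhombus_turn[OF r]] by (auto simp: small_pair_def)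
next
  assume pq: "p = a + small_ratio *\<^sub>R (c - a) \<and> q = c + small_ratio *\<^sub>R (a - c)"
  note p = small_centre_dist[OF r, of p] small_centre_region[OF r, of p]
  note q = small_centre_dist[OF rhombus_turn[OF r], of q] small_centre_region[OF rhombus_turn[OF r], of q]
  have e: "{c, d, a, b} = {a, b, c, d}" by auto
  have "p - q = (2 * small_ratio - 1) *\<^sub>R (c - a)"
    unfolding pq[THEN conjunct1] pq[THEN conjunct2] by (simp add: complex_eq_iff algebra_simps)
  moreover have "(norm (c - a))\<^sup>2 = 12 - 8 * rho"
    using rhombus_diagonals(1)[OF r] by (simp add: dist_norm norm_minus_commute)
  ultimately have "(norm (p - q))\<^sup>2 = (2 * small_ratio - 1)\<^sup>2 * (12 - 8 * rho)"
    by (simp add: power_mult_distrib)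
  also have "\<dots> = (2 * rho)\<^sup>2"
  proof -
    have "(rho - 1)\<^sup>2 * (12 - 8 * rho) = 16 * (2 * rho)\<^sup>2" using rho_eq by algebra
    moreover have sr: "2 * small_ratio - 1 = (rho - 1) / 4" by (simp add: small_ratio_def)
    ultimately show ?thesis unfolding sr by (simp add: power_divide)
  qed
  finally have "dist p q = 2 * rho" using rho_bounds by (subst square_dist_eq) auto
  then show "small_pair rho a b c d p q"
    unfolding small_pair_def using p q pq e by (auto simp: tangent_def)
qed

text \<open>A tile is a set without labels, while \<open>packing_of_tiling\<close> quantifies over
  all labellings. The acute vertices are the only pair at squared distance 12 - 8
  \<open>rho\<close>, so different labellings can only exchange the two acute or the two obtuse
  vertices.\<close>

lemma rhombus_hull_unique:
  assumes r: "rhombus alph a b c d" and r': "rhombus alph a' b' c' d'"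
    and eq: "convex hull {a, b, c, d} = convex hull {a', b', c', d'}"
  shows "{a, c} = {a', c'}" "{b, d} = {b', d'}"
proof -
  have V: "{a, b, c, d} = {a', b', c', d'}"
    by (rule set_eqI) (simp only: rhombus_extreme_iff[OF r, symmetric] eq rhombus_extreme_iff[OF r'])
  note D = rhombus_diagonals[OF r] rhombus_diagonals[OF r']
  have ne: "12 - 8 * rho \<noteq> 4" "4 + 8 * rho \<noteq> 4" "12 - 8 * rho \<noteq> 4 + 8 * rho" "12 - 8 * rho \<noteq> 0"
    using rho_bounds by auto
  have long: "{x, y} = {a, c}" if "rhombus alph a b c d" "x \<in> {a, b, c, d}" "y \<in> {a, b, c, d}" "(dist x y)\<^sup>2 = 12 - 8 * rho"
    for a b c d x y
  proof -
    have D: "dist a b = 2" "dist b c = 2" "dist c d = 2" "dist d a = 2" "dist b a = 2" "dist c b = 2" "dist d c = 2" "dist a d = 2"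
      using that(1) by (auto simp: rhombus_def dist_commute)
    have "dist x y \<noteq> 2" "x \<noteq> y" using that(4) ne by auto
    note nxy = this
    have bd: "\<not> (x = b \<and> y = d)" "\<not> (x = d \<and> y = b)"
      using that(4) ne rhombus_diagonals(2)[OF that(1)] by (auto simp: dist_commute)
    note xin = that(2)
    consider "x = a" | "x = b" | "x = c" | "x = d" using xin by blast
    then show ?thesis
    proof cases
      case 1 then have "y = c" using nxy D that(3) by auto
      then show ?thesis using 1 by simp
    next
      case 2 then show ?thesis using nxy D that(3) bd by auto
    next
      case 3 then have "y = a" using nxy D that(3) by auto
      then show ?thesis using 3 by auto
    next
      case 4 then show ?thesis using nxy D that(3) bd by auto
    qed
  qed
  have "a \<in> {a', b', c', d'}" "c \<in> {a', b', c', d'}" unfolding V[symmetric] by simp_all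
  then show ac: "{a, c} = {a', c'}" using long[OF r' _ _ D(1)] by simp
  have "distinct [a, b, c, d]" "distinct [a', b', c', d']" using r r' by (auto simp: rhombus_def)
  then have "{b, d} = {a, b, c, d} - {a, c}" "{b', d'} = {a', b', c', d'} - {a', c'}" by auto
  then show "{b, d} = {b', d'}" using V ac by simp
qed

lemma rhombus_not_triangle:
  assumes "rhombus alph a b c d" "dist x y = 2" "dist y z = 2" "dist z x = 2"
  shows "convex hull {a, b, c, d} \<noteq> convex hull {x, y, z}"
proof
  assume eq: "convex hull {a, b, c, d} = convex hull {x, y, z}"
  have "{a, b, c, d} = {x, y, z}"
    by (rule set_eqI) (simp only: rhombus_extreme_iff[OF assms(1), symmetric] eq triangle_extreme_iff[OF assms(2-4)])
  moreover have "card {a, b, c, d} = 4" using assms(1) by (auto simp: rhombus_def)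
  moreover have "card {x, y, z} \<le> 3" by (simp add: card_insert_if)
  ultimately show False by simp
qed

section \<open>Tilings and the components of the complement of their edges\<close>

text \<open>The interior of a tile is connected, and its frontier lies in \<open>X\<close>. A larger
  connected set would meet that frontier, so the interior is a whole component. As the tiles cover
  the plane, no other component remains. The lemma serves for the drawn segments of a given packing
  as well as for those of a packing built from a tiling.\<close>

lemma components_of_tiles:
  assumes tiles: "\<And>T. T \<in> \<T> \<Longrightarrow> \<exists>v b c. corner T v b c"
    and cover: "\<Union>\<T> = UNIV"
    and int: "\<And>T. T \<in> \<T> \<Longrightarrow> interior T \<inter> X = {}"
    and bd: "\<And>T. T \<in> \<T> \<Longrightarrow> T - interior T \<subseteq> X"
  shows "components (- X) = interior ` \<T>" "closure ` components (- X) = \<T>"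
proof -
  have comp: "interior T \<in> components (- X)" if T: "T \<in> \<T>" for T
  proof -
    obtain v b c where c: "corner T v b c" using tiles[OF T] by blast
    have conn: "connected (interior T)"
      using corner_convex[OF c] by (simp add: convex_connected convex_interior)
    have ne: "interior T \<noteq> {}" by (rule corner_interior_nonempty[OF c])
    have sub: "interior T \<subseteq> - X" using int[OF T] by auto
    obtain K where K: "K \<in> components (- X)" "interior T \<subseteq> K"
      using exists_component_superset[OF sub _ conn] ne by (metis sub subset_empty)
    have "K = interior T"
    proof (rule ccontr)
      assume "K \<noteq> interior T"
      then have "K \<inter> frontier (interior T) \<noteq> {}"
        using in_components_connected[OF K(1)] K(2) ne by (intro connected_Int_frontier) auto
      moreover have "frontier (interior T) \<subseteq> X"
        using bd[OF T] corner_closure_interior[OF c] by (auto simp: frontier_def)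
      ultimately show False using in_components_subset[OF K(1)] by auto
    qed
    then show ?thesis using K by simp
  qed
  moreover have "K \<in> interior ` \<T>" if K: "K \<in> components (- X)" for K
  proof -
    obtain x where x: "x \<in> K" using in_components_nonempty[OF K] by auto
    then have "x \<notin> X" using in_components_subset[OF K] by auto
    moreover obtain T where T: "T \<in> \<T>" "x \<in> T" using cover by auto
    ultimately have "x \<in> interior T" using bd by auto
    then have "K = interior T" using components_eq[OF K comp[OF T(1)]] x by auto
    then show ?thesis using T by auto
  qed
  ultimately show eq: "components (- X) = interior ` \<T>" by auto
  have "closure (interior T) = T" if "T \<in> \<T>" for T
    using tiles[OF that] corner_closure_interior by blast
  then show "closure ` components (- X) = \<T>" unfolding eq image_image by simp
qed

text \<open>Infinitely many values in a compact disc would accumulate somewhere, which contradicts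
  their mutual distance.\<close>

lemma separated_finite:
  fixes f :: "'a \<Rightarrow> complex"
  assumes \<delta>: "0 < \<delta>" and sep: "\<And>x y. x \<in> S \<Longrightarrow> y \<in> S \<Longrightarrow> x \<noteq> y \<Longrightarrow> \<delta> \<le> dist (f x) (f y)"
  shows "finite {x \<in> S. dist (f x) c \<le> R}"
proof (rule ccontr)
  let ?A = "{x \<in> S. dist (f x) c \<le> R}"
  assume "infinite ?A"
  moreover have inj: "inj_on f ?A"
  proof (rule inj_onI, rule ccontr)
    fix x y assume "x \<in> ?A" "y \<in> ?A" "f x = f y" "x \<noteq> y"
    then show False using sep[of x y] \<delta> by auto
  qed
  ultimately have "infinite (f ` ?A)" using finite_imageD by blast
  moreover have "f ` ?A \<subseteq> cball c R" by (auto simp: dist_commute)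
  ultimately obtain l where l: "l islimpt (f ` ?A)"
    using compact_cball[of c R] by (meson Heine_Borel_imp_Bolzano_Weierstrass)
  obtain y where y: "y \<in> f ` ?A" "y \<noteq> l" "dist y l < \<delta>/2"
    using islimpt_approachable[THEN iffD1, OF l, rule_format, of "\<delta>/2"] \<delta> by auto
  \<comment> \<open>Choosing the second point strictly closer to the limit point makes it different
    from the first.\<close>
  then obtain z where z: "z \<in> f ` ?A" "z \<noteq> l" "dist z l < dist y l"
    using islimpt_approachable[THEN iffD1, OF l, rule_format, of "dist y l"] by auto
  have "y \<noteq> z" "dist y z < \<delta>" using y z dist_triangle2[of y z l] by auto
  then show False using sep y z by force
qed

lemma exists_nearest:
  fixes f :: "'a \<Rightarrow> complex"
  assumes fin: "\<And>R. finite {x \<in> S. dist (f x) c \<le> R}" and "S \<noteq> {}"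
  shows "\<exists>x\<in>S. \<forall>y\<in>S. dist (f x) c \<le> dist (f y) c"
proof -
  obtain z where z: "z \<in> S" using assms by auto
  let ?A = "{x \<in> S. dist (f x) c \<le> dist (f z) c}"
  have "finite ?A" "?A \<noteq> {}" using fin z by auto
  let ?m = "Min ((\<lambda>x. dist (f x) c) ` ?A)"
  have "?m \<in> (\<lambda>x. dist (f x) c) ` ?A" using \<open>finite ?A\<close> \<open>?A \<noteq> {}\<close> by (intro Min_in) auto
  then obtain x where x: "x \<in> ?A" "dist (f x) c = ?m" by auto
  have "dist (f x) c \<le> dist (f y) c" if "y \<in> ?A" for y
    unfolding x(2) using \<open>finite ?A\<close> that by (intro Min_le) auto
  with x(1)
have "x \<in> S" "dist (f x) c \<le> dist (f z) c" "\<And>y. y \<in> S \<Longrightarrow> dist (f y) c \<le> dist (f z) c \<Longrightarrow> dist (f x) c \<le> dist (f y) c"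
    by auto
  then show ?thesis by (intro bexI[of _ x]) (force, simp)
qed

section \<open>From packings to tilings\<close>

lemma cone_coords:
  assumes "0 < cross e f" "0 \<le> cross e u" "0 \<le> cross u f"
  obtains s t where "u = s *\<^sub>R e + t *\<^sub>R f" "0 \<le> s" "0 \<le> t"
proof -
  have "cross e f *\<^sub>R u = cross u f *\<^sub>R e + cross e u *\<^sub>R f"
    by (simp add: complex_eq_iff cross_def algebra_simps)
  then have "u = (1 / cross e f) *\<^sub>R (cross u f *\<^sub>R e + cross e u *\<^sub>R f)"
    using assms(1) by (metis divide_self_if less_irrefl scaleR_one scaleR_scaleR times_divide_eq_left mult.left_neutral)
  then have "u = (cross u f / cross e f) *\<^sub>R e + (cross e u / cross e f) *\<^sub>R f" by (simp add: scaleR_add_right)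
  then show ?thesis using that assms by simp
qed

lemma disjoint_balls_dist:
  fixes x y :: complex
  assumes "0 < a" "0 < b"
  shows "ball x a \<inter> ball y b = {} \<longleftrightarrow> a + b \<le> dist x y"
proof
  assume dis: "ball x a \<inter> ball y b = {}"
  show "a + b \<le> dist x y"
  proof (rule ccontr)
    assume "\<not> ?thesis"
    then have less: "dist x y < a + b" by simp
    define z where "z = x + (a / (a + b)) *\<^sub>R (y - x)"
    have "dist x z = a / (a + b) * dist x y"
      using assms by (simp add: z_def dist_norm norm_minus_commute)
    also have "\<dots> < a / (a + b) * (a + b)" using assms less by (intro mult_strict_left_mono) auto
    finally have 1: "dist x z < a" using assms by simp
    have "y - z = (b / (a + b)) *\<^sub>R (y - x)"
    proof -
      have "1 - a / (a + b) = b / (a + b)" using assms by (simp add: field_simps)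
      moreover have "y - z = (1 - a / (a + b)) *\<^sub>R (y - x)" by (simp add: z_def algebra_simps)
      ultimately show ?thesis by simp
    qed
    then have "dist y z = b / (a + b) * dist x y"
      using assms by (simp add: dist_norm norm_minus_commute)
    also have "\<dots> < b / (a + b) * (a + b)" using assms less by (intro mult_strict_left_mono) auto
    finally have "dist y z < b" using assms by simp
    then show False using 1 dis by auto
  qed
next
  assume le: "a + b \<le> dist x y"
  show "ball x a \<inter> ball y b = {}"
  proof (rule ccontr)
    assume "ball x a \<inter> ball y b \<noteq> {}"
    then obtain z where "dist x z < a" "dist y z < b" by auto
    then show False using le dist_triangle2[of x y z] by (simp add: dist_commute)
  qed
qed

lemma packing_iff:
  "packing P \<longleftrightarrow> (\<forall>D\<in>P. 0 < snd D) \<and>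
    (\<forall>D\<in>P. \<forall>E\<in>P. D \<noteq> E \<longrightarrow> snd D + snd E \<le> dist (fst D) (fst E))"
proof -
  have "interior (region D) \<inter> interior (region E) = {} \<longleftrightarrow> snd D + snd E \<le> dist (fst D) (fst E)"
    if "0 < snd D" "0 < snd E" for D E
    using disjoint_balls_dist[OF that] by (simp add: region_def)
  then show ?thesis unfolding packing_def pairwise_def by blast
qed

text \<open>Each angle is at least pi/3, with equality only between two small neighbours, so there
  are at most six neighbours, and six only if all are small. For fewer neighbours every assignment
  of radii is tested: the total is linear in \<open>alph\<close>, and \<open>alph_bounds\<close>
  excludes the value 2 pi unless one small and three unit discs occur, which gives 2
  \<open>alph\<close> + 2 (pi - \<open>alph\<close>).\<close>

lemma small_corona_radii:
  assumes rs: "set rs \<subseteq> {1, rho}"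
    and sum: "(\<Sum>i<length rs. tri_angle rho (rs ! i) (rs ! (Suc i mod length rs))) = 2 * pi"
  shows "set rs \<subseteq> {rho} \<or> rs \<in> {[rho, 1, 1, 1], [1, rho, 1, 1], [1, 1, rho, 1], [1, 1, 1, rho]}"
proof -
  let ?n = "length rs"
  let ?f = "\<lambda>i. tri_angle rho (rs ! i) (rs ! (Suc i mod ?n))"
  have val: "tri_angle rho x y \<ge> pi/3 \<and> (tri_angle rho x y = pi/3 \<longrightarrow> x = rho)"
    if "x \<in> {1, rho}" "y \<in> {1, rho}" for x y
    using that alph_bounds by (elim insertE emptyE; simp add: tri_angle_values)
  have mem: "rs ! i \<in> {1, rho}" if "i < ?n" for i using rs nth_mem[OF that] by blast
  have f: "?f i \<ge> pi/3" "?f i = pi/3 \<Longrightarrow> rs ! i = rho" if "i < ?n" for i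
    using val mem[OF that] mem[of "Suc i mod ?n"] that by (metis gr_implies_not0 mod_less_divisor neq0_conv)+
  have "(\<Sum>i<?n. pi/3) \<le> (\<Sum>i<?n. ?f i)" using f by (intro sum_mono) auto
  then have "real ?n * (pi/3) \<le> 2 * pi" using sum by simp
  then have "real ?n * pi \<le> 6 * pi" by simp
  then have "real ?n \<le> 6" by (simp only: mult_le_cancel_right_pos[OF pi_gt_zero])
  then have le6: "?n \<le> 6" by simp
  show ?thesis
  proof (cases "?n = 6")
    case True
    have "\<forall>i<?n. ?f i = pi/3"
    proof (rule ccontr)
      assume "\<not> ?thesis"
      then obtain i where i: "i < ?n" "pi/3 < ?f i" using f by force
      have "(\<Sum>i<?n. pi/3) < (\<Sum>i<?n. ?f i)"
        using f i by (intro sum_strict_mono_ex1) auto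
      then show False using sum True by simp
    qed
    then show ?thesis using f(2) by (metis in_set_conv_nth insertI1 subsetI)
  next
    case False
    have pp: "0 < pi" by simp
    have "?n = 0 \<or> ?n = 1 \<or> ?n = 2 \<or> ?n = 3 \<or> ?n = 4 \<or> ?n = 5" using le6 False by linarith
    then consider (0) "rs = []" | (1) a where "rs = [a]" | (2) a b where "rs = [a, b]"
      | (3) a b c where "rs = [a, b, c]" | (4) a b c d where "rs = [a, b, c, d]"
      | (5) a b c d e where "rs = [a, b, c, d, e]"
      by (auto simp: length_Suc_conv eval_nat_numeral)
    then show ?thesis
    proof cases
      case 0 then show ?thesis by simp
    next
      case 1
      then have "tri_angle rho a a = 2 * pi" "a \<in> {1, rho}" using sum rs by auto
      then show ?thesis using tri_angle_bounds(2)[of rho a a] rho_pos by auto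
    next
      case 2
      have "tri_angle rho a b + tri_angle rho b a = 2 * pi"
        using sum unfolding 2 by (simp add: mod_Suc add.assoc)
      moreover have "a \<in> {1, rho}" "b \<in> {1, rho}"
        using rs unfolding 2 by simp_all
      ultimately have sums: "tri_angle rho a b + tri_angle rho b a = 2 * pi" "a \<in> {1, rho}" "b \<in> {1, rho}" by blast+
      then show ?thesis using tri_angle_bounds(2)[of rho a b] tri_angle_bounds(2)[of rho b a] rho_pos by auto
    next
      case 3
      have "tri_angle rho a b + tri_angle rho b c + tri_angle rho c a = 2 * pi"
        using sum unfolding 3 by (simp add: mod_Suc add.assoc)
      moreover have "a \<in> {1, rho}" "b \<in> {1, rho}" "c \<in> {1, rho}"
        using rs unfolding 3 by simp_all
      ultimately have sums: "tri_angle rho a b + tri_angle rho b c + tri_angle rho c a = 2 * pi" "a \<in> {1, rho}" "b \<in> {1, rho}" "c \<in> {1, rho}" by blast+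
      from sums show ?thesis unfolding 3 using alph_bounds pp
        by (elim insertE emptyE; simp only: tri_angle_values; linarith?)
    next
      case 4
      have "tri_angle rho a b + tri_angle rho b c + tri_angle rho c d + tri_angle rho d a = 2 * pi"
        using sum unfolding 4 by (simp add: mod_Suc add.assoc)
      moreover have "a \<in> {1, rho}" "b \<in> {1, rho}" "c \<in> {1, rho}" "d \<in> {1, rho}"
        using rs unfolding 4 by simp_all
      ultimately have sums: "tri_angle rho a b + tri_angle rho b c + tri_angle rho c d + tri_angle rho d a = 2 * pi" "a \<in> {1, rho}" "b \<in> {1, rho}" "c \<in> {1, rho}" "d \<in> {1, rho}" by blast+
      from sums show ?thesis unfolding 4 using alph_bounds pp
        by (elim insertE emptyE; simp only: tri_angle_values; (simp; fail | linarith))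
    next
      case 5
      have "tri_angle rho a b + tri_angle rho b c + tri_angle rho c d + tri_angle rho d e + tri_angle rho e a = 2 * pi"
        using sum unfolding 5 by (simp add: mod_Suc add.assoc)
      moreover have "a \<in> {1, rho}" "b \<in> {1, rho}" "c \<in> {1, rho}" "d \<in> {1, rho}" "e \<in> {1, rho}"
        using rs unfolding 5 by simp_all
      ultimately have sums: "tri_angle rho a b + tri_angle rho b c + tri_angle rho c d + tri_angle rho d e + tri_angle rho e a = 2 * pi" "a \<in> {1, rho}" "b \<in> {1, rho}" "c \<in> {1, rho}" "d \<in> {1, rho}" "e \<in> {1, rho}" by blast+
      from sums show ?thesis unfolding 5 using alph_bounds pp
        by (elim insertE emptyE; simp only: tri_angle_values; linarith?)
    qed
  qed
qed

lemma packing_of_tiling_unitI: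
  "T \<in> \<T> \<Longrightarrow> v extreme_point_of T \<Longrightarrow> (v, 1) \<in> packing_of_tiling r \<alpha> \<T>"
  unfolding packing_of_tiling_def by blast

lemma packing_of_tiling_smallI:
  assumes "rhombus \<alpha> a b c d" "convex hull {a, b, c, d} \<in> \<T>" "small_pair r a b c d p q"
  shows "(p, r) \<in> packing_of_tiling r \<alpha> \<T>" "(q, r) \<in> packing_of_tiling r \<alpha> \<T>"
proof -
  have "{(p, r), (q, r)} \<in> {{(p, r), (q, r)} | p q. \<exists>a b c d. rhombus \<alpha> a b c d \<and> convex hull {a, b, c, d} \<in> \<T> \<and>
        small_pair r a b c d p q}"
    by (rule CollectI, rule exI[of _ p], rule exI[of _ q]) (use assms in blast)
  then have "{(p, r), (q, r)} \<subseteq> packing_of_tiling r \<alpha> \<T>"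
    unfolding packing_of_tiling_def by (intro subset_trans[OF Union_upper Un_upper2])
  then show "(p, r) \<in> packing_of_tiling r \<alpha> \<T>" "(q, r) \<in> packing_of_tiling r \<alpha> \<T>" by auto
qed

lemma packing_of_tilingE:
  assumes "D \<in> packing_of_tiling r \<alpha> \<T>"
  obtains (unit) v T where "D = (v, 1)" "T \<in> \<T>" "v extreme_point_of T"
    | (small) p q a b c d where "D = (p, r) \<or> D = (q, r)" "rhombus \<alpha> a b c d"
        "convex hull {a, b, c, d} \<in> \<T>" "small_pair r a b c d p q"
  using assms unfolding packing_of_tiling_def by blast

locale compact_one_rho =
  fixes P assumes P: "compact_packing_using 1 rho P"
begin

lemma rad: "D \<in> P \<Longrightarrow> snd D \<in> {1, rho}"
  using P by (auto simp: compact_packing_using_def)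

lemma radii_occur: "\<exists>x. (x, 1) \<in> P" "\<exists>p. (p, rho) \<in> P"
proof -
  have "1 \<in> snd ` P" "rho \<in> snd ` P" using P by (auto simp: compact_packing_using_def)
  then show "\<exists>x. (x, 1) \<in> P" "\<exists>p. (p, rho) \<in> P" by force+
qed

lemma rad_pos: "D \<in> P \<Longrightarrow> 0 < snd D"
  using rad[of D] rho_pos by auto

lemma sep: "D \<in> P \<Longrightarrow> E \<in> P \<Longrightarrow> D \<noteq> E \<Longrightarrow> snd D + snd E \<le> dist (fst D) (fst E)"
  using P by (auto simp: compact_packing_using_def compact_packing_def packing_iff)

lemma sur: "D \<in> P \<Longrightarrow> surrounded P D"
  using P by (auto simp: compact_packing_using_def compact_packing_def)

lemma tangent_neq: "D \<in> P \<Longrightarrow> tangent D E \<Longrightarrow> 0 < snd E \<Longrightarrow> D \<noteq> E"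
  using rad_pos[of D] by (auto simp: tangent_def)

lemma finite_near: "S \<subseteq> P \<Longrightarrow> finite {D \<in> S. dist (fst D) c \<le> R}"
proof (rule separated_finite[of "2 * rho"])
  fix D E assume "S \<subseteq> P" "D \<in> S" "E \<in> S" "D \<noteq> E"
  then have DE: "D \<in> P" "E \<in> P" "D \<noteq> E" by auto
  have "snd D + snd E \<le> dist (fst D) (fst E)" by (rule sep[OF DE])
  moreover have "rho \<le> snd D" "rho \<le> snd E"
    using rad[OF DE(1)] rad[OF DE(2)] rho_bounds by auto
  ultimately show "2 * rho \<le> dist (fst D) (fst E)" by simp
qed (simp add: rho_pos)

lemma nearest: "S \<subseteq> P \<Longrightarrow> S \<noteq> {} \<Longrightarrow> \<exists>D\<in>S. \<forall>E\<in>S. dist (fst D) c \<le> dist (fst E) c"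
  by (rule exists_nearest) (auto intro: finite_near)

lemma unit_dist: "(x, 1) \<in> P \<Longrightarrow> (y, 1) \<in> P \<Longrightarrow> x \<noteq> y \<Longrightarrow> 2 \<le> dist x y"
  using sep[of "(x, 1)" "(y, 1)"] by auto

text \<open>In the first alternative each neighbour \<open>E\<close> comes with a second small disc
  \<open>F\<close> tangent to both, namely its successor in the list. This is what later transfers
  the alternative to \<open>E\<close>: a ring with a single small disc cannot contain both
  \<open>D\<close> and \<open>F\<close>. In the second alternative the list is rotated so that it
  starts with the small disc.\<close>

lemma small_corona:
  assumes D: "D \<in> P" "snd D = rho"
  shows "(\<forall>E\<in>P. tangent D E \<longrightarrow> snd E = rho \<and> (\<exists>F\<in>P. tangent D F \<and> tangent E F \<and> snd F = rho)) \<or>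
    (\<exists>q b a d. {E \<in> P. tangent D E} = {q, b, a, d} \<and> snd q = rho \<and> snd b = 1 \<and> snd a = 1 \<and> snd d = 1 \<and> b \<noteq> d \<and>
      tangent q b \<and> tangent b a \<and> tangent a d \<and> tangent d q)"
proof -
  obtain Ds where Ds: "set Ds = {E \<in> P. tangent D E}"
     "sorted_wrt (<) (map (\<lambda>E. Arg2pi (fst E - fst D)) Ds)"
     "\<And>i. i<length Ds \<Longrightarrow> tangent (Ds ! i) (Ds ! (Suc i mod length Ds))"
     "(\<Sum>i<length Ds. vertex_angle (fst (Ds ! i)) (fst D) (fst (Ds ! (Suc i mod length Ds)))) = 2 * pi"
    using sur[OF D(1)] unfolding surrounded_def by blast
  let ?n = "length Ds"
  have ne: "0 < ?n" using Ds(4) by (cases Ds) auto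
  have md: "Suc i mod ?n < ?n" for i using ne by simp
  have mem: "Ds ! i \<in> P" "tangent D (Ds ! i)" if "i < ?n" for i
    using that Ds(1) nth_mem[of i Ds] by auto
  have dist: "distinct Ds"
    using Ds(2) by (metis distinct_map strict_sorted_iff)
  have "vertex_angle (fst (Ds ! i)) (fst D) (fst (Ds ! (Suc i mod ?n))) =
    tri_angle rho (map snd Ds ! i) (map snd Ds ! (Suc i mod ?n))" if i: "i < ?n" for i
    using vertex_angle_tangent[OF mem(2)[OF i] mem(2)[OF md] Ds(3)[OF i]]
      rad_pos[OF mem(1)[OF i]] rad_pos[OF mem(1)[OF md]] D i md[of i] rho_pos by simp
  then have "(\<Sum>i<length (map snd Ds). tri_angle rho (map snd Ds ! i) (map snd Ds ! (Suc i mod length (map snd Ds)))) = 2 * pi"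
    using Ds(4) by simp
  moreover have "set (map snd Ds) \<subseteq> {1, rho}" using Ds(1) rad by auto
  ultimately consider "set (map snd Ds) \<subseteq> {rho}"
    | "map snd Ds \<in> {[rho, 1, 1, 1], [1, rho, 1, 1], [1, 1, rho, 1], [1, 1, 1, rho]}"
    using small_corona_radii by blast
  then show ?thesis
  proof cases
    case 1
    have "snd E = rho \<and> (\<exists>F\<in>P. tangent D F \<and> tangent E F \<and> snd F = rho)" if E: "E \<in> P" "tangent D E" for E
    proof -
      obtain i where i: "i < ?n" "Ds ! i = E" using E Ds(1) by (metis (mono_tags, lifting) in_set_conv_nth mem_Collect_eq)
      have "snd (Ds ! j) = rho" if "j < ?n" for j
      proof -
        have "snd (Ds ! j) \<in> set (map snd Ds)" using that by simp
        then show ?thesis using 1 by blast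
      qed
      then show ?thesis using i mem[OF md] Ds(3)[OF i(1)] md by metis
    qed
    then show ?thesis by blast
  next
    case 2
    then have "?n = 4" by (auto dest!: arg_cong[where f = length])
    then obtain x0 x1 x2 x3 where x: "Ds = [x0, x1, x2, x3]"
      by (auto simp: length_Suc_conv eval_nat_numeral)
    have t: "tangent x0 x1" "tangent x1 x2" "tangent x2 x3" "tangent x3 x0"
      using Ds(3)[of 0] Ds(3)[of "Suc 0"] Ds(3)[of "Suc (Suc 0)"] Ds(3)[of "Suc (Suc (Suc 0))"]
      unfolding x by (simp_all add: mod_Suc)
    have N: "{E \<in> P. tangent D E} = {x0, x1, x2, x3}" using Ds(1) x by auto
    have dd: "x0 \<noteq> x2" "x1 \<noteq> x3" using dist x by auto
    have R: "snd q = rho \<Longrightarrow> snd b = 1 \<Longrightarrow> snd a = 1 \<Longrightarrow> snd d = 1 \<Longrightarrow> {x0, x1, x2, x3} = {q, b, a, d} \<Longrightarrow> b \<noteq> d \<Longrightarrow>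
      tangent q b \<Longrightarrow> tangent b a \<Longrightarrow> tangent a d \<Longrightarrow> tangent d q \<Longrightarrow> ?thesis" for q b a d
      unfolding N by blast
    from 2 consider "[snd x0, snd x1, snd x2, snd x3] = [rho, 1, 1, 1]" | "[snd x0, snd x1, snd x2, snd x3] = [1, rho, 1, 1]"
      | "[snd x0, snd x1, snd x2, snd x3] = [1, 1, rho, 1]" | "[snd x0, snd x1, snd x2, snd x3] = [1, 1, 1, rho]"
      unfolding x by auto
    then show ?thesis
    proof cases
      case 1 then show ?thesis by (intro R[of x0 x1 x2 x3]) (use t dd in auto)
    next
      case 2 then show ?thesis by (intro R[of x1 x2 x3 x0]) (use t dd in auto)
    next
      case 3 then show ?thesis by (intro R[of x2 x3 x0 x1]) (use t dd in auto)
    next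
      case 4 then show ?thesis by (intro R[of x3 x0 x1 x2]) (use t dd in auto)
    qed
  qed
qed

text \<open>A neighbour \<open>E\<close> of a disc in \<open>S\<close> has two distinct small
  neighbours, so its ring is again all small and \<open>S\<close> is closed under tangency. For the
  disc of \<open>S\<close> nearest to a unit disc \<open>V\<close>, the cone towards
  \<open>V\<close> is spanned by two discs of \<open>S\<close> forming an equilateral triangle with
  it, and \<open>V\<close> would have to lie near this triangle.\<close>

lemma no_small_disc_surrounded_by_small_discs:
  assumes D: "D \<in> P" "snd D = rho" and all: "\<forall>E\<in>P. tangent D E \<longrightarrow> snd E = rho"
  shows False
proof -
  define S where "S = {D \<in> P. snd D = rho \<and> (\<forall>E\<in>P. tangent D E \<longrightarrow> snd E = rho)}"
  have "D \<in> S" using assms by (simp add: S_def)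
  then have Sne: "S \<noteq> {}" by blast
  have SP: "S \<subseteq> P" by (auto simp: S_def)
  have closed: "E \<in> S" if D: "D \<in> S" and E: "E \<in> P" "tangent D E" for D E
  proof -
    have D': "D \<in> P" "snd D = rho" "\<forall>E\<in>P. tangent D E \<longrightarrow> snd E = rho" using D by (auto simp: S_def)
    from small_corona[OF D'(1,2)]
    have "\<exists>F\<in>P. tangent D F \<and> tangent E F \<and> snd F = rho"
    proof
      assume "\<exists>q b a d. {E \<in> P. tangent D E} = {q, b, a, d} \<and> snd q = rho \<and> snd b = 1 \<and> snd a = 1 \<and> snd d = 1 \<and> b \<noteq> d \<and>
        tangent q b \<and> tangent b a \<and> tangent a d \<and> tangent d q"
      then obtain b where "b \<in> P" "tangent D b" "snd b = 1" by blast
      then show ?thesis using D'(3) rho_bounds by auto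
    qed (use E in blast)
    then obtain F where F: "F \<in> P" "tangent D F" "tangent E F" "snd F = rho" by blast
    have Er: "snd E = rho" using D' E by auto
    have DF: "D \<noteq> F" using tangent_neq[OF D'(1) F(2)] F(4) rho_pos by auto
    from small_corona[OF E(1) Er] show "E \<in> S"
    proof
      assume "\<exists>q b a d. {E' \<in> P. tangent E E'} = {q, b, a, d} \<and> snd q = rho \<and> snd b = 1 \<and> snd a = 1 \<and> snd d = 1 \<and> b \<noteq> d \<and>
        tangent q b \<and> tangent b a \<and> tangent a d \<and> tangent d q"
      then obtain q b a d where N: "{E' \<in> P. tangent E E'} = {q, b, a, d}" "snd b = 1" "snd a = 1" "snd d = 1" by blast
      have "D \<in> {q, b, a, d}" "F \<in> {q, b, a, d}"
        unfolding N(1)[symmetric] using D' F tangent_sym[OF E(2)] by auto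
      then show ?thesis using N DF D'(2) F(4) rho_bounds by auto
    qed (use E Er in \<open>auto simp: S_def\<close>)
  qed
  obtain V where V: "V \<in> P" "snd V = 1" using radii_occur by auto
  obtain D where D: "D \<in> S" "\<And>E. E \<in> S \<Longrightarrow> dist (fst D) (fst V) \<le> dist (fst E) (fst V)"
    using nearest[OF SP Sne] by blast
  have D': "D \<in> P" "snd D = rho" using D by (auto simp: S_def)
  have "D \<noteq> V" using D' V rho_bounds by auto
  then have DV: "1 + rho \<le> norm (fst V - fst D)"
    using sep[OF D'(1) V(1)] D' V by (simp add: dist_norm norm_minus_commute)
  then have nz: "fst V - fst D \<noteq> 0" using rho_pos by auto
  from surrounded_cone[OF sur[OF D'(1)] rad_pos D'(1) nz] obtain E F where
    EF: "E \<in> P" "F \<in> P" "tangent D E" "tangent D F" "tangent E F"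
      "0 < cross (fst E - fst D) (fst F - fst D)"
      "0 \<le> cross (fst E - fst D) (fst V - fst D)" "0 \<le> cross (fst V - fst D) (fst F - fst D)" by blast
  have ES: "E \<in> S" "F \<in> S" using closed[OF D(1)] EF by auto
  then have rE: "snd E = rho" "snd F = rho" by (auto simp: S_def)
  define e f u where "e = fst E - fst D" and "f = fst F - fst D" and "u = fst V - fst D"
  have n: "norm e = 2 * rho" "norm f = 2 * rho" "norm (e - f) = 2 * rho"
    using EF rE D' by (auto simp: tangent_def dist_norm norm_minus_commute e_def f_def)
  then have ef: "e \<bullet> f = 2 * rho\<^sup>2" by (simp add: dot_norm_neg power2_eq_square)
  have ee: "e \<bullet> e = 4 * rho\<^sup>2" "f \<bullet> f = 4 * rho\<^sup>2" using n by (auto simp: dot_square_norm power2_eq_square)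
  obtain s t where st: "u = s *\<^sub>R e + t *\<^sub>R f" "0 \<le> s" "0 \<le> t"
    using cone_coords[of e f u] EF by (auto simp: e_def f_def u_def)
  \<comment> \<open>As \<open>A\<close> is not closer to \<open>V\<close>, the point
    \<open>u\<close> is on the near side of the perpendicular bisector of 0 and \<open>a\<close>.
    For both sides of the cone together this gives s + t \<le> 2/3, so \<open>u\<close> has norm at
    most 4 \<open>rho\<close> / 3, less than the distance 1 + \<open>rho\<close> required for
    disjoint discs.\<close>
  have far: "a \<bullet> u \<le> 2 * rho\<^sup>2" if "A \<in> S" "a = fst A - fst D" "norm a = 2 * rho" for A a
  proof -
    have "norm u \<le> norm (a - u)" using D(2)[OF that(1)] by (simp add: that u_def dist_norm norm_minus_commute)
    then have "(norm u)\<^sup>2 \<le> (norm (a - u))\<^sup>2" by (intro power_mono) auto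
    then show ?thesis using that(3) by (simp add: dot_norm_neg power2_eq_square)
  qed
  have "e \<bullet> u \<le> 2 * rho\<^sup>2" "f \<bullet> u \<le> 2 * rho\<^sup>2" using far[OF ES(1) e_def n(1)] far[OF ES(2) f_def n(2)] .
  moreover have "e \<bullet> u = s * (4 * rho\<^sup>2) + t * (2 * rho\<^sup>2)" "f \<bullet> u = s * (2 * rho\<^sup>2) + t * (4 * rho\<^sup>2)"
    unfolding st(1) inner_add_right inner_scaleR_right ee ef inner_commute[of f e] by auto
  ultimately have "rho\<^sup>2 * (3 * (s + t)) \<le> rho\<^sup>2 * 2" by (simp add: algebra_simps)
  then have "3 * (s + t) \<le> 2" using rho_pos by (simp add: mult_le_cancel_left_pos)
  moreover have "norm u \<le> s * (2 * rho) + t * (2 * rho)"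
    using norm_triangle_ineq[of "s *\<^sub>R e" "t *\<^sub>R f"] st n by simp
  moreover have "s * (2 * rho) + t * (2 * rho) = 2 * rho * (s + t)" by (simp add: algebra_simps)
  moreover have "2 * rho * (s + t) \<le> 2 * rho * (2/3)" if "3 * (s + t) \<le> 2"
    using rho_pos that by (intro mult_left_mono) auto
  ultimately have "norm u \<le> 2 * rho * (2/3)" by linarith
  then show False using DV rho_pos rho_bounds by (simp add: u_def)
qed

lemma small_corona_unique:
  assumes D: "D \<in> P" "snd D = rho"
  obtains q b a d where "{E \<in> P. tangent D E} = {(q, rho), (b, 1), (a, 1), (d, 1)}" "b \<noteq> d"
      "tangent (q, rho) (b, 1)" "tangent (b, 1) (a, 1)" "tangent (a, 1) (d, 1)" "tangent (d, 1) (q, rho)"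
proof -
  have "\<exists>q b a d. {E \<in> P. tangent D E} = {q, b, a, d} \<and> snd q = rho \<and> snd b = 1 \<and> snd a = 1 \<and> snd d = 1 \<and> b \<noteq> d \<and>
      tangent q b \<and> tangent b a \<and> tangent a d \<and> tangent d q"
    using small_corona[OF D]
  proof
    assume "\<forall>E\<in>P. tangent D E \<longrightarrow> snd E = rho \<and> (\<exists>F\<in>P. tangent D F \<and> tangent E F \<and> snd F = rho)"
    then have "\<forall>E\<in>P. tangent D E \<longrightarrow> snd E = rho" by simp
    then show ?thesis using no_small_disc_surrounded_by_small_discs[OF D] by simp
  qed
  then obtain q b a d where *: "{E \<in> P. tangent D E} = {q, b, a, d}" "snd q = rho" "snd b = 1" "snd a = 1" "snd d = 1" "b \<noteq> d"
      "tangent q b" "tangent b a" "tangent a d" "tangent d q" by blast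
  obtain q' b' a' d' where e: "q = (q', rho)" "b = (b', 1)" "a = (a', 1)" "d = (d', 1)"
    using *(2-5) by (metis prod.collapse)
  show ?thesis by (rule that[of q' b' a' d']) (use * in \<open>simp_all add: e\<close>)
qed

text \<open>The only small neighbour \<open>q\<close> of the disc at \<open>p\<close> has a ring of
  the same kind, with \<open>p\<close> as its small disc. The two rings share the unit discs
  \<open>b\<close> and \<open>d\<close>, and their remaining unit discs \<open>a\<close> and
  \<open>c\<close> complete the rhombus.\<close>

lemma small_rhombus:
  assumes D: "(p, rho) \<in> P"
  obtains a b c d q where "rhombus alph a b c d" "small_pair rho a b c d p q"
    "(a, 1) \<in> P" "(b, 1) \<in> P" "(c, 1) \<in> P" "(d, 1) \<in> P" "(q, rho) \<in> P"
    "{E \<in> P. tangent (p, rho) E} = {(q, rho), (b, 1), (a, 1), (d, 1)}"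
proof -
  obtain q b a d where N: "{E \<in> P. tangent (p, rho) E} = {(q, rho), (b, 1), (a, 1), (d, 1)}" "b \<noteq> d"
      "tangent (q, rho) (b, 1)" "tangent (b, 1) (a, 1)" "tangent (a, 1) (d, 1)" "tangent (d, 1) (q, rho)"
    by (rule small_corona_unique[OF D]) simp
  have inP: "(q, rho) \<in> P" "(b, 1) \<in> P" "(a, 1) \<in> P" "(d, 1) \<in> P"
    and tp: "tangent (p, rho) (q, rho)" "tangent (p, rho) (b, 1)" "tangent (p, rho) (a, 1)" "tangent (p, rho) (d, 1)"
    using N(1) by blast+
  obtain p' b' c d' where M: "{E \<in> P. tangent (q, rho) E} = {(p', rho), (b', 1), (c, 1), (d', 1)}" "b' \<noteq> d'"
      "tangent (p', rho) (b', 1)" "tangent (b', 1) (c, 1)" "tangent (c, 1) (d', 1)" "tangent (d', 1) (p', rho)"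
    by (rule small_corona_unique[OF inP(1)]) simp
  have r1: "rho \<noteq> 1" using rho_bounds by simp
  have inP': "(p', rho) \<in> P" "(b', 1) \<in> P" "(c, 1) \<in> P" "(d', 1) \<in> P"
    and tq: "tangent (q, rho) (b', 1)" "tangent (q, rho) (c, 1)" "tangent (q, rho) (d', 1)"
    using M(1) by blast+
  have "(p, rho) \<in> {E \<in> P. tangent (q, rho) E}" using D tangent_sym[OF tp(1)] by simp
  then have p': "p' = p" unfolding M(1) using r1 by auto
  have tpb: "tangent (p, rho) (b', 1)" "tangent (p, rho) (d', 1)" using M(3,6) p' tangent_sym by auto
  have pq: "p \<noteq> q" using tp(1) rho_pos by (auto simp: tangent_def)
  have sym: "dist q b = 1 + rho" "dist q d = 1 + rho" "dist p b = 1 + rho" "dist p d = 1 + rho" "dist p a = 1 + rho"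
    "dist q b' = 1 + rho" "dist q d' = 1 + rho" "dist p b' = 1 + rho" "dist p d' = 1 + rho" "dist q c = 1 + rho" "dist p q = 2 * rho"
    using N(3,6) tp tq tpb by (auto simp: tangent_def dist_commute)
  \<comment> \<open>Two circles meet in at most two points: another common point \<open>x\<close>
    would form a rhombus with \<open>p\<close>, \<open>b\<close>, \<open>q\<close>, just as
    \<open>d\<close> does, and the fourth vertex is determined.\<close>
  have two: "x = b \<or> x = d" if x: "dist p x = 1 + rho" "dist q x = 1 + rho" for x
  proof (rule ccontr)
    assume "\<not> ?thesis"
    then have ne: "x \<noteq> b" "x \<noteq> d" by auto
    have 1: "q = b + d - p" by (rule equilateral_quad[of _ _ "1 + rho"]) (use sym pq N(2) in \<open>auto simp: dist_commute\<close>)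
    have 2: "q = b + x - p" by (rule equilateral_quad[of _ _ "1 + rho"]) (use sym pq ne x in \<open>auto simp: dist_commute\<close>)
    show False using 1 2 ne by auto
  qed
  have bd: "{b', d'} = {b, d}" using two[of b'] two[of d'] sym M(2) N(2) by auto
  have tc: "dist c b = 2" "dist c d = 2"
    using M(4,5) bd by (auto simp: tangent_def dist_commute doubleton_eq_iff)
  have ta: "dist a b = 2" "dist a d = 2" using N(4,5) by (auto simp: tangent_def dist_commute)
  have ac: "a \<noteq> c" using two[of a] sym ta by auto
  have eqq: "q = b + d - p" by (rule equilateral_quad[of _ _ "1 + rho"]) (use sym pq N(2) in \<open>auto simp: dist_commute\<close>)
  have c: "c = b + d - a" by (rule equilateral_quad[of _ _ 2]) (use tc ta ac N(2) in \<open>auto simp: dist_commute\<close>)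
  \<comment> \<open>The parallelogram law in the rhombus p, b, q, d with sides 1 +
    \<open>rho\<close> and diagonal 2 \<open>rho\<close>. This short diagonal then fixes the angle
    at \<open>a\<close> to be \<open>alph\<close>.\<close>
  have "(norm (b - d))\<^sup>2 = 4 + 8 * rho"
  proof -
    let ?x = "b - p" and ?y = "d - p"
    have n: "norm ?x = 1 + rho" "norm ?y = 1 + rho" "norm (?x + ?y) = 2 * rho"
      using sym eqq by (auto simp: dist_norm norm_minus_commute algebra_simps)
    have "b - d = ?x - ?y" by simp
    then have "(norm (b - d))\<^sup>2 = 2 * (norm ?x)\<^sup>2 + 2 * (norm ?y)\<^sup>2 - (norm (?x + ?y))\<^sup>2"
      using dot_norm[of ?x ?y] dot_norm_neg[of ?x ?y] by simp
    then show ?thesis unfolding n by (simp add: power2_eq_square algebra_simps)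
  qed
  moreover have nn: "norm (b - a) = 2" "norm (d - a) = 2" using ta by (auto simp: dist_norm norm_minus_commute)
  ultimately have "(b - a) \<bullet> (d - a) = 2 - 4 * rho" using dot_norm_neg[of "b - a" "d - a"] by simp
  then have r: "rhombus alph a b c d" using nn c by (simp add: rhombus_iff)
  have "p = a + small_ratio *\<^sub>R (c - a)" using small_centre_unique[OF r] tp by auto
  moreover have "q = c + small_ratio *\<^sub>R (a - c)"
    using small_centre_unique[OF rhombus_turn[OF r], of q] tq N(3,6) tangent_sym by auto
  ultimately have "small_pair rho a b c d p q" using small_pair_iff[OF r] by simp
  then show ?thesis using that r inP inP'(3) N(1) by blast
qed

definition tiles :: "complex set set" where
  "tiles = {convex hull {x, y, z} | x y z. dist x y = 2 \<and> dist y z = 2 \<and> dist z x = 2 \<and>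
      (x, 1) \<in> P \<and> (y, 1) \<in> P \<and> (z, 1) \<in> P} \<union>
    {convex hull {a, b, c, d} | a b c d. rhombus alph a b c d \<and>
      (a, 1) \<in> P \<and> (b, 1) \<in> P \<and> (c, 1) \<in> P \<and> (d, 1) \<in> P \<and>
      (\<exists>p q. small_pair rho a b c d p q \<and> (p, rho) \<in> P \<and> (q, rho) \<in> P)}"

lemma tiles_kind: "T \<in> tiles \<Longrightarrow> rhombus_tile alph T \<or> triangle_tile T"
  unfolding tiles_def rhombus_tile_def triangle_tile_def by blast

lemma tiles_corner: "T \<in> tiles \<Longrightarrow> \<exists>v b c. corner T v b c"
  using tiles_kind tile_corner by blast

lemma tiles_vertex: "T \<in> tiles \<Longrightarrow> v extreme_point_of T \<Longrightarrow> (v, 1) \<in> P"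
  unfolding tiles_def using extreme_point_of_convex_hull by blast

text \<open>The direction lies in a cone spanned by two tangent neighbours of \<open>v\<close>, and
  a tile at \<open>v\<close> contains both their centres. If one of them is small, then
  \<open>v\<close> and the other neighbour belong to its ring, and the centres of this ring lie in
  its rhombus; otherwise the three unit discs form a triangle.\<close>

lemma unit_star:
  assumes v: "(v, 1) \<in> P" and u: "u \<noteq> 0"
  shows "\<exists>T\<in>tiles. v extreme_point_of T \<and> (\<exists>\<epsilon>>0. v + \<epsilon> *\<^sub>R u \<in> T)"
proof -
  obtain E F where EF: "E \<in> P" "F \<in> P" "tangent (v, 1) E" "tangent (v, 1) F" "tangent E F"
      "0 < cross (fst E - v) (fst F - v)" "0 \<le> cross (fst E - v) u" "0 \<le> cross u (fst F - v)"
    using surrounded_cone[OF sur[OF v] rad_pos v u] by auto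
  have "\<exists>T\<in>tiles. v extreme_point_of T \<and> fst E \<in> T \<and> fst F \<in> T"
  proof -
    have small: "\<exists>T\<in>tiles. v extreme_point_of T \<and> fst E \<in> T \<and> fst F \<in> T"
      if E: "E \<in> P" and F: "F \<in> P" and t: "tangent (v, 1) E" "tangent E F" and r: "snd E = rho" for E F
    proof -
      obtain p where p: "E = (p, rho)" using r by (metis prod.collapse)
      have pP: "(p, rho) \<in> P" using E p by simp
      obtain a b c d q where R: "rhombus alph a b c d" "small_pair rho a b c d p q"
        "(a, 1) \<in> P" "(b, 1) \<in> P" "(c, 1) \<in> P" "(d, 1) \<in> P" "(q, rho) \<in> P"
        "{E \<in> P. tangent (p, rho) E} = {(q, rho), (b, 1), (a, 1), (d, 1)}"
        by (rule small_rhombus[OF pP])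
      have "(v, 1) \<in> {E \<in> P. tangent (p, rho) E}" "F \<in> {E \<in> P. tangent (p, rho) E}"
        using v F t tangent_sym p by auto
      then have "v \<in> {a, b, c, d}" and F': "fst F \<in> {a, b, c, d, q}"
        unfolding R(8) using rho_bounds by auto
      moreover have "p \<in> convex hull {a, b, c, d}" "q \<in> convex hull {a, b, c, d}"
        using R(2) rho_pos by (auto simp: small_pair_def region_def subset_iff)
      moreover have "{a, b, c, d} \<subseteq> convex hull {a, b, c, d}" by (rule hull_subset)
      moreover have "convex hull {a, b, c, d} \<in> tiles" using R E p unfolding tiles_def by blast
      ultimately show ?thesis using rhombus_extreme_iff[OF R(1)] p by (intro bexI[of _ "convex hull {a, b, c, d}"]) auto
    qed
    consider "snd E = rho" | "snd F = rho" | "snd E = 1" "snd F = 1" using rad EF by blast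
    then show ?thesis
    proof cases
      case 1 then show ?thesis using small[of E F] EF by auto
    next
      case 2 then show ?thesis using small[of F E] EF tangent_sym by auto
    next
      case 3
      have d: "dist v (fst E) = 2" "dist (fst E) (fst F) = 2" "dist (fst F) v = 2"
        using EF 3 by (auto simp: tangent_def dist_commute)
      have "(fst E, 1) \<in> P" "(fst F, 1) \<in> P" using EF 3 by (metis prod.collapse)+
      then have "convex hull {v, fst E, fst F} \<in> tiles" unfolding tiles_def using d v by blast
      moreover have "{v, fst E, fst F} \<subseteq> convex hull {v, fst E, fst F}" by (rule hull_subset)
      ultimately show ?thesis using triangle_extreme_iff[OF d] by (intro bexI[of _ "convex hull {v, fst E, fst F}"]) auto
    qed
  qed
  then obtain T where T: "T \<in> tiles" "v extreme_point_of T" "fst E \<in> T" "fst F \<in> T" by blast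
  have "v \<in> T" using T(2) by (simp add: extreme_point_of_def)
  let ?e = "fst E - v" and ?f = "fst F - v"
  obtain s t where ust: "u = s *\<^sub>R ?e + t *\<^sub>R ?f" and st: "0 \<le> s" "0 \<le> t"
    by (rule cone_coords[OF EF(6-8)])
  have "s + t \<noteq> 0"
  proof
    assume "s + t = 0"
    then have "s = 0" "t = 0" using st by auto
    then show False using ust u by simp
  qed
  then have pos: "0 < s + t" using st by simp
  \<comment> \<open>With this factor the coefficients add up to 1, so the point lies on the segment
    between the two centres, inside the convex tile.\<close>
  define \<epsilon> where "\<epsilon> = 1 / (s + t)"
  have "v + \<epsilon> *\<^sub>R u = (\<epsilon> * s) *\<^sub>R fst E + (\<epsilon> * t) *\<^sub>R fst F"
  proof -
    have "\<epsilon> * s + \<epsilon> * t = 1" using pos by (simp add: \<epsilon>_def flip: add_divide_distrib)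
    then have "v = (\<epsilon> * s + \<epsilon> * t) *\<^sub>R v" by simp
    then show ?thesis unfolding ust by (simp add: algebra_simps)
  qed
  moreover have "(\<epsilon> * s) *\<^sub>R fst E + (\<epsilon> * t) *\<^sub>R fst F \<in> T"
  proof (rule convexD)
    show "convex T" using tiles_corner[OF T(1)] corner_convex by blast
    show "\<epsilon> * s + \<epsilon> * t = 1" using pos by (simp add: \<epsilon>_def flip: add_divide_distrib)
  qed (use T st pos in \<open>auto simp: \<epsilon>_def\<close>)
  ultimately have "v + \<epsilon> *\<^sub>R u \<in> T" by simp
  moreover have "0 < \<epsilon>" using pos by (simp add: \<epsilon>_def)
  ultimately show ?thesis using T(1,2) by blast
qed

lemma tiles_cover: "\<Union>tiles = UNIV"
proof (rule UNIV_eq_I[symmetric])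
  fix x
  let ?S = "{D \<in> P. snd D = 1}"
  have "?S \<noteq> {}"
    using radii_occur by auto
  then obtain D where D: "D \<in> ?S" "\<And>E. E \<in> ?S \<Longrightarrow> dist (fst D) x \<le> dist (fst E) x"
    using nearest[of ?S x] by blast
  define v where "v = fst D"
  have v: "(v, 1) \<in> P" using D by (metis (mono_tags) mem_Collect_eq prod.collapse v_def)
  show "x \<in> \<Union>tiles"
  proof (cases "x = v")
    case True
    obtain T where "T \<in> tiles" "v extreme_point_of T" using unit_star[OF v, of 1] by auto
    then show ?thesis using True by (auto simp: extreme_point_of_def)
  next
    case False
    then obtain T \<epsilon> where T: "T \<in> tiles" "v extreme_point_of T" "0 < \<epsilon>" "v + \<epsilon> *\<^sub>R (x - v) \<in> T"
      using unit_star[OF v, of "x - v"] by auto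
    then obtain b c where "corner T v b c" using tiles_corner corner_at_extreme by meson
    then have "x \<in> T"
    proof (rule corner_voronoi[OF _ T(3,4)])
      fix w assume "w extreme_point_of T"
      then have "(w, 1) \<in> P" using tiles_vertex T by blast
      then show "dist x v \<le> dist x w" using D(2)[of "(w, 1)"] by (simp add: v_def dist_commute)
    qed
    then show ?thesis using T by auto
  qed
qed

text \<open>The common point is within distance 1 of an end of each segment, which accounts for the
  four uses of \<open>main\<close>. If these ends differ, they are at distance at least 2, so the
  point is the midpoint of both segments and also of the two ends, and the segments coincide. If
  they agree, both segments leave the same point and share a further point only if they
  coincide.\<close>

lemma segments_cross:
  assumes P4: "(x, 1) \<in> P" "(y, 1) \<in> P" "(v, 1) \<in> P" "(w, 1) \<in> P" and d: "dist x y = 2" "dist v w = 2"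
    and z: "z \<in> closed_segment x y" "z \<in> closed_segment v w"
  shows "{x, y} = {v, w} \<or> z \<in> {x, y} \<inter> {v, w}"
proof -
  have main: "{x, y} = {v, w} \<or> z \<in> {x, y} \<inter> {v, w}"
    if "(x, 1) \<in> P" "(y, 1) \<in> P" "(v, 1) \<in> P" "(w, 1) \<in> P" "dist x y = 2" "dist v w = 2"
      "dist x z + dist z y = 2" "dist v z + dist z w = 2" "dist x z \<le> 1" "dist v z \<le> 1"
      "z \<in> closed_segment x y" "z \<in> closed_segment v w" for x y v w
  proof (cases "x = v")
    case True
    note zs = that(11,12)
    obtain s where s: "z = (1 - s) *\<^sub>R x + s *\<^sub>R y" "0 \<le> s" "s \<le> 1" using zs(1) unfolding in_segment by blast
    obtain t where t: "z = (1 - t) *\<^sub>R v + t *\<^sub>R w" "0 \<le> t" "t \<le> 1" using zs(2) unfolding in_segment by blast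
    have "z - x = s *\<^sub>R (y - x)" using s(1) by (simp add: algebra_simps)
    moreover have "z - v = t *\<^sub>R (w - v)" using t(1) by (simp add: algebra_simps)
    ultimately have zx: "z - x = s *\<^sub>R (y - x)" "z - x = t *\<^sub>R (w - x)" using True by auto
    have n: "norm (y - x) = 2" "norm (w - x) = 2" using that True by (auto simp: dist_norm norm_minus_commute)
    have "norm (z - x) = s * 2" using zx(1) n s by simp
    moreover have "norm (z - x) = t * 2" using zx(2) n t by simp
    ultimately have "s = t" by simp
    then have "s = 0 \<or> y = w" using zx by auto
    then show ?thesis using s True by auto
  next
    case False
    then have 2: "2 \<le> dist x v" using unit_dist that by auto
    have 1: "dist x v \<le> dist x z + dist v z" using dist_triangle2 by blast
    have eq: "dist x z = 1" "dist v z = 1" "dist z y = 1" "dist z w = 1" using 1 2 that by auto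
    have mid: "z = midpoint a b" if "dist a b = 2" "dist a z = 1" "dist z b = 1" for a b
    proof -
      have "between (a, b) z" using that by (simp add: between)
      then obtain s where s: "z = (1 - s) *\<^sub>R a + s *\<^sub>R b" "0 \<le> s"
        by (auto simp: between_mem_segment in_segment)
      then have "z - a = s *\<^sub>R (b - a)" by (simp add: algebra_simps)
      then have "norm (z - a) = s * norm (b - a)" using s by simp
      then have "1 = s * 2" using that by (simp add: dist_norm norm_minus_commute)
      then have hs: "s = 1/2" by simp
      have "z = (1 - 1/2) *\<^sub>R a + (1/2) *\<^sub>R b" using s(1) unfolding hs .
      then show ?thesis by (simp add: midpoint_def scaleR_add_right)
    qed
    have "dist x v = 2" using 1 2 eq by simp
    then have "z = midpoint x v" "z = midpoint x y" "z = midpoint v w"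
      using mid that eq by (auto simp: dist_commute)
    then have "y = v" "w = x" by (auto simp: midpoint_def)
    then show ?thesis by auto
  qed
  have sum: "dist x z + dist z y = 2" "dist v z + dist z w = 2"
    using z d by (auto simp: between_mem_segment[symmetric] between)
  have half: "dist x z \<le> 1 \<or> dist y z \<le> 1" "dist v z \<le> 1 \<or> dist w z \<le> 1"
    using sum by (auto simp: dist_commute)
  have sw: "z \<in> closed_segment y x" "z \<in> closed_segment w v" using z by (auto simp: closed_segment_commute)
  have sum': "dist y z + dist z x = 2" "dist w z + dist z v = 2" using sum by (auto simp: dist_commute)
  have d': "dist y x = 2" "dist w v = 2" using d by (auto simp: dist_commute)
  from half show ?thesis
    using main[OF P4(1,2,3,4) d sum(1,2) _ _ z(1,2)]
      main[OF P4(2,1,3,4) d'(1) d(2) sum'(1) sum(2) _ _ sw(1) z(2)]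
      main[OF P4(1,2,4,3) d(1) d'(2) sum(1) sum'(2) _ _ z(1) sw(2)]
      main[OF P4(2,1,4,3) d' sum' _ _ sw]
    by (auto simp: insert_commute)
qed

lemma tile_edge_drawn:
  assumes T: "T \<in> tiles" and c: "corner T v b c"
  shows "(v, 1) \<in> P" "(v + b, 1) \<in> P" "dist v (v + b) = 2" "closed_segment v (v + b) \<subseteq> drawn_segments P"
proof -
  show v: "(v, 1) \<in> P" using tiles_vertex[OF T corner_extreme[OF c]] .
  show vb: "(v + b, 1) \<in> P" using tiles_vertex[OF T] corner_next[OF c] corner_extreme by metis
  show d: "dist v (v + b) = 2" using corner_norm[OF c] by (simp add: dist_norm)
  show "closed_segment v (v + b) \<subseteq> drawn_segments P"
    unfolding drawn_segments_def using v vb d by (auto simp: tangent_def)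
qed

lemma tile_boundary_drawn:
  assumes T: "T \<in> tiles" shows "T - interior T \<subseteq> drawn_segments P"
proof
  fix x assume x: "x \<in> T - interior T"
  obtain v b c where "corner T v b c" using tiles_corner[OF T] by blast
  then obtain v b c where c: "corner T v b c" "x \<in> closed_segment v (v + b)"
    using corner_not_interior_edge x by blast
  then show "x \<in> drawn_segments P" using tile_edge_drawn(4)[OF T] by blast
qed

text \<open>No unit centre lies inside the tile, since it would be within distance 2 of a vertex. A
  segment through an interior point \<open>z\<close> therefore meets the boundary on its way to
  either end, at a point of an edge. By \<open>segments_cross\<close> the segment is this edge or
  the point is its end, so both ends are vertices of the tile at distance 2, and the segment is an
  edge after all.\<close>

lemma tile_interior_drawn:
  assumes T: "T \<in> tiles" shows "interior T \<inter> drawn_segments P = {}"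
proof (rule ccontr)
  assume "\<not> ?thesis"
  then obtain x y z where xy: "(x, 1) \<in> P" "(y, 1) \<in> P" "dist x y = 2" "z \<in> closed_segment x y" "z \<in> interior T"
    unfolding drawn_segments_def by (auto simp: tangent_def)
  obtain v0 b0 c0 where c0: "corner T v0 b0 c0" using tiles_corner[OF T] by blast
  have out: "x \<notin> interior T" if x: "(x, 1) \<in> P" for x
  proof
    assume i: "x \<in> interior T"
    then have "x \<in> T" using interior_subset by blast
    then obtain w where w: "w extreme_point_of T" "dist x w < 2" using corner_near_vertex[OF c0] by blast
    then have "x = w" using unit_dist[OF x tiles_vertex[OF T w(1)]] by force
    then show False using i w(1) extreme_point_not_in_interior by blast
  qed
  have end_vertex: "x extreme_point_of T \<or> (y extreme_point_of T \<and> closed_segment x y \<inter> interior T = {})"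
    if xy: "(x, 1) \<in> P" "(y, 1) \<in> P" "dist x y = 2" "z \<in> closed_segment x y" for x y
  proof -
    have "closed_segment x z \<inter> frontier (interior T) \<noteq> {}"
      using out[OF xy(1)] \<open>z \<in> interior T\<close> by (intro connected_Int_frontier) auto
    then obtain f where f: "f \<in> closed_segment x z" "f \<in> frontier (interior T)" by blast
    have "frontier (interior T) = T - interior T"
      using corner_closure_interior[OF c0] by (simp add: frontier_def)
    then obtain v b c where c: "corner T v b c" "f \<in> closed_segment v (v + b)"
      using corner_not_interior_edge[OF c0] f by blast
    have fz: "f \<noteq> z" using f(2) \<open>z \<in> interior T\<close> by (auto simp: frontier_def)
    have fs: "f \<in> closed_segment x y" using f(1) xy(4) by (meson closed_segment_subset ends_in_segment(1) convex_closed_segment subsetD)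
    note ed = tile_edge_drawn[OF T c(1)]
    from segments_cross[OF xy(1,2) ed(1,2) xy(3) ed(3) fs c(2)]
    show ?thesis
    proof
      assume "{x, y} = {v, v + b}"
      then have "closed_segment x y = closed_segment v (v + b)"
        by (simp only: segment_convex_hull)
      then have "z \<in> closed_segment v (v + b)" using xy(4) by blast
      then show ?thesis using corner_edge_interior[OF c(1)] \<open>z \<in> interior T\<close> by blast
    next
      assume e: "f \<in> {x, y} \<inter> {v, v + b}"
      have "f \<noteq> y"
      proof
        assume "f = y"
        then have "dist x z = dist x y + dist y z" using f(1)
          by (simp add: between_mem_segment[symmetric] between)
        moreover have "dist x y = dist x z + dist z y" using xy(4)
          by (simp add: between_mem_segment[symmetric] between)
        ultimately have "dist y z = 0" by (simp add: dist_commute)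
        then show False using fz \<open>f = y\<close> by simp
      qed
      then have "x \<in> {v, v + b}" using e by auto
      then have "x extreme_point_of T" using corner_extreme[OF c(1)] corner_next[OF c(1)] corner_extreme by (metis empty_iff insert_iff)
      then show ?thesis by blast
    qed
  qed
  have yx: "z \<in> closed_segment y x" "dist y x = 2" using xy by (auto simp: closed_segment_commute dist_commute)
  have "x extreme_point_of T" "y extreme_point_of T"
    using end_vertex[OF xy(1,2,3,4)] end_vertex[OF xy(2,1) yx(2,1)] xy(4,5) yx by blast+
  then obtain b c where c: "corner T x b c" using corner_at_extreme[OF c0] by blast
  have "y \<noteq> x" using xy(3) by auto
  then have "y = x + b \<or> y = x + c" using corner_vertex_dist(2)[OF c \<open>y extreme_point_of T\<close>] xy(3) by blast
  then show False using corner_edge_interior[OF c] corner_edge_interior[OF corner_swap[OF c]] xy(4,5) by blast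
qed

lemma tiling_of_packing_eq: "tiling_of_packing P = tiles"
  unfolding tiling_of_packing_def
  by (rule components_of_tiles(2)[OF tiles_corner tiles_cover tile_interior_drawn tile_boundary_drawn])

lemma interior_meets_tile:
  assumes "S \<in> tiles" "T \<in> tiles" "interior S \<inter> interior T \<noteq> {}"
  shows "S = T"
proof -
  have "interior S \<in> components (- drawn_segments P)" "interior T \<in> components (- drawn_segments P)"
    using components_of_tiles(1)[OF tiles_corner tiles_cover tile_interior_drawn tile_boundary_drawn] assms by auto
  then have "interior S = interior T" using assms(3) components_eq by blast
  then show ?thesis using corner_closure_interior tiles_corner assms by metis
qed

text \<open>It suffices to find, for each common point, a face of \<open>S\<close> through it that
  lies in \<open>T\<close>; the defining condition of a face then passes to the intersection. A
  common point is interior to neither tile, hence on an edge of each, and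
  \<open>segments_cross\<close> gives a common edge or a vertex.\<close>

lemma tile_int_face:
  assumes S: "S \<in> tiles" and T: "T \<in> tiles"
  shows "S \<inter> T face_of S"
proof (cases "S = T")
  case True
  moreover have "convex T" using tiles_corner[OF T] corner_convex by blast
  ultimately show ?thesis by (simp add: face_of_refl)
next
  case False
  obtain v0 b0 c0 where cS: "corner S v0 b0 c0" using tiles_corner[OF S] by blast
  obtain v1 b1 c1 where cT: "corner T v1 b1 c1" using tiles_corner[OF T] by blast
  have key: "\<exists>F. F face_of S \<and> x \<in> F \<and> F \<subseteq> T" if x: "x \<in> S" "x \<in> T" for x
  proof -
    have dis: "interior S \<inter> interior T = {}" using interior_meets_tile[OF S T] False by blast
    have "x \<notin> interior S"
    proof
      assume "x \<in> interior S"
      moreover have "x \<in> closure (interior T)" using x corner_closure_interior[OF cT] by simp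
      ultimately show False using dis open_Int_closure_eq_empty[of "interior S" "interior T"] by auto
    qed
    moreover have "x \<notin> interior T"
    proof
      assume "x \<in> interior T"
      moreover have "x \<in> closure (interior S)" using x corner_closure_interior[OF cS] by simp
      ultimately show False using dis open_Int_closure_eq_empty[of "interior T" "interior S"] by auto
    qed
    ultimately obtain v b c w b' c' where
      c: "corner S v b c" "x \<in> closed_segment v (v + b)" and c': "corner T w b' c'" "x \<in> closed_segment w (w + b')"
      using corner_not_interior_edge[OF cS] corner_not_interior_edge[OF cT] x by metis
    note eS = tile_edge_drawn[OF S c(1)] and eT = tile_edge_drawn[OF T c'(1)]
    from segments_cross[OF eS(1,2) eT(1,2) eS(3) eT(3) c(2) c'(2)]
    show ?thesis
    proof
      assume "{v, v + b} = {w, w + b'}"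
      then have "closed_segment v (v + b) = closed_segment w (w + b')"
        by (simp only: segment_convex_hull)
      then show ?thesis using corner_edge_face[OF c(1)] corner_edge_face[OF c'(1)] c(2)
        by (metis face_of_imp_subset)
    next
      assume "x \<in> {v, v + b} \<inter> {w, w + b'}"
      then have "x extreme_point_of S" using corner_extreme[OF c(1)] corner_next[OF c(1)] corner_extreme
        by (metis Int_iff empty_iff insert_iff)
      then show ?thesis using x by (intro exI[of _ "{x}"]) (auto simp: face_of_singleton)
    qed
  qed
  show ?thesis unfolding face_of_def
  proof (intro conjI ballI impI)
    show "convex (S \<inter> T)" using corner_convex cS cT convex_Int by blast
    fix a b x assume ab: "a \<in> S" "b \<in> S" "x \<in> S \<inter> T" "x \<in> open_segment a b"
    then obtain F where F: "F face_of S" "x \<in> F" "F \<subseteq> T" using key by blast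
    then have "a \<in> F" "b \<in> F" using face_ofD[OF F(1) ab(4) ab(1,2) F(2)] by auto
    then show "a \<in> S \<inter> T" "b \<in> S \<inter> T" using ab F by auto
  qed auto
qed

lemma tiling_of_packing_tiling: "rhombus_triangle_tiling alph (tiling_of_packing P)"
  unfolding tiling_of_packing_eq rhombus_triangle_tiling_def tiling_def
proof (intro conjI ballI)
  show "\<Union>tiles = UNIV" by (rule tiles_cover)
  show "pairwise (\<lambda>S T. interior S \<inter> interior T = {}) tiles"
    using interior_meets_tile by (auto simp: pairwise_def)
  show "S \<inter> T face_of S" "S \<inter> T face_of T" if "S \<in> tiles" "T \<in> tiles" for S T
    using tile_int_face[OF that] tile_int_face[OF that(2,1)] by (auto simp: Int_commute)
  show "rhombus_tile alph T \<or> triangle_tile T" if "T \<in> tiles" for T using tiles_kind[OF that] .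
  obtain p where p: "(p, rho) \<in> P" using radii_occur by auto
  obtain a b c d q where R: "rhombus alph a b c d" "small_pair rho a b c d p q"
        "(a, 1) \<in> P" "(b, 1) \<in> P" "(c, 1) \<in> P" "(d, 1) \<in> P" "(q, rho) \<in> P"
    by (rule small_rhombus[OF p])
  have "convex hull {a, b, c, d} \<in> tiles" using p R unfolding tiles_def by blast
  moreover have "rhombus_tile alph (convex hull {a, b, c, d})" using R(1) unfolding rhombus_tile_def by blast
  ultimately show "\<exists>T\<in>tiles. rhombus_tile alph T" by blast
qed

text \<open>The same tile may carry one labelling in \<open>tiles\<close> and another in
  \<open>packing_of_tiling\<close>. By \<open>rhombus_hull_unique\<close> the long diagonal is the
  same, and it determines the pair of small centres.\<close>

lemma packing_of_tiling_of_packing: "packing_of_tiling rho alph (tiling_of_packing P) = P"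
proof (intro equalityI subsetI)
  fix D assume "D \<in> packing_of_tiling rho alph (tiling_of_packing P)"
  then show "D \<in> P" unfolding tiling_of_packing_eq
  proof (cases rule: packing_of_tilingE)
    case unit then show ?thesis using tiles_vertex by simp
  next
    case 2: (small p q a b c d)
    then obtain a' b' c' d' p' q' where R: "convex hull {a, b, c, d} = convex hull {a', b', c', d'}" "rhombus alph a' b' c' d'"
      "small_pair rho a' b' c' d' p' q'" "(p', rho) \<in> P" "(q', rho) \<in> P"
      unfolding tiles_def using rhombus_not_triangle[OF 2(2)] by blast
    have "{a, c} = {a', c'}" by (rule rhombus_hull_unique(1)[OF 2(2) R(2,1)])
    then have "{p, q} = {p', q'}"
      using small_pair_iff[OF 2(2)] small_pair_iff[OF R(2)] 2(4) R(3) by (auto simp: doubleton_eq_iff)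
    then show ?thesis using 2(1) R(4,5) by (auto simp: doubleton_eq_iff)
  qed
next
  fix D assume D: "D \<in> P"
  then consider v where "D = (v, 1)" | p where "D = (p, rho)" using rad[OF D] by (cases D) auto
  then show "D \<in> packing_of_tiling rho alph (tiling_of_packing P)"
  proof cases
    case 1
    then obtain T where "T \<in> tiles" "v extreme_point_of T" using unit_star[of v 1] D by auto
    then show ?thesis unfolding 1 tiling_of_packing_eq by (rule packing_of_tiling_unitI)
  next
    case 2
    obtain a b c d q where R: "rhombus alph a b c d" "small_pair rho a b c d p q"
        "(a, 1) \<in> P" "(b, 1) \<in> P" "(c, 1) \<in> P" "(d, 1) \<in> P" "(q, rho) \<in> P"
      by (rule small_rhombus[of p]) (use D 2 in simp)
    have "convex hull {a, b, c, d} \<in> tiles" using D 2 R unfolding tiles_def by blast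
    then show ?thesis unfolding 2 tiling_of_packing_eq by (rule packing_of_tiling_smallI(1)[OF R(1) _ R(2)])
  qed
qed

end

section \<open>From tilings to packings\<close>

text \<open>The sides may be given in either orientation; if \<open>cross\<close> is negative,
  \<open>E\<close> and \<open>F\<close> exchange their roles.\<close>

lemma cone_coverI:
  assumes "E \<in> P" "F \<in> P" "tangent D E" "tangent D F" "tangent E F"
    and c: "cross (fst E - fst D) (fst F - fst D) \<noteq> 0"
    and u: "u = s *\<^sub>R (fst E - fst D) + t *\<^sub>R (fst F - fst D)" "0 \<le> s" "0 \<le> t"
  shows "\<exists>E\<in>P. \<exists>F\<in>P. tangent D E \<and> tangent D F \<and> tangent E F \<and>
      0 < cross (fst E - fst D) (fst F - fst D) \<and>
      0 \<le> cross (fst E - fst D) u \<and> 0 \<le> cross u (fst F - fst D)"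
proof -
  let ?e = "fst E - fst D" and ?f = "fst F - fst D"
  have x: "cross ?e u = t * cross ?e ?f" "cross u ?f = s * cross ?e ?f"
    "cross ?f u = s * cross ?f ?e" "cross u ?e = t * cross ?f ?e"
    unfolding u(1) by (auto simp: cross_def algebra_simps)
  show ?thesis
  proof (cases "0 < cross ?e ?f")
    case True
    then show ?thesis using assms(1-5) u(2,3) by (intro bexI[of _ E] bexI[of _ F]) (auto simp: x)
  next
    case False
    then have "0 < cross ?f ?e" using c cross_swap[of ?f ?e] by simp
    then show ?thesis using assms(1-5) u(2,3) tangent_sym[OF assms(5)]
      by (intro bexI[of _ F] bexI[of _ E]) (auto simp: x)
  qed
qed

lemma small_ratio_bounds: "0 < small_ratio" "small_ratio < 1/2"
  using rho_bounds by (auto simp: small_ratio_def)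

lemma rhombus_cross: "rhombus alph a b c d \<Longrightarrow> cross (b - a) (d - a) \<noteq> 0"
  using corner_cross rhombus_corner by blast

lemma small_pair_swap: "small_pair r a b c d p q \<Longrightarrow> small_pair r c d a b q p"
proof -
  have "{c, d, a, b} = {a, b, c, d}" by auto
  then show "small_pair r a b c d p q \<Longrightarrow> small_pair r c d a b q p"
    using tangent_sym by (auto simp: small_pair_def)
qed

locale rt_tiling =
  fixes \<T> assumes tiling: "rhombus_triangle_tiling alph \<T>"
begin

abbreviation "Q \<equiv> packing_of_tiling rho alph \<T>"

lemma cover: "\<Union>\<T> = UNIV"
  using tiling by (simp add: rhombus_triangle_tiling_def tiling_def)

lemma faces: "S \<in> \<T> \<Longrightarrow> T \<in> \<T> \<Longrightarrow> S \<inter> T face_of S" "S \<in> \<T> \<Longrightarrow> T \<in> \<T> \<Longrightarrow> S \<inter> T face_of T"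
  using tiling by (auto simp: rhombus_triangle_tiling_def tiling_def)

lemma kind: "T \<in> \<T> \<Longrightarrow> rhombus_tile alph T \<or> triangle_tile T"
  using tiling by (simp add: rhombus_triangle_tiling_def)

lemma tile: "T \<in> \<T> \<Longrightarrow> \<exists>v b c. corner T v b c"
  using kind tile_corner by blast

lemma interior_meets:
  assumes "S \<in> \<T>" "T \<in> \<T>" "x \<in> interior S" "x \<in> T" shows "S = T"
proof (rule ccontr)
  assume "S \<noteq> T"
  then have "interior S \<inter> interior T = {}"
    using tiling assms by (auto simp: rhombus_triangle_tiling_def tiling_def pairwise_def)
  moreover have "closure (interior T) = T" using tile[OF assms(2)] corner_closure_interior by blast
  ultimately have "interior S \<inter> T = {}" using open_Int_closure_eq_empty[of "interior S" "interior T"] by auto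
  then show False using assms by auto
qed

text \<open>This is where the edge-to-edge condition enters: the vertex is a face of
  \<open>S\<close> inside the intersection, hence a face of the intersection, which is a face of
  \<open>T\<close>.\<close>

lemma vertex_transfer:
  assumes "S \<in> \<T>" "T \<in> \<T>" "v extreme_point_of S" "v \<in> T" shows "v extreme_point_of T"
proof -
  have "{v} face_of S" using assms(3) by (simp add: face_of_singleton)
  moreover have "{v} \<subseteq> S \<inter> T" using assms(3,4) by (auto simp: extreme_point_of_def)
  ultimately have "{v} face_of S \<inter> T" by (rule face_of_subset) auto
  then have "{v} face_of T" using faces(2)[OF assms(1,2)] by (rule face_of_trans)
  then show ?thesis by (simp add: face_of_singleton)
qed

lemma finite_near_tiles: "finite {T \<in> \<T>. T \<inter> cball x 1 \<noteq> {}}"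
proof -
  have "\<forall>T\<in>\<T>. \<exists>m. cball m (1/4) \<subseteq> T" using tile corner_inball by blast
  then obtain f where f: "\<And>T. T \<in> \<T> \<Longrightarrow> cball (f T) (1/4) \<subseteq> T" by metis
  have fi: "ball (f T) (1/4) \<subseteq> interior T" if "T \<in> \<T>" for T
    using f[OF that] ball_subset_cball by (intro interior_maximal) (blast, simp)
  \<comment> \<open>Inscribed discs of radius 1/4 have disjoint interiors, so their centres are 1/2
    apart. A tile meeting the unit disc at \<open>x\<close> lies within distance 4 of one of its
    vertices, which puts its chosen centre within 4 + 4 + 1 of \<open>x\<close>.\<close>
  have "finite {T \<in> \<T>. dist (f T) x \<le> 9}"
  proof (rule separated_finite[of "1/2"])
    fix S T assume ST: "S \<in> \<T>" "T \<in> \<T>" "S \<noteq> T"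
    have "ball (f S) (1/4) \<inter> ball (f T) (1/4) = {}"
    proof (rule ccontr)
      assume "ball (f S) (1/4) \<inter> ball (f T) (1/4) \<noteq> {}"
      then obtain z where "z \<in> interior S" "z \<in> T" using fi[OF ST(1)] fi[OF ST(2)] interior_subset by blast
      then show False using interior_meets ST by blast
    qed
    then show "1/2 \<le> dist (f S) (f T)" using disjoint_balls_dist[of "1/4" "1/4"] by simp
  qed simp
  moreover have "dist (f T) x \<le> 9" if T: "T \<in> \<T>" "T \<inter> cball x 1 \<noteq> {}" for T
  proof -
    obtain v b c where "corner T v b c" using tile[OF T(1)] by blast
    then have sub: "T \<subseteq> cball v 4" by (rule corner_subset_cball)
    obtain y where y: "y \<in> T" "dist x y \<le> 1" using T(2) by auto
    have "f T \<in> T" using f[OF T(1)] by auto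
    then have "dist v (f T) \<le> 4" "dist v y \<le> 4" using sub y by auto
    then show ?thesis using y(2) dist_triangle[of "f T" x v] dist_triangle[of v x y] by (simp add: dist_commute)
  qed
  then have "{T \<in> \<T>. T \<inter> cball x 1 \<noteq> {}} \<subseteq> {T \<in> \<T>. dist (f T) x \<le> 9}" by blast
  ultimately show ?thesis using finite_subset by blast
qed

text \<open>The tiles near \<open>v\<close> that miss \<open>v\<close> form a finite union of closed
  sets, so a neighbourhood of \<open>v\<close> avoids them. A point of this neighbourhood in
  direction \<open>u\<close> lies in a tile that contains \<open>v\<close>, and
  \<open>vertex_transfer\<close> makes \<open>v\<close> a vertex of it.\<close>

lemma star:
  assumes S: "S \<in> \<T>" "v extreme_point_of S" and u: "u \<noteq> 0"
  shows "\<exists>T\<in>\<T>. v extreme_point_of T \<and> (\<exists>\<epsilon>>0. v + \<epsilon> *\<^sub>R u \<in> T)"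
proof -
  let ?K = "{T \<in> \<T>. T \<inter> cball v 1 \<noteq> {}}"
  let ?F = "\<Union>{T \<in> ?K. v \<notin> T}"
  have "closed ?F"
  proof (rule closed_Union)
    show "finite {T \<in> ?K. v \<notin> T}" by (rule finite_subset[OF _ finite_near_tiles[of v]]) blast
    show "\<forall>T\<in>{T \<in> ?K. v \<notin> T}. closed T" using tile corner_compact compact_imp_closed by blast
  qed
  then have "open (- ?F)" by (rule open_Compl)
  moreover have "v \<in> - ?F" by blast
  ultimately obtain e where e: "0 < e" "ball v e \<subseteq> - ?F" by (rule openE)
  \<comment> \<open>The step stays inside the ball of radius \<open>e\<close> and, because of the
    bound 1, among the tiles to which local finiteness applies.\<close>
  define \<epsilon> where "\<epsilon> = min (e/2) 1 / norm u"
  have \<epsilon>: "0 < \<epsilon>" "\<epsilon> * norm u < e" "\<epsilon> * norm u \<le> 1" using e(1) u by (auto simp: \<epsilon>_def)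
  let ?x = "v + \<epsilon> *\<^sub>R u"
  have dx: "dist v ?x = \<epsilon> * norm u" using \<epsilon>(1) by (simp add: dist_norm)
  obtain T where T: "T \<in> \<T>" "?x \<in> T" using cover by blast
  have "?x \<in> cball v 1" using dx \<epsilon>(3) by simp
  then have "T \<in> ?K" using T by blast
  moreover have "?x \<in> ball v e" using dx \<epsilon>(2) by simp
  then have "?x \<notin> ?F" using e(2) by blast
  ultimately have "v \<in> T" using T(2) by blast
  then have "v extreme_point_of T" using vertex_transfer[OF S(1) T(1) S(2)] by simp
  then show ?thesis using T \<epsilon>(1) by blast
qed

lemma unit_disc_covered:
  assumes S: "S \<in> \<T>" "v extreme_point_of S" and x: "dist x v \<le> 1"
  shows "\<exists>T\<in>\<T>. v extreme_point_of T \<and> x \<in> T"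
proof (cases "x = v")
  case True
  then show ?thesis using S by (auto simp: extreme_point_of_def)
next
  case False
  then obtain T \<epsilon> where T: "T \<in> \<T>" "v extreme_point_of T" "0 < \<epsilon>" "v + \<epsilon> *\<^sub>R (x - v) \<in> T"
    using star[OF S, of "x - v"] by auto
  moreover obtain b c where "corner T v b c" using tile[OF T(1)] corner_at_extreme T(2) by meson
  ultimately show ?thesis using corner_unit_sector x by blast
qed

text \<open>If the unit discs overlapped, a common point would lie in a tile at \<open>v\<close>.
  Shared boundary points would prove nothing, so it is moved into the interior of this tile while
  staying in both discs. The tile at \<open>w\<close> that contains it is then the same tile, whose
  vertices are at least 2 apart.\<close>

lemma vertex_dist:
  assumes S: "S \<in> \<T>" "v extreme_point_of S" and S': "S' \<in> \<T>" "w extreme_point_of S'" and ne: "v \<noteq> w"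
  shows "2 \<le> dist v w"
proof (rule ccontr)
  assume "\<not> ?thesis"
  then have "ball v 1 \<inter> ball w 1 \<noteq> {}" using disjoint_balls_dist[of 1 1 v w] by simp
  then obtain x where x: "x \<in> ball v 1 \<inter> ball w 1" by blast
  then have "dist x v \<le> 1" by (simp add: dist_commute less_imp_le)
  then obtain T where T: "T \<in> \<T>" "v extreme_point_of T" "x \<in> T" using unit_disc_covered[OF S] by blast
  have "x \<in> closure (interior T)" using tile[OF T(1)] corner_closure_interior T(3) by blast
  then have "(ball v 1 \<inter> ball w 1) \<inter> interior T \<noteq> {}"
    using open_Int_closure_eq_empty[of "ball v 1 \<inter> ball w 1" "interior T"] x by blast
  then obtain y where "y \<in> interior T" "y \<in> ball w 1" by blast
  then have y: "y \<in> interior T" "dist y w \<le> 1" by (auto simp: dist_commute)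
  then obtain T' where T': "T' \<in> \<T>" "w extreme_point_of T'" "y \<in> T'" using unit_disc_covered[OF S'] by blast
  have "T = T'" using interior_meets[OF T(1) T'(1) y(1) T'(3)] .
  then obtain b c where "corner T v b c" using tile[OF T(1)] corner_at_extreme T(2) by meson
  then show False using corner_vertex_dist(1)[of T v b c w] T'(2) \<open>T = T'\<close> ne \<open>\<not> 2 \<le> dist v w\<close> by blast
qed

lemma Q_unitD: "(v, 1) \<in> Q \<Longrightarrow> \<exists>T\<in>\<T>. v extreme_point_of T"
  using rho_bounds by (elim packing_of_tilingE) auto

lemma Q_smallD:
  assumes "(p, rho) \<in> Q"
  obtains q a b c d where "rhombus alph a b c d" "convex hull {a, b, c, d} \<in> \<T>" "small_pair rho a b c d p q"
  using assms
proof (cases rule: packing_of_tilingE)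
  case (unit v T)
  then show ?thesis using rho_bounds by simp
next
  case (small p' q' a b c d)
  show ?thesis
  proof (cases "p = p'")
    case True then show ?thesis using that small by blast
  next
    case False
    then have pq: "p = q'" using small(1) by auto
    have e: "{c, d, a, b} = {a, b, c, d}" by auto
    show ?thesis
      by (rule that[OF rhombus_turn[OF small(2)], of p']) (use small(3) small_pair_swap[OF small(4)] e pq in auto)
  qed
qed

lemma Q_rad: "D \<in> Q \<Longrightarrow> snd D \<in> {1, rho}"
  by (elim packing_of_tilingE) auto

lemma small_ball_interior: "small_pair rho a b c d p q \<Longrightarrow> ball p rho \<subseteq> interior (convex hull {a, b, c, d})"
  by (rule interior_maximal) (auto simp: small_pair_def region_def)

text \<open>A small open disc lies in the interior of its rhombus. If it met the unit disc at
  \<open>v\<close>, the tile at \<open>v\<close> covering the common point would be this rhombus, so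
  \<open>v\<close> would be one of its vertices, where the distances are known.\<close>

lemma unit_small_dist:
  assumes v: "(v, 1) \<in> Q" and p: "(p, rho) \<in> Q"
  shows "1 + rho \<le> dist v p"
proof (rule ccontr)
  assume less: "\<not> ?thesis"
  then have "ball v 1 \<inter> ball p rho \<noteq> {}" using disjoint_balls_dist[of 1 rho v p] rho_pos by simp
  then obtain y where y: "y \<in> ball v 1" "y \<in> ball p rho" by blast
  obtain q a b c d where R: "rhombus alph a b c d" "convex hull {a, b, c, d} \<in> \<T>" "small_pair rho a b c d p q"
    by (rule Q_smallD[OF p])
  obtain S where "S \<in> \<T>" "v extreme_point_of S" using Q_unitD[OF v] by blast
  moreover have "dist y v \<le> 1" using y(1) by (simp add: dist_commute)
  ultimately obtain T where T: "T \<in> \<T>" "v extreme_point_of T" "y \<in> T" using unit_disc_covered by blast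
  have "convex hull {a, b, c, d} = T"
    using interior_meets[OF R(2) T(1) _ T(3)] small_ball_interior[OF R(3)] y(2) by blast
  then have "v \<in> {a, b, c, d}" using T(2) rhombus_extreme_iff[OF R(1)] by blast
  moreover have "p = a + small_ratio *\<^sub>R (c - a)" using small_pair_iff[OF R(1)] R(3) by blast
  ultimately have "1 + rho \<le> dist p v" using small_centre_dist[OF R(1), of p] by auto
  then show False using less by (simp add: dist_commute)
qed

lemma small_small_dist:
  assumes p: "(p, rho) \<in> Q" and p': "(p', rho) \<in> Q" and ne: "p \<noteq> p'"
  shows "rho + rho \<le> dist p p'"
proof (rule ccontr)
  assume less: "\<not> ?thesis"
  then have "ball p rho \<inter> ball p' rho \<noteq> {}" using disjoint_balls_dist[of rho rho p p'] rho_pos by simp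
  then obtain y where y: "y \<in> ball p rho" "y \<in> ball p' rho" by blast
  obtain q a b c d where R: "rhombus alph a b c d" "convex hull {a, b, c, d} \<in> \<T>" "small_pair rho a b c d p q"
    by (rule Q_smallD[OF p])
  obtain q' a' b' c' d' where R': "rhombus alph a' b' c' d'" "convex hull {a', b', c', d'} \<in> \<T>" "small_pair rho a' b' c' d' p' q'"
    by (rule Q_smallD[OF p'])
  have "convex hull {a, b, c, d} = convex hull {a', b', c', d'}"
    using interior_meets[OF R(2) R'(2)] small_ball_interior[OF R(3)] small_ball_interior[OF R'(3)] y interior_subset by blast
  then have "{a, c} = {a', c'}" by (rule rhombus_hull_unique(1)[OF R(1) R'(1)])
  then have "p' = q" using ne R(3) R'(3) small_pair_iff[OF R(1)] small_pair_iff[OF R'(1)] by (auto simp: doubleton_eq_iff)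
  then show False using less R(3) by (simp add: small_pair_def tangent_def)
qed

lemma Q_cases:
  assumes "D \<in> Q"
  obtains v where "D = (v, 1)" | p where "D = (p, rho)"
  using Q_rad[OF assms] by (cases D) auto

lemma Q_sep:
  assumes "D \<in> Q" "E \<in> Q" "D \<noteq> E" shows "snd D + snd E \<le> dist (fst D) (fst E)"
  using assms(1)
proof (cases rule: Q_cases)
  case D: (1 v)
  from assms(2) show ?thesis
  proof (cases rule: Q_cases)
    case (1 w)
    then show ?thesis using vertex_dist Q_unitD[of v] Q_unitD[of w] D assms by fastforce
  next
    case (2 p) then show ?thesis using unit_small_dist D assms by auto
  qed
next
  case D: (2 p)
  from assms(2) show ?thesis
  proof (cases rule: Q_cases)
    case (1 w) then show ?thesis using unit_small_dist[of w p] D assms by (simp add: dist_commute)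
  next
    case (2 p') then show ?thesis using small_small_dist D assms by auto
  qed
qed

lemma Q_pos: "D \<in> Q \<Longrightarrow> 0 < snd D"
  using Q_rad[of D] rho_pos by auto

lemma Q_packing: "packing Q"
  unfolding packing_iff using Q_pos Q_sep by blast

lemma corner_edge_Q:
  assumes T: "T \<in> \<T>" and c: "corner T v b c"
  shows "closed_segment v (v + b) \<subseteq> drawn_segments Q"
proof -
  have "(v, 1) \<in> Q" using packing_of_tiling_unitI[OF T corner_extreme[OF c]] .
  moreover have "(v + b, 1) \<in> Q" using corner_next[OF c] corner_extreme packing_of_tiling_unitI[OF T] by metis
  moreover have "tangent (v, 1) (v + b, 1)" using corner_norm[OF c] by (simp add: tangent_def dist_norm)
  ultimately show ?thesis unfolding drawn_segments_def by blast
qed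

lemma tile_boundary_Q:
  assumes T: "T \<in> \<T>" shows "T - interior T \<subseteq> drawn_segments Q"
proof
  fix x assume x: "x \<in> T - interior T"
  obtain v b c where "corner T v b c" using tile[OF T] by blast
  then obtain v b c where "corner T v b c" "x \<in> closed_segment v (v + b)"
    using corner_not_interior_edge x by blast
  then show "x \<in> drawn_segments Q" using corner_edge_Q[OF T] by blast
qed

text \<open>Once the segment is known to be an edge of the tile \<open>T0\<close> that it enters,
  its point \<open>z\<close> belongs to \<open>T0\<close> and is interior to \<open>T\<close>. This
  forces \<open>T = T0\<close>, but no edge meets the interior of its own tile.\<close>

lemma tile_interior_Q:
  assumes T: "T \<in> \<T>" shows "interior T \<inter> drawn_segments Q = {}"
proof (rule ccontr)
  assume "\<not> ?thesis"
  then obtain x y z where xy: "(x, 1) \<in> Q" "(y, 1) \<in> Q" "dist x y = 2" "z \<in> closed_segment x y" "z \<in> interior T"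
    unfolding drawn_segments_def by (auto simp: tangent_def)
  obtain S where S: "S \<in> \<T>" "x extreme_point_of S" using Q_unitD[OF xy(1)] by blast
  have "y - x \<noteq> 0" using xy(3) by auto
  then obtain T0 \<epsilon> where T0: "T0 \<in> \<T>" "x extreme_point_of T0" "0 < \<epsilon>" "x + \<epsilon> *\<^sub>R (y - x) \<in> T0"
    using star[OF S] by blast
  obtain b c where c: "corner T0 x b c" using tile[OF T0(1)] corner_at_extreme T0(2) by meson
  obtain w where w: "w extreme_point_of T0" "dist y w < 2" using corner_sector_dist2[OF c T0(3,4) xy(3)] by blast
  have "w = y" using vertex_dist[of _ y T0 w] Q_unitD[OF xy(2)] T0(1) w by fastforce
  then have "y = x + b \<or> y = x + c" using corner_vertex_dist(2)[OF c, of y] w(1) xy(3) \<open>y - x \<noteq> 0\<close> by auto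
  then have e: "closed_segment x y face_of T0" "closed_segment x y \<inter> interior T0 = {}"
    using corner_edge_face[OF c] corner_edge_face[OF corner_swap[OF c]]
      corner_edge_interior[OF c] corner_edge_interior[OF corner_swap[OF c]] by auto
  then have "z \<in> T0" using xy(4) face_of_imp_subset by blast
  then have "T = T0" using interior_meets[OF T T0(1) xy(5)] by simp
  then show False using e(2) xy(4,5) by blast
qed

lemma tiling_of_packing_of_tiling: "tiling_of_packing Q = \<T>"
  unfolding tiling_of_packing_def
  by (rule components_of_tiles(2)[OF tile cover tile_interior_Q tile_boundary_Q])

lemma rhombus_Q:
  assumes "rhombus alph a b c d" "convex hull {a, b, c, d} \<in> \<T>"
  shows "(a, 1) \<in> Q" "(b, 1) \<in> Q" "(c, 1) \<in> Q" "(d, 1) \<in> Q"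
  using packing_of_tiling_unitI[OF assms(2)] rhombus_extreme_iff[OF assms(1)] by auto

text \<open>Around \<open>p\<close> the neighbours b, q, d, a span four cones that cover all
  directions; the one containing \<open>u\<close> is found explicitly.\<close>

lemma small_cone:
  assumes p: "(p, rho) \<in> Q"
  shows "\<exists>E\<in>Q. \<exists>F\<in>Q. tangent (p, rho) E \<and> tangent (p, rho) F \<and> tangent E F \<and>
      0 < cross (fst E - p) (fst F - p) \<and> 0 \<le> cross (fst E - p) u \<and> 0 \<le> cross u (fst F - p)"
proof -
  obtain q a b c d where R: "rhombus alph a b c d" "convex hull {a, b, c, d} \<in> \<T>" "small_pair rho a b c d p q"
    by (rule Q_smallD[OF p])
  note V = rhombus_Q[OF R(1,2)]
  have qQ: "(q, rho) \<in> Q" using packing_of_tiling_smallI(2)[OF R] .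
  have t: "tangent (p, rho) (q, rho)" "tangent (p, rho) (a, 1)" "tangent (p, rho) (b, 1)" "tangent (p, rho) (d, 1)"
    "tangent (q, rho) (b, 1)" "tangent (q, rho) (d, 1)" "tangent (b, 1) (q, rho)" "tangent (d, 1) (q, rho)"
    using R(3) tangent_sym by (auto simp: small_pair_def)
  have t2: "tangent (b, 1) (a, 1)" "tangent (d, 1) (a, 1)"
    using R(1) by (auto simp: rhombus_def tangent_def dist_commute)
  have pq: "p = a + small_ratio *\<^sub>R (c - a)" "q = c + small_ratio *\<^sub>R (a - c)" using R small_pair_iff by blast+
  define \<beta> \<delta> \<kappa> where "\<beta> = b - a" and "\<delta> = d - a" and "\<kappa> = 1 - 2 * small_ratio"
  have k: "0 < \<kappa>" using small_ratio_bounds by (simp add: \<kappa>_def)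
  have c: "c - a = \<beta> + \<delta>" using R(1) by (simp add: rhombus_iff \<beta>_def \<delta>_def)
  have vq: "q - p = \<kappa> *\<^sub>R (\<beta> + \<delta>)" unfolding pq c[symmetric] \<kappa>_def by (simp add: complex_eq_iff algebra_simps)
  have va: "a - p = (- small_ratio) *\<^sub>R (\<beta> + \<delta>)" unfolding pq c[symmetric] by simp
  have vb: "b - p = (1/2) *\<^sub>R (\<kappa> *\<^sub>R (\<beta> + \<delta>) + (\<beta> - \<delta>))"
    unfolding pq c \<kappa>_def by (simp add: complex_eq_iff \<beta>_def field_simps)
  have vd: "d - p = (1/2) *\<^sub>R (\<kappa> *\<^sub>R (\<beta> + \<delta>) - (\<beta> - \<delta>))"
    unfolding pq c \<kappa>_def by (simp add: complex_eq_iff \<delta>_def field_simps)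
  have X: "cross \<beta> \<delta> \<noteq> 0" using rhombus_cross[OF R(1)] by (simp add: \<beta>_def \<delta>_def)
  obtain A B where AB: "u = A *\<^sub>R \<beta> + B *\<^sub>R \<delta>" using dual_basis[OF X] by metis
  \<comment> \<open>Coordinates along the two diagonals. Since \<open>b\<close> and \<open>d\<close>
    lie on opposite sides of the long diagonal, the sign of \<open>h\<close> chooses between them;
    removing the multiple of that side leaves a vector along the long diagonal, whose sign chooses
    \<open>q\<close> or \<open>a\<close>.\<close>
  define g h where "g = (A + B) / 2" and "h = (A - B) / 2"
  have u: "u = g *\<^sub>R (\<beta> + \<delta>) + h *\<^sub>R (\<beta> - \<delta>)"
    unfolding AB g_def h_def by (simp add: complex_eq_iff field_simps)
  have cr: "cross (b - p) (q - p) = \<kappa> * cross \<beta> \<delta>" "cross (b - p) (a - p) = - small_ratio * cross \<beta> \<delta>"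
    "cross (d - p) (q - p) = - \<kappa> * cross \<beta> \<delta>" "cross (d - p) (a - p) = small_ratio * cross \<beta> \<delta>"
    unfolding vb vq va vd by (simp_all add: cross_def algebra_simps)
  have sr: "0 < small_ratio" by (rule small_ratio_bounds)
  consider "0 \<le> h" "h * \<kappa> \<le> g" | "0 \<le> h" "g < h * \<kappa>" | "h < 0" "- h * \<kappa> \<le> g" | "h < 0" "g < - h * \<kappa>" by linarith
  then show ?thesis
  proof cases
    case 1
    have "u = (2 * h) *\<^sub>R (b - p) + ((g - h * \<kappa>) / \<kappa>) *\<^sub>R (q - p)"
      unfolding u vb vq using k by (simp add: complex_eq_iff field_simps)
    then show ?thesis using cone_coverI[of "(b, 1)" Q "(q, rho)" "(p, rho)" u "2 * h" "(g - h * \<kappa>) / \<kappa>"]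
      V qQ t k cr X 1 by auto
  next
    case 2
    have "u = (2 * h) *\<^sub>R (b - p) + ((h * \<kappa> - g) / small_ratio) *\<^sub>R (a - p)"
      unfolding u vb va using sr by (simp add: complex_eq_iff field_simps)
    then show ?thesis using cone_coverI[of "(b, 1)" Q "(a, 1)" "(p, rho)" u "2 * h" "(h * \<kappa> - g) / small_ratio"]
      V t t2 sr cr X 2 by auto
  next
    case 3
    have "u = (- 2 * h) *\<^sub>R (d - p) + ((g + h * \<kappa>) / \<kappa>) *\<^sub>R (q - p)"
      unfolding u vd vq using k by (simp add: complex_eq_iff field_simps)
    then show ?thesis using cone_coverI[of "(d, 1)" Q "(q, rho)" "(p, rho)" u "- 2 * h" "(g + h * \<kappa>) / \<kappa>"]
      V qQ t k cr X 3 by auto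
  next
    case 4
    have "u = (- 2 * h) *\<^sub>R (d - p) + ((- h * \<kappa> - g) / small_ratio) *\<^sub>R (a - p)"
      unfolding u vd va using sr by (simp add: complex_eq_iff field_simps)
    then show ?thesis using cone_coverI[of "(d, 1)" Q "(a, 1)" "(p, rho)" u "- 2 * h" "(- h * \<kappa> - g) / small_ratio"]
      V t t2 sr cr X 4 by auto
  qed
qed

lemma sector_par:
  assumes "0 < \<epsilon>" "v + \<epsilon> *\<^sub>R u \<in> par_at v b c \<or> v + \<epsilon> *\<^sub>R u \<in> tri_at v b c"
  obtains s t where "u = s *\<^sub>R b + t *\<^sub>R c" "0 \<le> s" "0 \<le> t"
proof -
  obtain s t where st: "v + \<epsilon> *\<^sub>R u = v + s *\<^sub>R b + t *\<^sub>R c" "0 \<le> s" "0 \<le> t"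
    using assms(2) by (auto simp: par_at_def tri_at_def)
  have "u = (1 / \<epsilon>) *\<^sub>R (\<epsilon> *\<^sub>R u)" using assms(1) by simp
  also have "\<epsilon> *\<^sub>R u = s *\<^sub>R b + t *\<^sub>R c" using st(1) by (simp add: add.assoc)
  finally have "u = (s / \<epsilon>) *\<^sub>R b + (t / \<epsilon>) *\<^sub>R c" by (simp add: scaleR_add_right)
  then show ?thesis using that[of "s / \<epsilon>" "t / \<epsilon>"] st assms(1) by simp
qed

text \<open>The tile entered in direction \<open>u\<close> is cut into cones by its small discs: at
  an acute vertex of a rhombus by one of them, at an obtuse vertex by both, and in a triangle by
  none. In each cone the two sides are centres of discs tangent to each other and to the disc at
  \<open>v\<close>.\<close>

lemma unit_cone:
  assumes v: "(v, 1) \<in> Q" and u0: "u \<noteq> 0"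
  shows "\<exists>E\<in>Q. \<exists>F\<in>Q. tangent (v, 1) E \<and> tangent (v, 1) F \<and> tangent E F \<and>
      0 < cross (fst E - v) (fst F - v) \<and> 0 \<le> cross (fst E - v) u \<and> 0 \<le> cross u (fst F - v)"
proof -
  obtain T \<epsilon> where T: "T \<in> \<T>" "v extreme_point_of T" "0 < \<epsilon>" "v + \<epsilon> *\<^sub>R u \<in> T"
    using star[OF _ _ u0] Q_unitD[OF v] by blast
  have acute: ?thesis if R: "rhombus alph v b c d" "T = convex hull {v, b, c, d}" for b c d
  proof -
    have RT: "convex hull {v, b, c, d} \<in> \<T>" using T R by simp
    note V = rhombus_Q[OF R(1) RT]
    obtain p q where s: "small_pair rho v b c d p q" using small_pair_iff[OF R(1)] by blast
    have pQ: "(p, rho) \<in> Q" using packing_of_tiling_smallI(1)[OF R(1) RT s] .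
    have t: "tangent (v, 1) (p, rho)" "tangent (b, 1) (p, rho)" "tangent (d, 1) (p, rho)" "tangent (v, 1) (b, 1)" "tangent (v, 1) (d, 1)"
      using s R(1) tangent_sym[of "(p, rho)"] by (auto simp: small_pair_def rhombus_def tangent_def dist_commute)
    obtain x y where xy: "u = x *\<^sub>R (b - v) + y *\<^sub>R (d - v)" "0 \<le> x" "0 \<le> y"
      using sector_par T(3,4) unfolding R(2) rhombus_hull[OF R(1)] by blast
    have "p = v + small_ratio *\<^sub>R (c - v)" using small_pair_iff[OF R(1)] s by blast
    then have vp: "p - v = small_ratio *\<^sub>R ((b - v) + (d - v))" using R(1) by (simp add: rhombus_iff)
    have X: "cross (b - v) (d - v) \<noteq> 0" by (rule rhombus_cross[OF R(1)])
    have cr: "cross (b - v) (p - v) = small_ratio * cross (b - v) (d - v)" "cross (d - v) (p - v) = - small_ratio * cross (b - v) (d - v)"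
      unfolding vp by (simp_all add: cross_def algebra_simps)
    have sr: "0 < small_ratio" by (rule small_ratio_bounds)
    show ?thesis
    proof (cases "y \<le> x")
      case True
      have "u = (x - y) *\<^sub>R (b - v) + (y / small_ratio) *\<^sub>R (p - v)"
        unfolding xy(1) vp using sr by (simp add: complex_eq_iff field_simps)
      then show ?thesis using cone_coverI[of "(b, 1)" Q "(p, rho)" "(v, 1)" u "x - y" "y / small_ratio"]
        V pQ t sr cr X xy True by auto
    next
      case False
      have "u = (y - x) *\<^sub>R (d - v) + (x / small_ratio) *\<^sub>R (p - v)"
        unfolding xy(1) vp using sr by (simp add: complex_eq_iff field_simps)
      then show ?thesis using cone_coverI[of "(d, 1)" Q "(p, rho)" "(v, 1)" u "y - x" "x / small_ratio"]
        V pQ t sr cr X xy False by auto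
    qed
  qed
  have obtuse: ?thesis if R: "rhombus alph a v c d" "T = convex hull {a, v, c, d}" for a c d
  proof -
    have RT: "convex hull {a, v, c, d} \<in> \<T>" using T R by simp
    note V = rhombus_Q[OF R(1) RT]
    obtain p q where s: "small_pair rho a v c d p q" using small_pair_iff[OF R(1)] by blast
    have pQ: "(p, rho) \<in> Q" "(q, rho) \<in> Q" using packing_of_tiling_smallI[OF R(1) RT s] .
    have t: "tangent (v, 1) (p, rho)" "tangent (v, 1) (q, rho)" "tangent (a, 1) (p, rho)" "tangent (c, 1) (q, rho)" "tangent (p, rho) (q, rho)"
      "tangent (v, 1) (a, 1)" "tangent (v, 1) (c, 1)"
      using s R(1) tangent_sym[of "(p, rho)"] tangent_sym[of "(q, rho)"] by (auto simp: small_pair_def rhombus_def tangent_def dist_commute)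
    \<comment> \<open>In the coordinates along the edges to the acute vertices the small centres are
      (m, l) and (l, m). Since l < m, the directions follow each other as \<open>A\<close>,
      \<open>p\<close>, \<open>q\<close>, \<open>C\<close>, which gives three cones.\<close>
    define A C l m where "A = a - v" and "C = c - v" and "l = small_ratio" and "m = 1 - small_ratio"
    have lm: "0 < l" "l < m" using small_ratio_bounds by (auto simp: l_def m_def)
    have d: "d - a = C" using R(1) by (simp add: rhombus_iff C_def)
    have "par_at a (v - a) (d - a) = par_at v A C"
      using par_at_next[of a "v - a" "d - a"] unfolding d by (simp add: A_def)
    then obtain x y where xy: "u = x *\<^sub>R A + y *\<^sub>R C" "0 \<le> x" "0 \<le> y"
      using sector_par T(3,4) unfolding R(2) rhombus_hull[OF R(1)] by metis
    have pq: "p = a + small_ratio *\<^sub>R (c - a)" "q = c + small_ratio *\<^sub>R (a - c)" using small_pair_iff[OF R(1)] s by blast+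
    have vp: "p - v = m *\<^sub>R A + l *\<^sub>R C" "q - v = l *\<^sub>R A + m *\<^sub>R C"
      unfolding pq by (simp_all add: A_def C_def l_def m_def complex_eq_iff algebra_simps)
    have "cross (v - a) (d - a) \<noteq> 0" by (rule rhombus_cross[OF R(1)])
    moreover have "cross (v - a) (d - a) = - cross A C" unfolding d by (simp add: cross_def A_def algebra_simps)
    ultimately have X: "cross A C \<noteq> 0" by simp
    have cr: "cross A (p - v) = l * cross A C" "cross C (q - v) = - l * cross A C"
      "cross (p - v) (q - v) = (m + l) * (m - l) * cross A C"
      unfolding vp by (simp_all add: cross_def algebra_simps)
    have av: "a - v = A" "c - v = C" by (simp_all add: A_def C_def)
    consider "y * m \<le> x * l" | "x * m \<le> y * l" | "x * l < y * m" "y * l < x * m" by linarith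
    then show ?thesis
    proof cases
      case 1
      have "u = (x - y * m / l) *\<^sub>R A + (y / l) *\<^sub>R (p - v)"
        unfolding xy(1) vp using lm by (simp add: complex_eq_iff field_simps)
      moreover have "0 \<le> x - y * m / l" using 1 lm by (simp add: field_simps)
      ultimately show ?thesis using cone_coverI[of "(a, 1)" Q "(p, rho)" "(v, 1)" u "x - y * m / l" "y / l"]
        V pQ t lm cr X xy av by auto
    next
      case 2
      have "u = (y - x * m / l) *\<^sub>R C + (x / l) *\<^sub>R (q - v)"
        unfolding xy(1) vp using lm by (simp add: complex_eq_iff field_simps)
      moreover have "0 \<le> y - x * m / l" using 2 lm by (simp add: field_simps)
      ultimately show ?thesis using cone_coverI[of "(c, 1)" Q "(q, rho)" "(v, 1)" u "y - x * m / l" "x / l"]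
        V pQ t lm cr X xy av by auto
    next
      case 3
      \<comment> \<open>The determinant m^2 - l^2 of the coordinates of the two small centres, as
        needed for Cramer's rule in the middle cone.\<close>
      define D where "D = (m + l) * (m - l)"
      have D: "0 < D" using lm by (simp add: D_def)
      have "D *\<^sub>R u = (x * m - y * l) *\<^sub>R (p - v) + (y * m - x * l) *\<^sub>R (q - v)"
        unfolding xy(1) vp D_def by (simp add: complex_eq_iff algebra_simps)
      then have "u = (1 / D) *\<^sub>R ((x * m - y * l) *\<^sub>R (p - v) + (y * m - x * l) *\<^sub>R (q - v))"
        using D by (metis divide_self_if less_irrefl scaleR_one scaleR_scaleR times_divide_eq_left mult.left_neutral)
      then have "u = ((x * m - y * l) / D) *\<^sub>R (p - v) + ((y * m - x * l) / D) *\<^sub>R (q - v)"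
        by (simp add: scaleR_add_right)
      then show ?thesis using cone_coverI[of "(p, rho)" Q "(q, rho)" "(v, 1)" u "(x * m - y * l) / D" "(y * m - x * l) / D"]
        V pQ t D cr(3) X 3 unfolding D_def[symmetric] by auto
    qed
  qed
  have triangle: ?thesis if R: "dist v y = 2" "dist y z = 2" "dist z v = 2" "T = convex hull {v, y, z}" for y z
  proof -
    have V: "(y, 1) \<in> Q" "(z, 1) \<in> Q"
      using packing_of_tiling_unitI[OF T(1)] triangle_extreme_iff[OF R(1-3)] R(4) by auto
    have n: "norm (y - v) = 2" "norm (z - v) = 2" "norm ((y - v) - (z - v)) = 2"
      using R by (auto simp: dist_norm norm_minus_commute)
    then have "(y - v) \<bullet> (z - v) = 2" unfolding dot_norm_neg n by simp
    moreover have Tt: "T = tri_at v (y - v) (z - v)" using R(4) by (simp flip: convex_hull_tri)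
    ultimately have "corner T v (y - v) (z - v)" using n by (simp add: corner_def)
    then have X: "cross (y - v) (z - v) \<noteq> 0" by (rule corner_cross)
    obtain s t where "u = s *\<^sub>R (y - v) + t *\<^sub>R (z - v)" "0 \<le> s" "0 \<le> t"
      using sector_par T(3,4) unfolding Tt by blast
    then show ?thesis using cone_coverI[of "(y, 1)" Q "(z, 1)" "(v, 1)" u s t] V R X
      by (auto simp: tangent_def dist_commute)
  qed
  from kind[OF T(1)] show ?thesis
  proof
    assume "rhombus_tile alph T"
    then obtain a b c d where R: "rhombus alph a b c d" "T = convex hull {a, b, c, d}" by (auto simp: rhombus_tile_def)
    have e: "{c, d, a, b} = {a, b, c, d}" "{a, d, c, b} = {a, b, c, d}" by auto
    have "v = a \<or> v = b \<or> v = c \<or> v = d" using T(2) rhombus_extreme_iff[OF R(1)] R(2) by auto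
    then show ?thesis
      using acute[of b c d] obtuse[of a c d] acute[of d a b] obtuse[of a c b] R rhombus_turn[OF R(1)] rhombus_flip[OF R(1)] e
      by auto
  next
    assume "triangle_tile T"
    then obtain x y z where R: "dist x y = 2" "dist y z = 2" "dist z x = 2" "T = convex hull {x, y, z}"
      by (auto simp: triangle_tile_def)
    have e: "{y, z, x} = {x, y, z}" "{z, x, y} = {x, y, z}" by auto
    have "v = x \<or> v = y \<or> v = z" using T(2) triangle_extreme_iff[OF R(1-3)] R(4) by auto
    then show ?thesis using triangle[of y z] triangle[of z x] triangle[of x y] R e by auto
  qed
qed

lemma Q_finite_near: "finite {D \<in> Q. dist (fst D) c \<le> R}"
proof (rule separated_finite[of "2 * rho"])
  fix D E assume DE: "D \<in> Q" "E \<in> Q" "D \<noteq> E"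
  have "snd D + snd E \<le> dist (fst D) (fst E)" by (rule Q_sep[OF DE])
  moreover have "rho \<le> snd D" "rho \<le> snd E"
    using Q_rad[OF DE(1)] Q_rad[OF DE(2)] rho_bounds by auto
  ultimately show "2 * rho \<le> dist (fst D) (fst E)" by simp
qed (simp add: rho_pos)

text \<open>The cones come from the tiles at the disc, and \<open>no_disc_between\<close> shows that
  they contain no further neighbours. Finiteness holds because tangent discs have centres at
  distance at most 2 and all centres are separated by 2 \<open>rho\<close>.\<close>

lemma Q_surrounded:
  assumes D: "D \<in> Q" shows "surrounded Q D"
proof (rule surroundedI[OF _ Q_pos D])
  have "{E \<in> Q. tangent D E} \<subseteq> {E \<in> Q. dist (fst E) (fst D) \<le> 2}"
  proof safe
    fix x s assume E: "(x, s) \<in> Q" "tangent D (x, s)"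
    show "dist (fst (x, s)) (fst D) \<le> 2"
      using Q_rad[OF E(1)] Q_rad[OF D] E(2) rho_bounds by (auto simp: tangent_def dist_commute)
  qed
  then show "finite {E \<in> Q. tangent D E}" using Q_finite_near finite_subset by blast
next
  fix u :: complex assume u: "u \<noteq> 0"
  from D show "\<exists>E\<in>Q. \<exists>F\<in>Q. tangent D E \<and> tangent D F \<and> tangent E F \<and>
      0 < cross (fst E - fst D) (fst F - fst D) \<and>
      0 \<le> cross (fst E - fst D) u \<and> 0 \<le> cross u (fst F - fst D)"
  proof (cases rule: Q_cases)
    case (1 v) then show ?thesis using unit_cone[OF _ u, of v] D unfolding 1 by (simp only: fst_conv)
  next
    case (2 p) then show ?thesis using small_cone[of p u] D unfolding 2 by (simp only: fst_conv)
  qed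
next
  fix E F G assume *: "E \<in> Q" "F \<in> Q" "G \<in> Q" "tangent D E" "tangent D F" "tangent D G" "tangent E F"
      "0 < cross (fst E - fst D) (fst F - fst D)"
      "0 \<le> cross (fst E - fst D) (fst G - fst D)" "0 \<le> cross (fst G - fst D) (fst F - fst D)"
  show "G = E \<or> G = F"
    by (rule no_disc_between[OF *(4-7) Q_rad[OF D] Q_rad[OF *(1)] Q_rad[OF *(2)] Q_rad[OF *(3)] _ _ *(8-10)])
      (use Q_sep * in blast)+
qed

lemma Q_compact: "compact_packing_using 1 rho Q"
proof -
  obtain T where T: "T \<in> \<T>" "rhombus_tile alph T" using tiling by (auto simp: rhombus_triangle_tiling_def)
  then obtain a b c d where R: "rhombus alph a b c d" "T = convex hull {a, b, c, d}" by (auto simp: rhombus_tile_def)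
  then have RT: "convex hull {a, b, c, d} \<in> \<T>" using T by simp
  obtain p q where s: "small_pair rho a b c d p q" using small_pair_iff[OF R(1)] by blast
  have "(a, 1) \<in> Q" "(p, rho) \<in> Q" using rhombus_Q(1)[OF R(1) RT] packing_of_tiling_smallI(1)[OF R(1) RT s] .
  then have "{1, rho} \<subseteq> snd ` Q" by force
  moreover have "snd ` Q \<subseteq> {1, rho}" using Q_rad by blast
  ultimately show ?thesis
    unfolding compact_packing_using_def compact_packing_def using Q_packing Q_surrounded by auto
qed

end

theorem mainTheorem7:
  fixes r \<alpha> :: real
  assumes "r = (sqrt 17 - 3) / 4"
    and "\<alpha> = 2 * arccos ((-1 + sqrt 17) / 4)"
  shows "bij_betw tiling_of_packing
           {P. compact_packing_using 1 r P} {\<T>. rhombus_triangle_tiling \<alpha> \<T>} \<and>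
         bij_betw (packing_of_tiling r \<alpha>)
           {\<T>. rhombus_triangle_tiling \<alpha> \<T>} {P. compact_packing_using 1 r P} \<and>
         (\<forall>P. compact_packing_using 1 r P \<longrightarrow> packing_of_tiling r \<alpha> (tiling_of_packing P) = P) \<and>
         (\<forall>\<T>. rhombus_triangle_tiling \<alpha> \<T> \<longrightarrow> tiling_of_packing (packing_of_tiling r \<alpha> \<T>) = \<T>)"
proof -
  have r: "r = rho" and \<alpha>: "\<alpha> = alph" using assms by (auto simp: rho_def alph_def)
  have P: "rhombus_triangle_tiling alph (tiling_of_packing P)" "packing_of_tiling rho alph (tiling_of_packing P) = P"
    if "compact_packing_using 1 rho P" for P
  proof -
    interpret compact_one_rho P using that by unfold_locales
    show "rhombus_triangle_tiling alph (tiling_of_packing P)" "packing_of_tiling rho alph (tiling_of_packing P) = P"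
      by (rule tiling_of_packing_tiling packing_of_tiling_of_packing)+
  qed
  have T: "compact_packing_using 1 rho (packing_of_tiling rho alph \<T>)" "tiling_of_packing (packing_of_tiling rho alph \<T>) = \<T>"
    if "rhombus_triangle_tiling alph \<T>" for \<T>
  proof -
    interpret rt_tiling \<T> using that by unfold_locales
    show "compact_packing_using 1 rho (packing_of_tiling rho alph \<T>)" "tiling_of_packing (packing_of_tiling rho alph \<T>) = \<T>"
      by (rule Q_compact tiling_of_packing_of_tiling)+
  qed
  have "bij_betw tiling_of_packing {P. compact_packing_using 1 rho P} {\<T>. rhombus_triangle_tiling alph \<T>}"
    by (rule bij_betwI[where g = "packing_of_tiling rho alph"]) (use P T in auto)
  moreover have "bij_betw (packing_of_tiling rho alph) {\<T>. rhombus_triangle_tiling alph \<T>} {P. compact_packing_using 1 rho P}"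
    by (rule bij_betwI[where g = tiling_of_packing]) (use P T in auto)
  ultimately show ?thesis unfolding r \<alpha> using P T by blast
qed

end
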